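(* Let $q$ be a prime power and let $n\geq 5$, $I$, $J$ be integers with $0<I<J<n$ and $\gcd(J-I,n)=1$. Assume $q\geq 2^{\frac{13}{3}n+4}$ and let $\alpha\in\mathbb{F}_{q^n}\setminus\{0\}$. Then the binomial $f(x)=x^{q^I}+\alpha x^{q^J}$ is scattered over $\mathbb{F}_{q^n}$ if and only if $I+J=n$ and $\mathrm{N}_{q^n/q}(\alpha)\neq 1$.
   Context: An $\mathbb{F}_q$-linearized polynomial $f\in\mathbb{F}_{q^n}[x]$ is called scattered (over $\mathbb{F}_{q^n}$) if for all $x,y\in\mathbb{F}_{q^n}^*$, $\frac{f(x)}{x}=\frac{f(y)}{y}$ implies $\frac{x}{y}\in\mathbb{F}_q$. Here $\mathrm{N}_{q^n/q}(\alpha)=\alpha^{(q^n-1)/(q-1)}$ is the norm from $\mathbb{F}_{q^n}$ to $\mathbb{F}_q$. *)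

theory Defs
  imports
    Complex_Main
    "HOL-Library.Cardinality"
    "HOL-Computational_Algebra.Polynomial"
    "HOL-Number_Theory.Prime_Powers"
begin

definition is_subfield :: "'a::field set \<Rightarrow> bool" where
  "is_subfield K \<longleftrightarrow>
     0 \<in> K \<and> 1 \<in> K \<and>
     (\<forall>x\<in>K. \<forall>y\<in>K. x + y \<in> K) \<and> (\<forall>x\<in>K. - x \<in> K) \<and>
     (\<forall>x\<in>K. \<forall>y\<in>K. x * y \<in> K) \<and> (\<forall>x\<in>K. x \<noteq> 0 \<longrightarrow> inverse x \<in> K)"

definition linearized_poly :: "nat \<Rightarrow> 'a::field poly \<Rightarrow> bool" where
  "linearized_poly q f \<longleftrightarrow> (\<forall>k. coeff f k \<noteq> 0 \<longrightarrow> (\<exists>i. k = q ^ i))"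

text \<open>Here the ambient type is the field with \<open>q ^ n\<close> elements and \<open>K\<close> is its subfield
  with \<open>q = card K\<close> elements.\<close>

definition scattered :: "'a::field set \<Rightarrow> 'a poly \<Rightarrow> bool" where
  "scattered K f \<longleftrightarrow>
     linearized_poly (card K) f \<and>
     (\<forall>x y. x \<noteq> 0 \<longrightarrow> y \<noteq> 0 \<longrightarrow> poly f x / x = poly f y / y \<longrightarrow> x / y \<in> K)"

text \<open>The division in the exponent is exact, the quotient being \<open>1 + q + \<dots> + q ^ (n - 1)\<close>.\<close>

definition fq_norm :: "nat \<Rightarrow> nat \<Rightarrow> 'a::field \<Rightarrow> 'a" where
  "fq_norm q n a = a ^ ((q ^ n - 1) div (q - 1))"

end

theory Submission
  imports "HOL-Algebra.Algebraic_Closure_Type" Defs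
begin

text \<open>
  Writing \<open>x = z y\<close>, the binomial fails to be scattered iff
  \<open>(z^(q^I) - z) y^(q^I) = -\<alpha> (z^(q^J) - z) y^(q^J)\<close> for some \<open>z \<notin> K\<close> and \<open>y \<noteq> 0\<close>; since \<open>J - I\<close> is prime
  to \<open>n\<close>, Hilbert's Theorem 90 turns this into \<open>N(z^(q^I) - z) = N(-\<alpha>) N(z^(q^J) - z)\<close> for some \<open>z \<notin> K\<close>.
  If \<open>I + J = n\<close>, the two norms differ by the factor \<open>N(-1)\<close>, and the criterion \<open>N(\<alpha>) \<noteq> 1\<close> follows.

  If \<open>I + J \<noteq> n\<close>, the norm equation has a solution \<open>z \<notin> K\<close> for every nonzero \<open>c \<in> K\<close> in place of
  \<open>N(-\<alpha>)\<close>. Restrict \<open>z\<close> to the family \<open>z = a(x) + s b(x) + t e\<close> with \<open>x, s, t \<in> K\<close>; its conjugates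
  \<open>X_i = a_i(x) + s b_i(x) + t e_i\<close> turn the equation into a surface \<open>G(x, s, t) = 0\<close> over \<open>K\<close>, monic of degree \<open>n\<close> in \<open>t\<close>
  up to a constant. The polynomials \<open>a\<close>, \<open>b\<close> are interpolated so that the fibre over one point \<open>x0\<close> of the algebraic closure is quadratic
  in \<open>s\<close>, irreducible, and has a branch at which \<open>t\<close> vanishes to order exactly two in \<open>s - s0\<close>.
  Assuming that the surface has no \<open>K\<close>-points, Stepanov's method in two variables gives a contradiction: a nonzero polynomial
  \<open>\<Psi>\<close> in \<open>x, s, t, x^q, s^q, t^q\<close> is constructed that vanishes to order \<open>m\<close> along the surface over
  all \<open>K\<close>-rational base points (the absence of \<open>K\<close>-points says that \<open>t^q\<close> is a second root, different from \<open>t\<close>, which saves the decisive factor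
  \<open>(n - 1) / n\<close> in the count of conditions). By degree \<open>\<Psi>\<close> is then a multiple of \<open>G\<close>, whereas the
  expansion along the ramified branch over \<open>x0\<close> shows that it is not.
\<close>

section \<open>Weighted polynomial functions\<close>

text \<open>Along a line the degree of \<open>\<Psi>\<close> is about q (b + n^2), and vanishing to
  order m at almost q points kills a polynomial only if its degree stays below about m q. So m has
  to exceed b, and then, without the factor (n - 1) / n, there would always be at least as many
  conditions as unknown coefficients. Absolute irreducibility of the whole surface is never
  established: a quantitative bound for the vanishing along one branch of one fibre takes its place.
  The special point x0 is chosen in F outside K because there the values a_i(x0), b_i(x0) of the n
  conjugate polynomials can be prescribed independently, whereas over a point of K they are
  conjugate to each other. Prescribing b_i(x0) = 0 for all i \<noteq> 0 leaves s in a single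
  conjugate, and this makes the fibre quadratic in s. The size of q enters as q \<ge> 600 n^7, which
  outweighs all degrees that occur.\<close>

lemma homogeneous_system_nontrivial:
  fixes L :: "'e \<Rightarrow> 'u \<Rightarrow> 'k::field"
  assumes "finite B" "finite A" "card B < card A"
  shows "\<exists>c. (\<exists>a\<in>A. c a \<noteq> 0) \<and> (\<forall>b\<in>B. (\<Sum>a\<in>A. L b a * c a) = 0)"
  using assms
proof (induction B arbitrary: A L rule: finite_induct)
  case empty
  then have "A \<noteq> {}" by auto
  then show ?case by (intro exI[of _ "\<lambda>_. 1"]) auto
next
  case (insert b B)
  show ?case
  proof (cases "\<forall>a\<in>A. L b a = 0")
    case True
    have "card B < card A" using insert.prems insert.hyps by simp
    then show ?thesis using insert.IH[OF insert.prems(1), of L] True by auto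
  next
    case False
    then obtain a0 where a0: "a0 \<in> A" "L b a0 \<noteq> 0" by auto
    \<comment> \<open>Row \<open>b\<close>, solved for the unknown \<open>a0\<close>, is substituted
      into the other rows.\<close>
    define L' where "L' = (\<lambda>b' a. L b' a - L b' a0 / L b a0 * L b a)"
    have "card B < card (A - {a0})" using insert.prems insert.hyps a0 by simp
    then obtain c where c: "\<exists>a\<in>A-{a0}. c a \<noteq> 0" "\<forall>b'\<in>B. (\<Sum>a\<in>A-{a0}. L' b' a * c a) = 0"
      using insert.IH[of "A - {a0}" L'] insert.prems(1) by blast
    define c' where "c' = c(a0 := - (\<Sum>a\<in>A-{a0}. L b a * c a) / L b a0)"
    have sm: "(\<Sum>a\<in>A. L b' a * c' a) = L b' a0 * c' a0 + (\<Sum>a\<in>A-{a0}. L b' a * c a)" for b'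
      using a0 insert.prems(1) by (subst sum.remove[of _ a0]) (auto simp: c'_def intro!: sum.cong)
    have "(\<Sum>a\<in>A. L b' a * c' a) = 0" if "b' \<in> insert b B" for b'
    proof (cases "b' = b")
      case True
      then show ?thesis unfolding sm using a0 by (simp add: c'_def)
    next
      case False
      then have "(\<Sum>a\<in>A-{a0}. L' b' a * c a) = 0" using c that by auto
      then have "(\<Sum>a\<in>A-{a0}. L b' a * c a) = L b' a0 / L b a0 * (\<Sum>a\<in>A-{a0}. L b a * c a)"
        by (simp add: L'_def algebra_simps sum_subtractf sum_distrib_left)
      then show ?thesis unfolding sm using a0 by (simp add: c'_def)
    qed
    moreover have "\<exists>a\<in>A. c' a \<noteq> 0" using c(1) unfolding c'_def by auto
    ultimately show ?thesis by blast
  qed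
qed

text \<open>\<open>pw wt mt S N w r f\<close>: the function \<open>f\<close> is given by a polynomial in the variables \<open>v 0, \<dots>, v (N - 1)\<close> with
  coefficients in \<open>S\<close>, of weighted degree at most \<open>w\<close> for the weights \<open>wt\<close> and at most \<open>r\<close> for \<open>mt\<close>.\<close>

inductive pw :: "(nat \<Rightarrow> int) \<Rightarrow> (nat \<Rightarrow> int) \<Rightarrow> 'r set \<Rightarrow> nat \<Rightarrow> int \<Rightarrow> int
    \<Rightarrow> ((nat \<Rightarrow> 'r) \<Rightarrow> 'r::comm_ring_1) \<Rightarrow> bool"
  for wt mt S N where
  zero: "pw wt mt S N w r (\<lambda>v. 0)"
| const: "c \<in> S \<Longrightarrow> 0 \<le> w \<Longrightarrow> 0 \<le> r \<Longrightarrow> pw wt mt S N w r (\<lambda>v. c)"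
| var: "i < N \<Longrightarrow> wt i \<le> w \<Longrightarrow> mt i \<le> r \<Longrightarrow> pw wt mt S N w r (\<lambda>v. v i)"
| add: "pw wt mt S N w r f \<Longrightarrow> pw wt mt S N w r g \<Longrightarrow> pw wt mt S N w r (\<lambda>v. f v + g v)"
| mult: "pw wt mt S N w r f \<Longrightarrow> pw wt mt S N w' r' g \<Longrightarrow> pw wt mt S N (w + w') (r + r') (\<lambda>v. f v * g v)"

lemma pw_mono: "pw wt mt S N w r f \<Longrightarrow> w \<le> w' \<Longrightarrow> r \<le> r' \<Longrightarrow> pw wt mt S N w' r' f"
proof (induction arbitrary: w' r' rule: pw.induct)
  case (mult w r f w2 r2 g)
  have "pw wt mt S N (w' - w2) (r' - r2) f" using mult by (intro mult.IH) auto
  from pw.mult[OF this mult.hyps(2)] show ?case by simp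
qed (auto intro: pw.intros)

lemma pw_vars_mono: "pw wt mt S N w r f \<Longrightarrow> N \<le> N' \<Longrightarrow> pw wt mt S N' w r f"
  by (induction rule: pw.induct) (auto intro: pw.intros)

lemma pw_mult': "pw wt mt S N w r f \<Longrightarrow> pw wt mt S N w' r' g \<Longrightarrow> w + w' \<le> w2 \<Longrightarrow> r + r' \<le> r2
    \<Longrightarrow> pw wt mt S N w2 r2 (\<lambda>v. f v * g v)"
  by (blast intro: pw.mult pw_mono)

lemma pw_sum:
  "(\<And>i. i \<in> A \<Longrightarrow> pw wt mt S N w r (f i)) \<Longrightarrow> pw wt mt S N w r (\<lambda>v. \<Sum>i\<in>A. f i v)"
  by (induction A rule: infinite_finite_induct) (auto intro: pw.intros)

lemma pw_uminus:
  "pw wt mt S N w r f \<Longrightarrow> -1 \<in> S \<Longrightarrow> pw wt mt S N w r (\<lambda>v. - f v)"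
  using pw_mult'[OF pw.const[of "-1" S 0 0], of wt mt N w r f w r] by simp

lemma pw_diff:
  "pw wt mt S N w r f \<Longrightarrow> pw wt mt S N w r g \<Longrightarrow> -1 \<in> S \<Longrightarrow> pw wt mt S N w r (\<lambda>v. f v - g v)"
  using pw.add[OF _ pw_uminus, of wt mt S N w r f g] by simp

lemma pw_power:
  "pw wt mt S N w r f \<Longrightarrow> 1 \<in> S \<Longrightarrow> pw wt mt S N (int k * w) (int k * r) (\<lambda>v. f v ^ k)"
proof (induction k)
  case 0 then show ?case by (auto intro: pw.const)
next
  case (Suc k)
  from pw_mult'[OF Suc.prems(1) Suc.IH[OF Suc.prems]] show ?case by (simp add: algebra_simps)
qed

lemma pw_prod:
  assumes "\<And>i. i \<in> A \<Longrightarrow> pw wt mt S N w r (f i)" "1 \<in> S" "finite A"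
  shows "pw wt mt S N (int (card A) * w) (int (card A) * r) (\<lambda>v. \<Prod>i\<in>A. f i v)"
  using assms(3,1)
proof (induction A rule: finite_induct)
  case empty then show ?case using assms(2) by (auto intro: pw.const)
next
  case (insert a A)
  then have "pw wt mt S N w r (f a)" "pw wt mt S N (int (card A) * w) (int (card A) * r) (\<lambda>v. \<Prod>i\<in>A. f i v)"
    by auto
  from pw_mult'[OF this] insert.hyps show ?case by (simp add: algebra_simps)
qed

text \<open>Polynomial functions respect congruences. With \<open>d = 0\<close> this says that only
  the first N variables matter; with \<open>d\<close> a power of Y it compares values along arcs
  that agree to some order.\<close>

lemma pw_cong_dvd:
  assumes "pw wt mt S N w r f" "\<And>i. i < N \<Longrightarrow> d dvd (v i - v' i)"
  shows "d dvd (f v - f v')"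
  using assms
proof (induction rule: pw.induct)
  case (add w r f g)
  have "d dvd (f v - f v') + (g v - g v')" using add by (intro dvd_add) auto
  then show ?case by (simp add: algebra_simps)
next
  case (mult w r f w' r' g)
  have "d dvd (f v - f v') * g v + f v' * (g v - g v')" using mult by (intro dvd_add dvd_mult dvd_mult2) auto
  then show ?case by (simp add: algebra_simps)
qed auto

lemma pw_cong:
  assumes "pw wt mt S N w r f" "\<And>i. i < N \<Longrightarrow> v i = v' i"
  shows "f v = f v'"
  using pw_cong_dvd[OF assms(1), of 0 v v'] assms(2) by simp

text \<open>\<open>pw\<close> describes functions, not polynomials, so exponents have to be
  recovered by expanding; a list of monomials suffices, since like terms never have to be
  merged.\<close>

lemma pw_monomials:
  fixes f :: "(nat \<Rightarrow> 'r::comm_ring_1) \<Rightarrow> 'r"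
  assumes "pw wt mt S N w r f" "1 \<in> S" "\<And>a b. a \<in> S \<Longrightarrow> b \<in> S \<Longrightarrow> a * b \<in> S"
  shows "\<exists>L. (\<forall>(c,ex)\<in>set L. c \<in> S \<and> (\<Sum>i<N. wt i * int (ex i)) \<le> w \<and> (\<Sum>i<N. mt i * int (ex i)) \<le> r) \<and>
     (\<forall>v. f v = (\<Sum>(c,ex)\<leftarrow>L. c * (\<Prod>i<N. v i ^ ex i)))"
  using assms(1)
proof (induction rule: pw.induct)
  case zero
  then show ?case by (intro exI[of _ "[]"]) auto
next
  case (const c w r)
  then show ?case by (intro exI[of _ "[(c, \<lambda>_. 0)]"]) auto
next
  case (var i w r)
  have "(\<Prod>j<N. v j ^ (if j = i then 1 else 0)) = v i" for v :: "nat \<Rightarrow> 'r"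
  proof -
    have "(\<Prod>j<N. v j ^ (if j = i then 1 else 0)) = (\<Prod>j<N. if j = i then v j else 1)"
      by (intro prod.cong) auto
    then show ?thesis using var by (simp add: prod.delta)
  qed
  moreover have "(\<Sum>j<N. u j * int (if j = i then 1 else 0)) = u i" for u :: "nat \<Rightarrow> int"
  proof -
    have "(\<Sum>j<N. u j * int (if j = i then 1 else 0)) = (\<Sum>j<N. if j = i then u j else 0)"
      by (intro sum.cong) auto
    then show ?thesis using var by (simp add: sum.delta)
  qed
  ultimately show ?case using var assms(2) by (intro exI[of _ "[(1, \<lambda>j. if j = i then 1 else 0)]"]) auto
next
  case (add w r f g)
  then obtain L1 L2 where
    L1: "\<forall>(c,ex)\<in>set L1. c \<in> S \<and> (\<Sum>i<N. wt i * int (ex i)) \<le> w \<and> (\<Sum>i<N. mt i * int (ex i)) \<le> r"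
        "\<forall>v. f v = (\<Sum>(c,ex)\<leftarrow>L1. c * (\<Prod>i<N. v i ^ ex i))" and
    L2: "\<forall>(c,ex)\<in>set L2. c \<in> S \<and> (\<Sum>i<N. wt i * int (ex i)) \<le> w \<and> (\<Sum>i<N. mt i * int (ex i)) \<le> r"
        "\<forall>v. g v = (\<Sum>(c,ex)\<leftarrow>L2. c * (\<Prod>i<N. v i ^ ex i))" by blast
  then show ?case by (intro exI[of _ "L1 @ L2"]) auto
next
  case (mult w r f w' r' g)
  then obtain L1 L2 where
    L1: "\<forall>(c,ex)\<in>set L1. c \<in> S \<and> (\<Sum>i<N. wt i * int (ex i)) \<le> w \<and> (\<Sum>i<N. mt i * int (ex i)) \<le> r"
        "\<forall>v. f v = (\<Sum>(c,ex)\<leftarrow>L1. c * (\<Prod>i<N. v i ^ ex i))" and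
    L2: "\<forall>(c,ex)\<in>set L2. c \<in> S \<and> (\<Sum>i<N. wt i * int (ex i)) \<le> w' \<and> (\<Sum>i<N. mt i * int (ex i)) \<le> r'"
        "\<forall>v. g v = (\<Sum>(c,ex)\<leftarrow>L2. c * (\<Prod>i<N. v i ^ ex i))" by blast
  define L where "L = concat (map (\<lambda>(c1,e1). map (\<lambda>(c2,e2). (c1 * c2, \<lambda>i. e1 i + e2 i)) L2) L1)"
  have *: "(\<Sum>(c,ex)\<leftarrow>concat (map (\<lambda>(c1,e1). map (\<lambda>(c2,e2). (c1 * c2, \<lambda>i. e1 i + e2 i)) L2) L1). c * (\<Prod>i<N. v i ^ ex i))
     = (\<Sum>(c,ex)\<leftarrow>L1. c * (\<Prod>i<N. v i ^ ex i)) * (\<Sum>(c,ex)\<leftarrow>L2. c * (\<Prod>i<N. v i ^ ex i))" for v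
  proof (induction L1)
    case (Cons a L1)
    obtain c1 e1 where a: "a = (c1, e1)" by force
    have "(\<Sum>(c,ex)\<leftarrow>map (\<lambda>(c2,e2). (c1 * c2, \<lambda>i. e1 i + e2 i)) L2. c * (\<Prod>i<N. v i ^ ex i))
       = c1 * (\<Prod>i<N. v i ^ e1 i) * (\<Sum>(c,ex)\<leftarrow>L2. c * (\<Prod>i<N. v i ^ ex i))"
      by (induction L2) (auto simp: algebra_simps power_add prod.distrib)
    then show ?case using Cons by (simp add: a algebra_simps)
  qed auto
  have "c \<in> S \<and> (\<Sum>i<N. wt i * int (ex i)) \<le> w + w' \<and> (\<Sum>i<N. mt i * int (ex i)) \<le> r + r'" if "(c, ex) \<in> set L" for c ex
  proof -
    from that obtain c1 e1 c2 e2 where m: "(c1,e1) \<in> set L1" "(c2,e2) \<in> set L2" "ex = (\<lambda>i. e1 i + e2 i)" "c = c1 * c2"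
      unfolding L_def by auto
    have "(\<Sum>i<N. u i * int (ex i)) = (\<Sum>i<N. u i * int (e1 i)) + (\<Sum>i<N. u i * int (e2 i))" for u
      by (simp add: m(3) sum.distrib algebra_simps)
    moreover have "c1 * c2 \<in> S" using L1(1) L2(1) m assms(3) by fastforce
    ultimately show ?thesis using L1(1) L2(1) m by fastforce
  qed
  moreover have "f v * g v = (\<Sum>(c,ex)\<leftarrow>L. c * (\<Prod>i<N. v i ^ ex i))" for v
    unfolding L_def * using L1(2) L2(2) by simp
  ultimately show ?case by (intro exI[of _ L]) auto
qed

text \<open>The variables 0, 1, 2 are \<open>x, s, t\<close> and 3, 4, 5 their increments.\<close>

definition wtR :: "nat \<Rightarrow> nat \<Rightarrow> int" where
  "wtR n i = (if i = 2 \<or> i = 5 then int n else 1)"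

abbreviation pwR :: "nat \<Rightarrow> nat \<Rightarrow> int \<Rightarrow> ((nat \<Rightarrow> 'k::field poly) \<Rightarrow> 'k poly) \<Rightarrow> bool" where
  "pwR n N w f \<equiv> pw (wtR n) (\<lambda>_. 0) (range (\<lambda>c. [:c:])) N w 0 f"

text \<open>Here the variables are \<open>x, s, t\<close>, a second root \<open>T\<close> of the same fibre and the slope \<open>\<mu>\<close> of a line in the \<open>(x, s)\<close>-plane;
  the degree in \<open>\<mu>\<close> is recorded separately.\<close>

definition wtE :: "nat \<Rightarrow> nat \<Rightarrow> int" where
  "wtE n i = (if i < 2 then 1 else if i < 4 then int n else 0)"

definition mtE :: "nat \<Rightarrow> int" where "mtE i = (if i = 4 then 1 else 0)"

abbreviation pwE :: "nat \<Rightarrow> int \<Rightarrow> int \<Rightarrow> ((nat \<Rightarrow> 'k::field) \<Rightarrow> 'k) \<Rightarrow> bool" where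
  "pwE n w r f \<equiv> pw (wtE n) mtE UNIV 5 w r f"

lemma const_polys [simp]: "[:c:] \<in> range (\<lambda>c. [:c:])" "0 \<in> range (\<lambda>c::'k::field. [:c:])"
  "1 \<in> range (\<lambda>c::'k::field. [:c:])" "- 1 \<in> range (\<lambda>c::'k::field. [:c:])"
proof -
  show "0 \<in> range (\<lambda>c::'k::field. [:c:])" by (rule range_eqI[of _ _ 0]) simp
  show "1 \<in> range (\<lambda>c::'k::field. [:c:])" by (rule range_eqI[of _ _ 1]) (simp add: one_pCons)
  show "-1 \<in> range (\<lambda>c::'k::field. [:c:])" by (rule range_eqI[of _ _ "-1"]) (simp add: one_pCons)
qed simp

lemma pwR_at_const:
  assumes "pw (wtR n) (\<lambda>_. 0) (range (\<lambda>c. [:c:])) 3 w r f"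
  shows "\<exists>h. pwE n w r h \<and> (\<forall>env. f (\<lambda>i. [:env i:]) = [:h env:])"
  using assms
proof (induction rule: pw.induct)
  case zero
  then show ?case by (intro exI[of _ "\<lambda>_. 0"]) (auto intro: pw.zero)
next
  case (const c w r)
  then obtain d where "c = [:d:]" by auto
  then show ?case using const by (intro exI[of _ "\<lambda>_. d"]) (auto intro: pw.const)
next
  case (var i w r)
  then show ?case by (intro exI[of _ "\<lambda>v. v i"]) (auto intro!: pw.var simp: wtR_def wtE_def mtE_def split: if_splits)
next
  case (add w r f g)
  then obtain h1 h2 where "pwE n w r h1 \<and> (\<forall>env. f (\<lambda>i. [:env i:]) = [:h1 env:])"
    "pwE n w r h2 \<and> (\<forall>env. g (\<lambda>i. [:env i:]) = [:h2 env:])" by auto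
  then show ?case by (intro exI[of _ "\<lambda>v. h1 v + h2 v"]) (auto intro: pw.add)
next
  case (mult w r f w' r' g)
  then obtain h1 h2 where "pwE n w r h1 \<and> (\<forall>env. f (\<lambda>i. [:env i:]) = [:h1 env:])"
    "pwE n w' r' h2 \<and> (\<forall>env. g (\<lambda>i. [:env i:]) = [:h2 env:])" by auto
  then show ?case by (intro exI[of _ "\<lambda>v. h1 v * h2 v"]) (auto intro: pw.mult)
qed

lemma pwR_coeff_0:
  assumes "pw wt mt (range (\<lambda>c. [:c:])) N w r f"
  shows "coeff (f v) 0 = coeff (f (\<lambda>i. [:coeff (v i) 0:])) 0"
  using assms by (induction rule: pw.induct) (auto simp: coeff_mult_0)

text \<open>A filtration on polynomials in Y in which Y counts with weight \<open>- c0\<close>: the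
  coefficient of Y^r may exceed \<open>w\<close> by r c0 and has degree at most r in the slope
  \<mu>. Being multiplicative, it follows the Newton iteration without explicit formulas for the
  coefficients.\<close>

definition eclass :: "nat \<Rightarrow> int \<Rightarrow> int \<Rightarrow> ((nat \<Rightarrow> 'k::field) \<Rightarrow> 'k poly) \<Rightarrow> bool" where
  "eclass n c0 w F \<longleftrightarrow> (\<forall>r. pwE n (w + int r * c0) (int r) (\<lambda>env. coeff (F env) r))"

lemma eclass_const: "pwE n w 0 h \<Longrightarrow> eclass n c0 w (\<lambda>env. [:h env:])"
proof -
  assume h: "pwE n w 0 h"
  have "pwE n (w + int r * c0) (int r) (\<lambda>env. coeff [:h env:] r)" for r
    using h by (cases r) (auto intro: pw.zero)
  then show ?thesis unfolding eclass_def by blast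
qed

lemma eclass_zero: "eclass n c0 w (\<lambda>env. 0)"
  unfolding eclass_def by (auto intro: pw.zero)

lemma eclass_lin: "pwE n w 1 h \<Longrightarrow> eclass n c0 (w - c0) (\<lambda>env. [:0, h env:])"
proof -
  assume h: "pwE n w 1 h"
  have "pwE n (w - c0 + int r * c0) (int r) (\<lambda>env. coeff [:0, h env:] r)" for r
  proof -
    consider "r = 0" | "r = 1" | k where "r = Suc (Suc k)" by (metis One_nat_def not0_implies_Suc)
    then show ?thesis by cases (use h in \<open>auto intro: pw.zero\<close>)
  qed
  then show ?thesis unfolding eclass_def by blast
qed

lemma eclass_add: "eclass n c0 w F \<Longrightarrow> eclass n c0 w F' \<Longrightarrow> eclass n c0 w (\<lambda>env. F env + F' env)"
  unfolding eclass_def by (auto intro: pw.add)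

lemma eclass_mult:
  assumes "eclass n c0 w F" "eclass n c0 w' F'"
  shows "eclass n c0 (w + w') (\<lambda>env. F env * F' env)"
  unfolding eclass_def coeff_mult
proof (intro allI pw_sum)
  fix r i :: nat assume i: "i \<in> {..r}"
  have "pwE n (w + int i * c0) (int i) (\<lambda>env. coeff (F env) i)"
    "pwE n (w' + int (r - i) * c0) (int (r - i)) (\<lambda>env. coeff (F' env) (r - i))"
    using assms unfolding eclass_def by auto
  from pw_mult'[OF this] show "pwE n (w + w' + int r * c0) (int r) (\<lambda>env. coeff (F env) i * coeff (F' env) (r - i))"
    using i by (simp add: algebra_simps of_nat_diff)
qed

lemma eclass_uminus: "eclass n c0 w F \<Longrightarrow> eclass n c0 w (\<lambda>env. - F env)"
  unfolding eclass_def by (auto intro: pw_uminus)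

lemma eclass_power: "eclass n c0 w F \<Longrightarrow> eclass n c0 (int k * w) (\<lambda>env. F env ^ k)"
proof (induction k)
  case 0
  have "pwE n 0 0 (\<lambda>_. 1::'a)" by (auto intro: pw.const)
  from eclass_const[OF this] show ?case by (simp add: one_pCons)
next
  case (Suc k)
  from eclass_mult[OF Suc.prems Suc.IH[OF Suc.prems]] show ?case by (simp add: algebra_simps)
qed

lemma eclass_mono: "eclass n c0 w F \<Longrightarrow> w \<le> w' \<Longrightarrow> eclass n c0 w' F"
  unfolding eclass_def by (auto intro: pw_mono)

lemma eclass_subst:
  assumes "pw wt mt (range (\<lambda>c. [:c:])) N w r f" "\<And>i. i < N \<Longrightarrow> eclass n c0 (wt i) (\<lambda>env. a env i)"
  shows "eclass n c0 w (\<lambda>env. f (a env))"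
  using assms
proof (induction rule: pw.induct)
  case (const c w r)
  then obtain d where "c = [:d:]" by auto
  moreover have "pwE n w 0 (\<lambda>_. d)" using const by (auto intro: pw.const)
  ultimately show ?case using eclass_const by fastforce
next
  case (var i w r)
  then show ?case using eclass_mono by blast
qed (auto intro: eclass_zero eclass_add eclass_mult)

section \<open>Taylor expansion in the increments of x, s and t\<close>

definition shift6 :: "(nat \<Rightarrow> 'r::comm_ring_1) \<Rightarrow> nat \<Rightarrow> 'r" where
  "shift6 v = (\<lambda>i. if i < 3 then v i + v (i + 3) else 0)"

text \<open>Only the increment of t is expanded to second order: Newton iteration solves for t, and
  terms containing an increment of x or s may stay lumped in \<open>A\<close> and \<open>B\<close>.
  \<open>D\<close> is the t-derivative and involves the three base variables alone. The bounds may
  become negative, which forces the corresponding part to vanish; hence the integer weights.\<close>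

lemma pwR_taylor:
  fixes f :: "(nat \<Rightarrow> 'k::field poly) \<Rightarrow> 'k poly"
  assumes "pw (wtR n) (\<lambda>_. 0) (range (\<lambda>c. [:c:])) 3 w r f"
  shows "\<exists>D A B C. pw (wtR n) (\<lambda>_. 0) (range (\<lambda>c. [:c:])) 3 (w - int n) r D \<and>
     pw (wtR n) (\<lambda>_. 0) (range (\<lambda>c. [:c:])) 6 (w - 1) r A \<and>
     pw (wtR n) (\<lambda>_. 0) (range (\<lambda>c. [:c:])) 6 (w - 1) r B \<and>
     pw (wtR n) (\<lambda>_. 0) (range (\<lambda>c. [:c:])) 6 (w - 2 * int n) r C \<and>
     (\<forall>v. f (shift6 v) = f v + v 5 * D v + v 3 * A v + v 4 * B v + (v 5)\<^sup>2 * C v)"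
  (is "\<exists>D A B C. ?P w r f D A B C")
  using assms
proof (induction rule: pw.induct)
  case zero
  show ?case by (rule exI[of _ "\<lambda>_. 0"])+ (auto intro: pw.zero)
next
  case (const c w r)
  show ?case by (rule exI[of _ "\<lambda>_. 0"])+ (auto intro: pw.zero)
next
  case (var i w r)
  consider "i = 0" | "i = 1" | "i = 2" using var by linarith
  then show ?case
  proof cases
    case 1
    show ?thesis using var 1
      by (intro exI[of _ "\<lambda>_. 0"] exI[of _ "\<lambda>_. 1"] conjI)
        (auto intro!: pw.zero pw.const simp: wtR_def shift6_def)
  next
    case 2
    show ?thesis using var 2
      by (intro exI[of _ "\<lambda>_. 0"] exI[of _ "\<lambda>_. 1"] conjI)
        (auto intro!: pw.zero pw.const simp: wtR_def shift6_def)
  next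
    case 3
    show ?thesis using var 3
      by (intro exI[of _ "\<lambda>_. 0"] exI[of _ "\<lambda>_. 1"] conjI)
        (auto intro!: pw.zero pw.const simp: wtR_def shift6_def)
  qed
next
  case (add w r f g)
  then obtain D A B C D' A' B' C' where 1: "?P w r f D A B C" and 2: "?P w r g D' A' B' C'" by blast
  show ?case
    by (rule exI[of _ "\<lambda>v. D v + D' v"], rule exI[of _ "\<lambda>v. A v + A' v"], rule exI[of _ "\<lambda>v. B v + B' v"],
        rule exI[of _ "\<lambda>v. C v + C' v"])
      (use 1 2 in \<open>auto intro: pw.add simp: algebra_simps\<close>)
next
  case (mult w r f w' r' g)
  then obtain D A B C D' A' B' C' where 1: "?P w r f D A B C" and 2: "?P w' r' g D' A' B' C'" by blast
  let ?S = "range (\<lambda>c::'k. [:c:])"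
  have f6: "pw (wtR n) (\<lambda>_. 0) ?S 6 w r f" and g6: "pw (wtR n) (\<lambda>_. 0) ?S 6 w' r' g"
    using mult.hyps by (auto intro: pw_vars_mono)
  have D6: "pw (wtR n) (\<lambda>_. 0) ?S 6 (w - int n) r D" and D6': "pw (wtR n) (\<lambda>_. 0) ?S 6 (w' - int n) r' D'"
    using 1 2 by (auto intro: pw_vars_mono)
  have v3: "pw (wtR n) (\<lambda>_. 0) ?S 6 1 0 (\<lambda>v. v 3)" and v4: "pw (wtR n) (\<lambda>_. 0) ?S 6 1 0 (\<lambda>v. v 4)"
   and v5: "pw (wtR n) (\<lambda>_. 0) ?S 6 (int n) 0 (\<lambda>v. v 5)" by (auto intro!: pw.var simp: wtR_def)
  have v52: "pw (wtR n) (\<lambda>_. 0) ?S 6 (2 * int n) 0 (\<lambda>v. (v 5)\<^sup>2)"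
    using pw_power[OF v5, of 2] by simp
  \<comment> \<open>\<open>h\<close> is \<open>g\<close> with only its t-increment carried out,
    \<open>fs\<close> is \<open>f\<close> with all increments carried out; with this choice the
    mixed terms of the product sort themselves into \<open>A2\<close> and \<open>B2\<close>.\<close>
  define h where "h = (\<lambda>v. g v + v 5 * D' v + (v 5)\<^sup>2 * C' v)"
  have h: "pw (wtR n) (\<lambda>_. 0) ?S 6 w' r' h" unfolding h_def
    using pw_mult'[OF v5 D6', of w' r'] pw_mult'[OF v52, of "w' - 2 * int n" r' C' w' r'] g6 2
    by (auto intro!: pw.add)
  define fs where "fs = (\<lambda>v. f v + v 5 * D v + v 3 * A v + v 4 * B v + (v 5)\<^sup>2 * C v)"
  have fs: "pw (wtR n) (\<lambda>_. 0) ?S 6 w r fs" unfolding fs_def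
    using pw_mult'[OF v5 D6, of w r] pw_mult'[OF v52, of "w - 2 * int n" r C w r]
      pw_mult'[OF v3, of "w - 1" r A w r] pw_mult'[OF v4, of "w - 1" r B w r] f6 1
    by (auto intro!: pw.add)
  define A2 where "A2 = (\<lambda>v. A v * h v + fs v * A' v)"
  define B2 where "B2 = (\<lambda>v. B v * h v + fs v * B' v)"
  define C2 where "C2 = (\<lambda>v. D v * D' v + C v * g v + f v * C' v + v 5 * (C v * D' v + D v * C' v) + (v 5)\<^sup>2 * (C v * C' v))"
  define D2 where "D2 = (\<lambda>v. D v * g v + f v * D' v)"
  have "pw (wtR n) (\<lambda>_. 0) ?S 3 (w + w' - int n) (r + r') D2" unfolding D2_def
    using 1 2 mult.hyps by (auto intro!: pw.add intro: pw_mult')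
  moreover have "pw (wtR n) (\<lambda>_. 0) ?S 6 (w + w' - 1) (r + r') A2" unfolding A2_def
    using 1 2 h fs by (auto intro!: pw.add intro: pw_mult')
  moreover have "pw (wtR n) (\<lambda>_. 0) ?S 6 (w + w' - 1) (r + r') B2" unfolding B2_def
    using 1 2 h fs by (auto intro!: pw.add intro: pw_mult')
  moreover have "pw (wtR n) (\<lambda>_. 0) ?S 6 (w + w' - 2 * int n) (r + r') C2"
  proof -
    have C6: "pw (wtR n) (\<lambda>_. 0) ?S 6 (w - 2 * int n) r C" "pw (wtR n) (\<lambda>_. 0) ?S 6 (w' - 2 * int n) r' C'"
      using 1 2 by auto
    have a: "pw (wtR n) (\<lambda>_. 0) ?S 6 (w + w' - 3 * int n) (r + r') (\<lambda>v. C v * D' v + D v * C' v)"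
      using pw_mult'[OF C6(1) D6'] pw_mult'[OF D6 C6(2)] by (auto intro!: pw.add)
    have b: "pw (wtR n) (\<lambda>_. 0) ?S 6 (w + w' - 4 * int n) (r + r') (\<lambda>v. C v * C' v)"
      using pw_mult'[OF C6] by auto
    show ?thesis unfolding C2_def
      using pw_mult'[OF v5 a, of "w + w' - 2 * int n" "r + r'"] pw_mult'[OF v52 b, of "w + w' - 2 * int n" "r + r'"]
        pw_mult'[OF D6 D6', of "w + w' - 2 * int n" "r + r'"] pw_mult'[OF C6(1) g6, of "w + w' - 2 * int n" "r + r'"]
        pw_mult'[OF f6 C6(2), of "w + w' - 2 * int n" "r + r'"]
      by (auto intro!: pw.add)
  qed
  moreover have "f (shift6 v) * g (shift6 v) = f v * g v + v 5 * D2 v + v 3 * A2 v + v 4 * B2 v + (v 5)\<^sup>2 * C2 v" for v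
  proof -
    have "f (shift6 v) = fs v" and g: "g (shift6 v) = h v + v 3 * A' v + v 4 * B' v" using 1 2 by (auto simp: h_def fs_def)
    then have "f (shift6 v) * g (shift6 v) = fs v * h v + v 3 * (fs v * A' v) + v 4 * (fs v * B' v)"
      by (simp add: algebra_simps)
    also have "fs v * h v = (f v + v 5 * D v + (v 5)\<^sup>2 * C v) * h v + v 3 * (A v * h v) + v 4 * (B v * h v)"
      by (simp add: fs_def algebra_simps)
    also have "(f v + v 5 * D v + (v 5)\<^sup>2 * C v) * h v = f v * g v + v 5 * D2 v + (v 5)\<^sup>2 * C2 v"
      unfolding h_def D2_def C2_def by (simp add: algebra_simps power2_eq_square)
    finally show ?thesis unfolding A2_def B2_def by (simp add: algebra_simps)
  qed
  ultimately show ?case by blast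
qed

lemma Y_power_dvd_iff: "[:0,1:] ^ k dvd p \<longleftrightarrow> (\<forall>i<k. coeff (p::'k::field poly) i = 0)"
  using monom_1_dvd_iff'[of k p] by (simp add: monom_altdef)

lemma Y_power_mult_coeff: "coeff ([:0,1:] ^ k * p) i = (if i < k then 0 else coeff (p::'k::field poly) (i - k))"
  using coeff_monom_mult[of 1 k p i] by (simp add: monom_altdef)

definition vec3 :: "'b \<Rightarrow> 'b \<Rightarrow> 'b \<Rightarrow> nat \<Rightarrow> 'b" where
  "vec3 x s t = (\<lambda>i. if i = 0 then x else if i = 1 then s else t)"

section \<open>Newton iteration along lines\<close>

locale taylor_curve =
  fixes n :: nat and G D A B C :: "(nat \<Rightarrow> 'k::field poly) \<Rightarrow> 'k poly"
  assumes n2: "n \<ge> 2"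
    and G: "pwR n 3 (int (n * n)) G"
    and D: "pwR n 3 (int (n * n) - int n) D"
    and A: "pwR n 6 (int (n * n) - 1) A"
    and B: "pwR n 6 (int (n * n) - 1) B"
    and C: "pwR n 6 (int (n * n) - 2 * int n) C"
    and taylor: "\<And>v. G (shift6 v) = G v + v 5 * D v + v 3 * A v + v 4 * B v + (v 5)\<^sup>2 * C v"
begin

definition g :: "(nat \<Rightarrow> 'k) \<Rightarrow> 'k" where "g env = coeff (D (\<lambda>i. [:env i:])) 0"
definition Gc :: "(nat \<Rightarrow> 'k) \<Rightarrow> 'k" where "Gc env = coeff (G (\<lambda>i. [:env i:])) 0"

lemma D_const: "D (\<lambda>i. [:env i:]) = [:g env:]" and g_pw: "pwE n (int (n * n) - int n) 0 g"
proof -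
  obtain h where h: "pwE n (int (n * n) - int n) 0 h" "\<forall>env. D (\<lambda>i. [:env i:]) = [:h env:]"
    using pwR_at_const[OF D] by blast
  then have "g = h" by (auto simp: g_def)
  then show "D (\<lambda>i. [:env i:]) = [:g env:]" "pwE n (int (n * n) - int n) 0 g" using h by auto
qed

lemma G_const: "G (\<lambda>i. [:env i:]) = [:Gc env:]" and Gc_pw: "pwE n (int (n * n)) 0 Gc"
proof -
  obtain h where h: "pwE n (int (n * n)) 0 h" "\<forall>env. G (\<lambda>i. [:env i:]) = [:h env:]"
    using pwR_at_const[OF G] by blast
  then have "Gc = h" by (auto simp: Gc_def)
  then show "G (\<lambda>i. [:env i:]) = [:Gc env:]" "pwE n (int (n * n)) 0 Gc" using h by auto
qed

definition arg :: "(nat \<Rightarrow> 'k) \<Rightarrow> 'k poly \<Rightarrow> nat \<Rightarrow> 'k poly" where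
  "arg env w = (\<lambda>i. if i < 3 then [:env i:] else if i = 3 then [:0, (g env)\<^sup>2:]
      else if i = 4 then [:0, env 4 * (g env)\<^sup>2:] else [:g env:] * w)"

text \<open>Denominator-free Newton iteration: with the step \<open>(g\<^sup>2 y, \<mu> g\<^sup>2 y)\<close> in \<open>(x, s)\<close>, where \<open>g\<close> is the
  \<open>t\<close>-derivative of \<open>G\<close>, the root becomes \<open>t + g W\<close>.\<close>

primrec W :: "nat \<Rightarrow> (nat \<Rightarrow> 'k) \<Rightarrow> 'k poly" where
  "W 0 env = 0"
| "W (Suc k) env = - ([:0,1:] * A (arg env (W k env)) + [:0, env 4:] * B (arg env (W k env))
       + (W k env)\<^sup>2 * C (arg env (W k env)))"

definition sh :: "nat \<Rightarrow> (nat \<Rightarrow> 'k) \<Rightarrow> nat \<Rightarrow> 'k poly" where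
  "sh k env = shift6 (arg env (W k env))"

lemma sh_simps: "sh k env 0 = [:env 0, (g env)\<^sup>2:]" "sh k env (Suc 0) = [:env 1, env 4 * (g env)\<^sup>2:]"
  "sh k env 2 = [:env 2:] + [:g env:] * W k env"
  by (auto simp: sh_def shift6_def arg_def)

text \<open>At the increments of \<open>arg\<close> all terms of the Taylor formula beyond the
  constant one share the factor g^2: the linear term in t is g times g W, and the others carry g^2
  by the choice of the steps. The recursion for \<open>W\<close> is what remains, read as a
  fixed-point equation.\<close>

lemma G_sh: "G (sh k env) = [:Gc env:] + [:(g env)\<^sup>2:] * (W k env - W (Suc k) env)"
proof -
  let ?a = "arg env (W k env)"
  have 1: "G ?a = [:Gc env:]" using pw_cong[OF G, of ?a "\<lambda>i. [:env i:]"] G_const by (simp add: arg_def)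
  have 2: "D ?a = [:g env:]" using pw_cong[OF D, of ?a "\<lambda>i. [:env i:]"] D_const by (simp add: arg_def)
  have e: "?a 3 = [:(g env)\<^sup>2:] * [:0,1:]" "?a 4 = [:(g env)\<^sup>2:] * [:0, env 4:]" "?a 5 = [:g env:] * W k env"
    by (auto simp: arg_def)
  have sq: "[:(g env)\<^sup>2:] = [:g env:]\<^sup>2" by (simp add: power2_eq_square)
  have "G (sh k env) = [:Gc env:] + ?a 5 * [:g env:] + ?a 3 * A ?a + ?a 4 * B ?a + (?a 5)\<^sup>2 * C ?a"
    unfolding sh_def taylor 1 2 ..
  also have "\<dots> = [:Gc env:] + [:g env:]\<^sup>2 * (W k env + [:0,1:] * A ?a + [:0, env 4:] * B ?a + (W k env)\<^sup>2 * C ?a)"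
    unfolding e sq by (simp only: power2_eq_square algebra_simps)
  also have "W k env + [:0,1:] * A ?a + [:0, env 4:] * B ?a + (W k env)\<^sup>2 * C ?a = W k env - W (Suc k) env"
    by (simp add: algebra_simps)
  finally show ?thesis unfolding sq .
qed

lemma Y_dvd_W: "[:0,1:] dvd W k env"
proof (induction k)
  case (Suc k)
  have "[:0, env 4:] = [:0,1:] * [:env 4:]" by simp
  then have "[:0,1:] dvd [:0, env 4:]" by (metis dvd_triv_left)
  moreover have "[:0,1:] dvd (W k env)\<^sup>2" using Suc by (simp add: power2_eq_square)
  ultimately show ?case by (auto simp del: mult_pCons_left simp: dvd_mult2)
qed simp

text \<open>Each step gains one factor Y: the right-hand side of the recursion depends on
  \<open>W\<close> only through \<open>A\<close> and \<open>B\<close>, which are multiplied by Y,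
  and through W^2 C, where Y divides \<open>W\<close>.\<close>

lemma W_Suc_diff: "[:0,1:] ^ Suc k dvd W (Suc k) env - W k env"
proof (induction k)
  case 0
  show ?case using Y_dvd_W[of "Suc 0" env] by (simp del: W.simps(2))
next
  case (Suc k)
  let ?d = "W (Suc k) env - W k env" and ?Y = "[:0,1::'k:]"
  let ?a = "arg env (W k env)" and ?b = "arg env (W (Suc k) env)"
  have ab: "?d dvd ?b i - ?a i" for i
    by (auto simp: arg_def simp flip: smult_diff_right intro: dvd_smult simp del: W.simps)
  have A': "?d dvd A ?b - A ?a" and B': "?d dvd B ?b - B ?a" and C': "?d dvd C ?b - C ?a"
    using pw_cong_dvd[OF A ab] pw_cong_dvd[OF B ab] pw_cong_dvd[OF C ab] by auto
  have Y4: "[:0, env 4:] = ?Y * [:env 4:]" by simp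
  have "W (Suc (Suc k)) env - W (Suc k) env
     = - (?Y * (A ?b - A ?a) + ?Y * ([:env 4:] * (B ?b - B ?a))
        + ?d * ((W (Suc k) env + W k env) * C ?b) + (W k env)\<^sup>2 * (C ?b - C ?a))"
  proof -
    have "W (Suc (Suc k)) env - W (Suc k) env =
       - ([:0,1:] * A ?b + [:0, env 4:] * B ?b + (W (Suc k) env)\<^sup>2 * C ?b)
       - - ([:0,1:] * A ?a + [:0, env 4:] * B ?a + (W k env)\<^sup>2 * C ?a)"
      by (rule arg_cong2[of _ _ _ _ "(-)", OF W.simps(2) W.simps(2)])
    moreover have "- (y * a' + y * m * b' + p\<^sup>2 * c') - - (y * a + y * m * b + k\<^sup>2 * c)
       = - (y * (a' - a) + y * (m * (b' - b)) + (p - k) * ((p + k) * c') + k\<^sup>2 * (c' - c))"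
      for y a a' b b' c c' m p k :: "'k poly" by (simp add: algebra_simps power2_eq_square)
    ultimately show ?thesis unfolding Y4 by metis
  qed
  moreover have "?Y * ?d dvd ?Y * (A ?b - A ?a)" using A' by (rule mult_dvd_mono[OF dvd_refl])
  moreover have "?Y * ?d dvd ?Y * ([:env 4:] * (B ?b - B ?a))" using B' by (intro mult_dvd_mono dvd_refl dvd_mult)
  moreover have "?Y * ?d dvd ?d * ((W (Suc k) env + W k env) * C ?b)"
  proof -
    have "?Y dvd W (Suc k) env + W k env" by (intro dvd_add Y_dvd_W)
    then have "?d * ?Y dvd ?d * ((W (Suc k) env + W k env) * C ?b)" by (intro mult_dvd_mono dvd_refl dvd_mult2)
    then show ?thesis by (metis mult.commute)
  qed
  moreover have "?Y * ?d dvd (W k env)\<^sup>2 * (C ?b - C ?a)"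
    using C' Y_dvd_W[of k env] by (intro mult_dvd_mono) (auto simp: power2_eq_square)
  ultimately have "?Y * ?d dvd W (Suc (Suc k)) env - W (Suc k) env"
    by (metis dvd_add dvd_minus_iff)
  moreover have "?Y ^ Suc (Suc k) dvd ?Y * ?d"
    using mult_dvd_mono[OF dvd_refl[of ?Y] Suc.IH] by (simp only: power_Suc)
  ultimately show ?case by (rule dvd_trans[rotated])
qed

lemma G_sh_dvd: "Gc env = 0 \<Longrightarrow> [:0,1:] ^ Suc k dvd G (sh k env)"
proof -
  assume "Gc env = 0"
  then have "G (sh k env) = - [:(g env)\<^sup>2:] * (W (Suc k) env - W k env)"
    unfolding G_sh by (simp only: algebra_simps) simp
  then show ?thesis using W_Suc_diff[of k env] by (metis dvd_mult)
qed

text \<open>\<open>g\<close> weighs n^2 - n. Giving Y the weight \<open>- c0\<close> makes the step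
  g^2 Y weigh 1, exactly as x and s do.\<close>

definition c0 :: int where "c0 = 2 * (int (n * n) - int n) - 1"

lemma c0_eq: "- c0 + (int (n * n) - 1) = 2 * int n - int (n * n)"
  unfolding c0_def by (simp only: of_nat_mult algebra_simps)

lemma eclass_var: "i < 5 \<Longrightarrow> eclass n c (wtE n i) (\<lambda>env. [:env i:])" if "i \<noteq> 4" for i
  using that by (intro eclass_const pw.var) (auto simp: mtE_def)

text \<open>The weight is the one for which g W weighs n, like t. It reproduces itself: Y A
  contributes - c0 + n^2 - 1, and W^2 C contributes 2 (2 n - n^2) + n^2 - 2 n, both equal to 2 n -
  n^2.\<close>

lemma eclass_W: "eclass n c0 (2 * int n - int (n * n)) (W k)"
proof (induction k)
  case 0
  then show ?case by (simp add: eclass_zero)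
next
  case (Suc k)
  have g: "eclass n c0 (int (n * n) - int n) (\<lambda>env. [:g env:])" using g_pw by (rule eclass_const)
  have g2: "pwE n (2 * (int (n * n) - int n)) 0 (\<lambda>env. (g env)\<^sup>2)"
    using pw_power[OF g_pw, of 2] by simp
  have gy: "eclass n c0 1 (\<lambda>env. [:0, (g env)\<^sup>2:])"
    using eclass_lin[OF pw_mono[OF g2], of "2 * (int (n * n) - int n)" c0] by (simp add: c0_def)
  have mu: "pwE n 0 1 (\<lambda>env. env 4)" by (auto intro!: pw.var simp: wtE_def mtE_def)
  have "pwE n (2 * (int (n * n) - int n)) 1 (\<lambda>env. env 4 * (g env)\<^sup>2)"
    using pw_mult'[OF mu g2] by auto
  then have gmy: "eclass n c0 1 (\<lambda>env. [:0, env 4 * (g env)\<^sup>2:])"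
    using eclass_lin[of n "2 * (int (n * n) - int n)" _ c0] by (simp add: c0_def)
  have gw: "eclass n c0 (int n) (\<lambda>env. [:g env:] * W k env)"
    using eclass_mult[OF g Suc.IH] by simp
  have v: "eclass n c0 (wtR n i) (\<lambda>env. [:env i:])" if "i < 3" for i
  proof -
    have "wtE n i = wtR n i" using that by (auto simp: wtE_def wtR_def)
    then show ?thesis using eclass_var[of i c0] that by simp
  qed
  have args: "eclass n c0 (wtR n i) (\<lambda>env. arg env (W k env) i)" if i6: "i < 6" for i
  proof -
    consider "i < 3" | "i = 3" | "i = 4" | "i = 5" using i6 by linarith
    then show ?thesis
    proof cases
      case 1 then show ?thesis using v by (simp add: arg_def)
    qed (use gy gmy gw in \<open>auto simp: arg_def wtR_def\<close>)
  qed
  have Y: "eclass n c0 (- c0) (\<lambda>env::nat \<Rightarrow> 'k. [:0,1:])"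
    using eclass_lin[of n 0 "\<lambda>_. 1::'k" c0] pw.const[of "1::'k" UNIV 0 1 "wtE n" mtE 5] by simp
  have muY: "eclass n c0 (- c0) (\<lambda>env. [:0,env 4:])"
    using eclass_lin[OF mu, of c0] by simp
  have 1: "eclass n c0 (2 * int n - int (n * n)) (\<lambda>env. [:0,1:] * A (arg env (W k env)))"
    using eclass_mult[OF Y eclass_subst[OF A args]] by (simp only: c0_eq)
  have 2: "eclass n c0 (2 * int n - int (n * n)) (\<lambda>env. [:0,env 4:] * B (arg env (W k env)))"
    using eclass_mult[OF muY eclass_subst[OF B args]] by (simp only: c0_eq)
  have aux: "int 2 * (2 * a - N) + (N - 2 * a) = 2 * a - N" for a N :: int by simp
  have 3: "eclass n c0 (2 * int n - int (n * n)) (\<lambda>env. (W k env)\<^sup>2 * C (arg env (W k env)))"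
    using eclass_mult[OF eclass_power[OF Suc.IH, of 2] eclass_subst[OF C args]]
    by (simp only: aux)
  show ?case unfolding W.simps by (intro eclass_uminus eclass_add 1 2 3)
qed

lemma eclass_sh: "i < 3 \<Longrightarrow> eclass n c0 (wtR n i) (\<lambda>env. sh k env i)"
proof -
  assume i: "i < 3"
  have g2: "pwE n (2 * (int (n * n) - int n)) 0 (\<lambda>env. (g env)\<^sup>2)"
    using pw_power[OF g_pw, of 2] by simp
  have gy: "eclass n c0 1 (\<lambda>env. [:0, (g env)\<^sup>2:])"
    using eclass_lin[OF pw_mono[OF g2], of "2 * (int (n * n) - int n)" c0] by (simp add: c0_def)
  have mu: "pwE n 0 1 (\<lambda>env. env 4)" by (auto intro!: pw.var simp: wtE_def mtE_def)
  have "pwE n (2 * (int (n * n) - int n)) 1 (\<lambda>env. env 4 * (g env)\<^sup>2)"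
    using pw_mult'[OF mu g2] by auto
  then have gmy: "eclass n c0 1 (\<lambda>env. [:0, env 4 * (g env)\<^sup>2:])"
    using eclass_lin[of n "2 * (int (n * n) - int n)" _ c0] by (simp add: c0_def)
  have gw: "eclass n c0 (int n) (\<lambda>env. [:g env:] * W k env)"
    using eclass_mult[OF eclass_const[OF g_pw] eclass_W[of k]] by simp
  have wv: "wtE n i = wtR n i" using i by (auto simp: wtE_def wtR_def)
  have v: "eclass n c0 (wtR n i) (\<lambda>env. [:env i:])"
    using eclass_var[of i c0] i wv by simp
  consider "i = 0" | "i = 1" | "i = 2" using i by linarith
  then show ?thesis
  proof cases
    case 1
    then show ?thesis using eclass_add[OF v[unfolded 1], of "\<lambda>env. [:0, (g env)\<^sup>2:]"] gy
      by (simp add: sh_simps wtR_def)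
  next
    case 2
    then show ?thesis using eclass_add[OF v[unfolded 2], of "\<lambda>env. [:0, env 4 * (g env)\<^sup>2:]"] gmy
      by (simp add: sh_simps wtR_def)
  next
    case 3
    then show ?thesis using eclass_add[OF v[unfolded 3], of "\<lambda>env. [:g env:] * W k env"] gw
      by (simp add: sh_simps wtR_def)
  qed
qed

text \<open>Here x and s follow an arbitrary arc through a point with nonzero t-derivative, and no
  weights are recorded, so division by g is allowed, unlike in \<open>W\<close>.\<close>

lemma hensel_lift:
  assumes p: "Gc env = 0" "g env \<noteq> 0" and v: "\<And>i. i < 2 \<Longrightarrow> coeff (v i) 0 = env i"
  shows "\<exists>\<tau>. coeff \<tau> 0 = env 2 \<and> [:0,1:] ^ M dvd G (v(2 := \<tau>))"
proof (induction M)
  case 0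
  show ?case by (intro exI[of _ "[:env 2:]"]) simp
next
  case (Suc M)
  then obtain \<tau> where \<tau>: "coeff \<tau> 0 = env 2" "[:0,1:] ^ M dvd G (v(2 := \<tau>))" by blast
  have const0: "coeff (f (v(2:=\<sigma>))) 0 = coeff (f (\<lambda>i. [:env i:])) 0"
    if "pwR n 3 w f" "coeff \<sigma> 0 = env 2" for f w \<sigma>
  proof -
    have "coeff (f (v(2:=\<sigma>))) 0 = coeff (f (\<lambda>i. [:coeff ((v(2:=\<sigma>)) i) 0:])) 0" using that(1) by (rule pwR_coeff_0)
    also have "f (\<lambda>i. [:coeff ((v(2:=\<sigma>)) i) 0:]) = f (\<lambda>i. [:env i:])"
      using that v by (intro pw_cong[OF that(1)]) auto
    finally show ?thesis .
  qed
  show ?case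
  \<comment> \<open>At order 0 the correction would be a constant and its square would not be of
    higher order; the hypothesis on the point settles this case.\<close>
  proof (cases "M = 0")
    case True
    have "coeff (G (v(2:=\<tau>))) 0 = 0" using const0[OF G \<tau>(1)] p by (simp add: Gc_def)
    then have "coeff \<tau> 0 = env 2 \<and> [:0,1:] ^ Suc M dvd G (v(2:=\<tau>))" unfolding Y_power_dvd_iff using True \<tau>(1) by auto
    then show ?thesis by (rule exI[of _ \<tau>])
  next
    case False
    obtain h where h: "G (v(2 := \<tau>)) = [:0,1:] ^ M * h" using \<tau>(2) by (auto elim: dvdE)
    define w where "w = [:0,1:] ^ M * [:- coeff h 0 / g env:]"
    define u where "u = (\<lambda>i. if i < 2 then v i else if i = 2 then \<tau> else if i = 5 then w else 0)"
    have c0: "coeff (D (v(2:=\<tau>))) 0 = g env" using const0[OF D \<tau>(1)] by (simp add: g_def)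
    have e: "G (shift6 u) = G (v(2 := \<tau> + w))" by (rule pw_cong[OF G]) (auto simp: shift6_def u_def)
    have e2: "G u = G (v(2:=\<tau>))" by (rule pw_cong[OF G]) (auto simp: u_def)
    have e3: "D u = D (v(2:=\<tau>))" by (rule pw_cong[OF D]) (auto simp: u_def)
    have "G (v(2 := \<tau> + w)) = G u + u 5 * D u + u 3 * A u + u 4 * B u + (u 5)\<^sup>2 * C u"
      unfolding e[symmetric] taylor ..
    also have "\<dots> = [:0,1:] ^ M * h + w * D (v(2:=\<tau>)) + w\<^sup>2 * C u" unfolding e2 e3 h by (simp add: u_def)
    also have "\<dots> = [:0,1:] ^ M * (h + [:- coeff h 0 / g env:] * D (v(2:=\<tau>)) + [:0,1:]^M * [:- coeff h 0 / g env:]\<^sup>2 * C u)"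
      unfolding w_def by (simp only: power2_eq_square algebra_simps)
    finally have eq: "G (v(2 := \<tau> + w)) = \<dots>" .
    have "coeff (h + [:- coeff h 0 / g env:] * D (v(2:=\<tau>)) + [:0,1:]^M * [:- coeff h 0 / g env:]\<^sup>2 * C u) 0 = 0"
      using False p c0 by (simp add: coeff_mult_0 coeff_0_power)
    then have "[:0,1:] ^ 1 dvd (h + [:- coeff h 0 / g env:] * D (v(2:=\<tau>)) + [:0,1:]^M * [:- coeff h 0 / g env:]\<^sup>2 * C u)"
      by (subst Y_power_dvd_iff) simp
    then have "[:0,1:] ^ Suc M dvd G (v(2 := \<tau> + w))" unfolding eq
      using mult_dvd_mono[OF dvd_refl[of "[:0,1:]^M"]] by (simp add: mult.commute[of "[:0,1:]"] del: mult_pCons_right mult_pCons_left)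
    moreover have "coeff (\<tau> + w) 0 = env 2" using False \<tau>(1) by (simp add: w_def coeff_mult_0 coeff_0_power)
    ultimately show ?thesis by blast
  qed
qed

end

section \<open>The auxiliary polynomial\<close>

definition tri :: "nat \<Rightarrow> (nat \<times> nat) set" where "tri w = {(k, k'). k + k' \<le> w}"

lemma finite_tri [simp]: "finite (tri w)"
  by (rule finite_subset[of _ "{..w} \<times> {..w}"]) (auto simp: tri_def)

lemma card_tri: "2 * card (tri w) = (w + 1) * (w + 2)"
proof -
  have "tri w = Sigma {..w} (\<lambda>k. {..w - k})" by (auto simp: tri_def)
  then have "card (tri w) = (\<Sum>k\<le>w. Suc (w - k))" by (simp add: card_SigmaI)
  also have "\<dots> = (\<Sum>k\<le>w. Suc k)"
    using sum.nat_diff_reindex[of Suc "Suc w"] by (simp add: lessThan_Suc_atMost)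
  also have "2 * (\<Sum>k\<le>w. Suc k) = (w + 1) * (w + 2)" by (induction w) auto
  finally show ?thesis by simp
qed

lemma const_poly_mult: "[:a * b:] = [:a:] * [:b::'k::field:]" by simp

locale lead_curve = taylor_curve +
  assumes lead: "coeff (G (\<lambda>i. if i = 2 then [:0,1:] else 0)) n \<noteq> 0"
begin

definition m3 :: "nat \<times> nat \<times> nat \<Rightarrow> (nat \<Rightarrow> 'r::comm_ring_1) \<Rightarrow> 'r" where
  "m3 = (\<lambda>(k,k',i) v. v 0 ^ k * v 1 ^ k' * v 2 ^ i)"

text \<open>Since t weighs n and the total weight is at most n^2, a term with t^i and i \<ge> n can
  only be a constant multiple of t^n; \<open>lead\<close> makes that constant nonzero.\<close>

lemma G_expand:
  "\<exists>\<gamma> L. \<gamma> \<noteq> 0 \<and> (\<forall>(c,k,k',i)\<in>set L. i < n \<and> k + k' + n * i \<le> n * n) \<and>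
     (\<forall>v. G v = [:\<gamma>:] * v 2 ^ n + (\<Sum>(c,p)\<leftarrow>L. [:c:] * m3 p v))"
proof -
  obtain L0 where L0: "\<forall>(c,ex)\<in>set L0. c \<in> range (\<lambda>c. [:c:]) \<and> (\<Sum>i<3. wtR n i * int (ex i)) \<le> int (n * n)"
    "\<forall>v. G v = (\<Sum>(c,ex)\<leftarrow>L0. c * (\<Prod>i<3. v i ^ ex i))"
  proof -
    have m: "a * b \<in> range (\<lambda>c::'a. [:c:])" if "a \<in> range (\<lambda>c::'a. [:c:])" "b \<in> range (\<lambda>c::'a. [:c:])" for a b
    proof -
      obtain a' b' where "a = [:a':]" "b = [:b':]" using \<open>a \<in> _\<close> \<open>b \<in> _\<close> by auto
      then have "a * b = [:a' * b':]" by simp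
      then show ?thesis by blast
    qed
    show ?thesis using pw_monomials[OF G const_polys(3) m] that by fast
  qed
  define L1 where "L1 = map (\<lambda>(c,ex). (coeff c 0, ex 0, ex 1, ex (2::nat))) L0"
  have p3: "(\<Prod>i<3. f i) = f 0 * f 1 * f (2::nat)" for f :: "nat \<Rightarrow> 'a poly"
    by (simp add: numeral_3_eq_3 numeral_2_eq_2)
  have s3: "(\<Sum>i<3. f i) = f 0 + f 1 + f (2::nat)" for f :: "nat \<Rightarrow> int"
    by (simp add: numeral_3_eq_3 numeral_2_eq_2)
  have L1: "k + k' + n * i \<le> n * n" if mem: "(c,k,k',i) \<in> set L1" for c k k' i
  proof -
    obtain c' ex where "(c', ex) \<in> set L0" "k = ex 0" "k' = ex 1" "i = ex 2" using mem by (auto simp: L1_def)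
    then have "int k + int k' + int n * int i \<le> int (n * n)" using L0(1) by (fastforce simp: s3 wtR_def)
    then show ?thesis by (metis of_nat_add of_nat_le_iff of_nat_mult)
  qed
  have GL1: "G v = (\<Sum>(c,p)\<leftarrow>L1. [:c:] * m3 p v)" for v
  proof -
    have "G v = (\<Sum>(c,ex)\<leftarrow>L0. c * (\<Prod>i<3. v i ^ ex i))" using L0 by blast
    also have "\<dots> = (\<Sum>(c,p)\<leftarrow>L1. [:c:] * m3 p v)" using L0(1) unfolding L1_def
      by (induction L0) (auto simp: p3 m3_def mult.assoc)
    finally show ?thesis .
  qed
  define La where "La = filter (\<lambda>(c,k,k',i). i < n) L1"
  define Lb where "Lb = filter (\<lambda>(c,k,k',i). \<not> i < n) L1"
  define \<gamma> where "\<gamma> = sum_list (map fst Lb)"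
  have Lb: "k = 0 \<and> k' = 0 \<and> i = n" if "(c,k,k',i) \<in> set Lb" for c k k' i
  proof -
    have "k + k' + n * i \<le> n * n" "i \<ge> n" using L1 that by (auto simp: Lb_def)
    moreover have "n * i \<ge> n * n" using \<open>i \<ge> n\<close> by simp
    ultimately show ?thesis using n2 by (metis add_eq_0_iff_both_eq_0 add_le_same_cancel2 le_antisym le_trans le_zero_eq mult_cancel1 not_numeral_le_zero order_refl trans_le_add2)
  qed
  have sb: "(\<Sum>(c,p)\<leftarrow>Lb. [:c:] * m3 p v) = [:\<gamma>:] * v 2 ^ n" for v
  proof -
    have "(\<Sum>(c,p)\<leftarrow>Lb. [:c:] * m3 p v) = (\<Sum>(c,p)\<leftarrow>Lb. [:c:] * v 2 ^ n)"
      by (rule arg_cong[of _ _ sum_list], rule map_cong[OF refl]) (use Lb in \<open>force simp: m3_def\<close>)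
    also have "\<dots> = [:\<gamma>:] * v 2 ^ n" unfolding \<gamma>_def by (induction Lb) (auto simp: algebra_simps smult_add_left)
    finally show ?thesis .
  qed
  have spl: "(\<Sum>(c,p)\<leftarrow>L1. [:c:] * m3 p v) = (\<Sum>(c,p)\<leftarrow>Lb. [:c:] * m3 p v) + (\<Sum>(c,p)\<leftarrow>La. [:c:] * m3 p v)" for v :: "nat \<Rightarrow> 'a poly"
    unfolding La_def Lb_def by (induction L1) (auto simp: algebra_simps)
  have ex: "G v = [:\<gamma>:] * v 2 ^ n + (\<Sum>(c,p)\<leftarrow>La. [:c:] * m3 p v)" for v using GL1 spl sb by metis
  have "\<gamma> \<noteq> 0"
  proof
    assume 0: "\<gamma> = 0"
    define v :: "nat \<Rightarrow> 'a poly" where "v = (\<lambda>i. if i = 2 then [:0,1:] else 0)"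
    have "coeff ([:c:] * m3 p v) n = 0" if "(c,p) \<in> set La" for c p
    proof -
      obtain k k' i where p: "p = (k,k',i)" by (metis prod.exhaust)
      then have "i < n" using that by (auto simp: La_def)
      show ?thesis
      proof (cases "k = 0 \<and> k' = 0")
        case True
        then show ?thesis using \<open>i < n\<close> p by (simp add: m3_def v_def flip: monom_altdef[of 1, simplified])
      next
        case False
        then show ?thesis using p by (auto simp: m3_def v_def power_0_left)
      qed
    qed
    then have "coeff (\<Sum>(c,p)\<leftarrow>La. [:c:] * m3 p v) n = 0" by (induction La) auto
    then have "coeff (G v) n = 0" using ex[of v] 0 by simp
    then show False using lead by (simp add: v_def)
  qed
  then show ?thesis using ex L1 by (intro exI[of _ \<gamma>] exI[of _ La]) (auto simp: La_def)
qed

definition \<gamma>L where "\<gamma>L = (SOME p. fst p \<noteq> 0 \<and> (\<forall>(c,k,k',i)\<in>set (snd p). i < n \<and> k + k' + n * i \<le> n * n) \<and>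
     (\<forall>v. G v = [:fst p:] * v 2 ^ n + (\<Sum>(c,p)\<leftarrow>snd p. [:c:] * m3 p v)))"
definition "\<gamma> = fst \<gamma>L"
definition "LG = snd \<gamma>L"

lemma \<gamma>L: "fst \<gamma>L \<noteq> 0 \<and> (\<forall>(c,k,k',i)\<in>set (snd \<gamma>L). i < n \<and> k + k' + n * i \<le> n * n) \<and>
     (\<forall>v. G v = [:fst \<gamma>L:] * v 2 ^ n + (\<Sum>(c,p)\<leftarrow>snd \<gamma>L. [:c:] * m3 p v))"
proof -
  obtain g0 L0 where "g0 \<noteq> 0 \<and> (\<forall>(c,k,k',i)\<in>set L0. i < n \<and> k + k' + n * i \<le> n * n) \<and>
     (\<forall>v. G v = [:g0:] * v 2 ^ n + (\<Sum>(c,p)\<leftarrow>L0. [:c:] * m3 p v))"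
    using G_expand by (elim exE) (rule that)
  then have "fst (g0,L0) \<noteq> 0 \<and> (\<forall>(c,k,k',i)\<in>set (snd (g0,L0)). i < n \<and> k + k' + n * i \<le> n * n) \<and>
     (\<forall>v. G v = [:fst (g0,L0):] * v 2 ^ n + (\<Sum>(c,p)\<leftarrow>snd (g0,L0). [:c:] * m3 p v))" unfolding fst_conv snd_conv .
  then show ?thesis unfolding \<gamma>L_def by (rule someI)
qed

lemma \<gamma>_nz: "\<gamma> \<noteq> 0" using \<gamma>L unfolding \<gamma>_def by (elim conjE)

lemma LG: "(c,k,k',i) \<in> set LG \<Longrightarrow> i < n \<and> k + k' + n * i \<le> n * n"
  using \<gamma>L[THEN conjunct2, THEN conjunct1] unfolding LG_def by fast

lemma G_eq: "G v = [:\<gamma>:] * v 2 ^ n + (\<Sum>(c,p)\<leftarrow>LG. [:c:] * m3 p v)"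
  using \<gamma>L[THEN conjunct2, THEN conjunct2] unfolding \<gamma>_def LG_def by (rule spec)

section \<open>Division with remainder by G as a polynomial in t\<close>

definition red :: "nat \<Rightarrow> ((nat \<Rightarrow> 'a poly) \<Rightarrow> 'a poly) \<Rightarrow> bool" where
  "red w f \<longleftrightarrow> (\<exists>c Q. \<forall>v. f v = (\<Sum>i<n. (\<Sum>(k,k')\<in>tri w. [:c i (k,k'):] * (v 0 ^ k * v 1 ^ k')) * v 2 ^ i) + G v * Q v)"

lemma red_add: "red w f \<Longrightarrow> red w f' \<Longrightarrow> red w (\<lambda>v. f v + f' v)"
  unfolding red_def
proof (elim exE, goal_cases)
  case (1 c c' Q Q')
  show ?case
    by (rule exI[of _ "\<lambda>i p. c i p + c' i p"], rule exI[of _ "\<lambda>v. Q v + Q' v"])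
      (use 1 in \<open>auto simp: algebra_simps sum.distrib smult_add_left split_def simp flip: sum_distrib_left sum_distrib_right\<close>)
qed

lemma red_zero: "red w (\<lambda>v. 0)"
  unfolding red_def by (rule exI[of _ "\<lambda>_ _. 0"], rule exI[of _ "\<lambda>_. 0"]) (auto simp: split_def)

lemma red_scale: "red w f \<Longrightarrow> red w (\<lambda>v. [:a:] * f v)"
  unfolding red_def
proof (elim exE, goal_cases)
  case (1 c Q)
  show ?case
    by (rule exI[of _ "\<lambda>i p. a * c i p"], rule exI[of _ "\<lambda>v. [:a:] * Q v"])
      (use 1 in \<open>simp only: const_poly_mult distrib_left sum_distrib_left sum_distrib_right split_def mult.assoc mult.left_commute[of "[:a:]"], simp\<close>)
qed

lemma red_G: "red w (\<lambda>v. G v * Q v)"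
  unfolding red_def by (rule exI[of _ "\<lambda>_ _. 0"], rule exI[of _ Q]) (auto simp: split_def)

lemma red_sum_list: "(\<And>x. x \<in> set L \<Longrightarrow> red w (f x)) \<Longrightarrow> red w (\<lambda>v. \<Sum>x\<leftarrow>L. f x v)"
  by (induction L) (auto intro: red_zero red_add)

lemma m3_mult: "m3 (k,k',i) v * m3 (l,l',j) v = m3 (k+l,k'+l',i+j) v"
  by (simp add: m3_def power_add)

text \<open>Replacing t^n by means of G lowers the exponent of t without raising the weight, because
  every term of \<open>LG\<close> weighs at most n^2, the weight of t^n. Hence the coefficients of
  the remainder have degree at most \<open>w\<close> in x and s.\<close>

lemma red_monomial: "k + k' + n * i \<le> w \<Longrightarrow> red w (m3 (k,k',i))"
proof (induction i arbitrary: k k' rule: less_induct)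
  case (less i)
  show ?case
  proof (cases "i < n")
    case True
    have "m3 (k,k',i) v = (\<Sum>i'<n. (\<Sum>(l,l')\<in>tri w. [:if i' = i \<and> (l,l') = (k,k') then 1 else 0:] * (v 0 ^ l * v 1 ^ l')) * v 2 ^ i')" for v :: "nat \<Rightarrow> 'a poly"
    proof -
      have kk: "(k,k') \<in> tri w" using less.prems by (simp add: tri_def)
      have "(\<Sum>(l,l')\<in>tri w. [:if i' = i \<and> (l,l') = (k,k') then 1 else 0:] * (v 0 ^ l * v 1 ^ l')) * v 2 ^ i'
         = (if i' = i then m3 (k,k',i) v else 0)" for i'
      proof (cases "i' = i")
        case True
        have "(\<Sum>(l,l')\<in>tri w. [:if i' = i \<and> (l,l') = (k,k') then 1 else 0:] * (v 0 ^ l * v 1 ^ l'))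
           = (\<Sum>p\<in>tri w. if p = (k,k') then v 0 ^ k * v 1 ^ k' else 0)"
          using True by (intro sum.cong) (auto split: if_splits)
        then show ?thesis using kk True by (simp add: m3_def)
      qed (auto simp: split_def)
      then show ?thesis using True by simp
    qed
    then show ?thesis unfolding red_def
      by (intro exI[of _ "\<lambda>i' p. if i' = i \<and> p = (k,k') then 1 else 0"] exI[of _ "\<lambda>_. 0"]) auto
  next
    case False
    define j where "j = i - n"
    have ij: "i = n + j" using False by (simp add: j_def)
    have m: "m3 (k,k',i) v = G v * ([:1/\<gamma>:] * m3 (k,k',j) v) + (\<Sum>(c,l,l',a)\<leftarrow>LG. [:-c/\<gamma>:] * m3 (k+l,k'+l',j+a) v)" for v :: "nat \<Rightarrow> 'a poly"
    proof -
      have "[:1/\<gamma>:] * (m3 (k,k',j) v * (G v - (\<Sum>(c,p)\<leftarrow>LG. [:c:] * m3 p v))) = [:1/\<gamma>:] * (m3 (k,k',j) v * ([:\<gamma>:] * v 2 ^ n))"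
        using G_eq[of v] by simp
      also have "\<dots> = ([:1/\<gamma>:] * [:\<gamma>:]) * (m3 (k,k',j) v * v 2 ^ n)" by (simp only: mult_ac)
      also have "[:1/\<gamma>:] * [:\<gamma>:] = 1" using \<gamma>_nz by (simp add: one_pCons)
      also have "1 * (m3 (k,k',j) v * v 2 ^ n) = m3 (k,k',i) v" by (simp add: m3_def ij power_add mult_ac)
      finally have "m3 (k,k',i) v = G v * ([:1/\<gamma>:] * m3 (k,k',j) v) - [:1/\<gamma>:] * (m3 (k,k',j) v * (\<Sum>(c,p)\<leftarrow>LG. [:c:] * m3 p v))"
        by (simp only: algebra_simps)
      also have "[:1/\<gamma>:] * (m3 (k,k',j) v * (\<Sum>(c,p)\<leftarrow>L. [:c:] * m3 p v)) = - (\<Sum>(c,l,l',a)\<leftarrow>L. [:-c/\<gamma>:] * m3 (k+l,k'+l',j+a) v)" for L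
        by (induction L) (auto simp: algebra_simps smult_add_right simp flip: m3_mult)
      finally show ?thesis by simp
    qed
    have "red w (\<lambda>v. \<Sum>(c,l,l',a)\<leftarrow>LG. [:-c/\<gamma>:] * m3 (k+l,k'+l',j+a) v)"
    proof -
      have "red w (\<lambda>v. (case x of (c,l,l',a) \<Rightarrow> [:-c/\<gamma>:] * m3 (k+l,k'+l',j+a) v))" if "x \<in> set LG" for x
      proof -
        obtain c l l' a where x: "x = (c,l,l',a)" by (metis prod.exhaust)
        then have "a < n" "l + l' + n * a \<le> n * n" using LG that by auto
        then have "j + a < i" "k + l + (k' + l') + n * (j + a) \<le> w" using ij less.prems by (auto simp: algebra_simps)
        then have "red w (m3 (k+l,k'+l',j+a))" using less.IH by blast
        from red_scale[OF this, of "-c/\<gamma>"] show ?thesis unfolding x prod.case .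
      qed
      then show ?thesis by (rule red_sum_list)
    qed
    then show ?thesis using red_add[OF red_G] m by (simp only: ext[of "m3 (k,k',i)", OF m])
  qed
qed

section \<open>Reduction at pairs of distinct roots t and T\<close>

text \<open>Dividing out \<open>t - T\<close> bounds the exponent of \<open>T\<close> by \<open>n - 2\<close> on this set, hence the range \<open>{..<n-1}\<close> in \<open>basis\<close> below.\<close>

definition Yset :: "(nat \<Rightarrow> 'a) set" where
  "Yset = {env. Gc env = 0 \<and> Gc (env(2 := env 3)) = 0 \<and> env 2 \<noteq> env 3}"

definition m5 :: "nat \<times> nat \<times> nat \<times> nat \<times> nat \<Rightarrow> (nat \<Rightarrow> 'a) \<Rightarrow> 'a" where
  "m5 = (\<lambda>(k,k',i,j,l) env. env 0 ^ k * env 1 ^ k' * env 2 ^ i * env 3 ^ j * env 4 ^ l)"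

definition basis :: "nat \<Rightarrow> nat \<Rightarrow> (nat \<times> nat \<times> nat \<times> nat \<times> nat) set" where
  "basis w r = (\<lambda>((k,k'),i,j,l). (k,k',i,j,l)) ` (tri w \<times> {..<n} \<times> {..<n-1} \<times> {..r})"

lemma finite_basis [simp]: "finite (basis w r)" by (simp add: basis_def)

lemma card_basis: "card (basis w r) = card (tri w) * n * (n - 1) * (r + 1)"
proof -
  have "inj_on (\<lambda>((k,k'),i,j,l). (k,k',i,j,l)) (tri w \<times> {..<n} \<times> {..<n-1} \<times> {..r})"
    by (auto simp: inj_on_def)
  then show ?thesis unfolding basis_def by (simp add: card_image card_cartesian_product algebra_simps)
qed

text \<open>Equality is asked for values on \<open>Yset\<close> only, with coefficients that do not
  depend on the point. This is enough to turn vanishing at every point into finitely many linear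
  conditions.\<close>

definition rep :: "nat \<Rightarrow> nat \<Rightarrow> ((nat \<Rightarrow> 'a) \<Rightarrow> 'a) \<Rightarrow> bool" where
  "rep w r f \<longleftrightarrow> (\<exists>c. \<forall>env\<in>Yset. f env = (\<Sum>b\<in>basis w r. c b * m5 b env))"

lemma rep_add: "rep w r f \<Longrightarrow> rep w r f' \<Longrightarrow> rep w r (\<lambda>v. f v + f' v)"
  unfolding rep_def
proof (elim exE, goal_cases)
  case (1 c c')
  then show ?case by (intro exI[of _ "\<lambda>b. c b + c' b"]) (auto simp: algebra_simps sum.distrib)
qed

lemma rep_zero: "rep w r (\<lambda>v. 0)"
  unfolding rep_def by (rule exI[of _ "\<lambda>_. 0"]) auto

lemma rep_scale: "rep w r f \<Longrightarrow> rep w r (\<lambda>v. a * f v)"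
  unfolding rep_def
proof (elim exE, goal_cases)
  case (1 c)
  then show ?case by (intro exI[of _ "\<lambda>b. a * c b"]) (auto simp: sum_distrib_left mult.assoc)
qed

lemma rep_sum_list: "(\<And>x. x \<in> set L \<Longrightarrow> rep w r (f x)) \<Longrightarrow> rep w r (\<lambda>v. \<Sum>x\<leftarrow>L. f x v)"
  by (induction L) (auto intro: rep_zero rep_add)

lemma rep_sum: "(\<And>x. x \<in> S \<Longrightarrow> rep w r (f x)) \<Longrightarrow> rep w r (\<lambda>v. \<Sum>x\<in>S. f x v)"
  by (induction S rule: infinite_finite_induct) (auto intro: rep_zero rep_add)

lemma rep_cong: "rep w r f \<Longrightarrow> (\<And>env. env \<in> Yset \<Longrightarrow> f' env = f env) \<Longrightarrow> rep w r f'"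
  unfolding rep_def by auto

lemma Gc_eq: "Gc env = \<gamma> * env 2 ^ n + (\<Sum>(c,p)\<leftarrow>LG. c * m3 p env)"
proof -
  have m: "m3 p (\<lambda>i. [:env i:]) = [:m3 p env:]" for p
    by (cases p) (simp add: m3_def poly_const_pow)
  have s: "(\<Sum>(c,p)\<leftarrow>L. [:c:] * m3 p (\<lambda>i. [:env i:])) = [:\<Sum>(c,p)\<leftarrow>L. c * m3 p env:]" for L
    by (induction L) (auto simp: m)
  have "[:Gc env:] = [:\<gamma>:] * [:env 2:] ^ n + (\<Sum>(c,p)\<leftarrow>LG. [:c:] * m3 p (\<lambda>i. [:env i:]))"
    using G_eq[of "\<lambda>i. [:env i:]"] G_const[of env] by simp
  then have "[:Gc env:] = [:\<gamma> * env 2 ^ n + (\<Sum>(c,p)\<leftarrow>LG. c * m3 p env):]" unfolding s by (simp add: poly_const_pow)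
  then show ?thesis by simp
qed

lemma rep_monomial_t: "k + k' + n * (i + j) \<le> w \<Longrightarrow> l \<le> r \<Longrightarrow> j < n - 1 \<Longrightarrow> rep w r (m5 (k,k',i,j,l))"
proof (induction i arbitrary: k k' rule: less_induct)
  case (less i)
  show ?case
  proof (cases "i < n")
    case True
    then have "(k,k',i,j,l) \<in> basis w r" using less.prems unfolding basis_def tri_def by force
    then have "m5 (k,k',i,j,l) env = (\<Sum>b\<in>basis w r. (if b = (k,k',i,j,l) then 1 else 0) * m5 b env)" for env
      by (simp add: if_distrib[of "\<lambda>x. x * _"] cong: if_cong)
    then show ?thesis unfolding rep_def by (intro exI[of _ "\<lambda>b. if b = (k,k',i,j,l) then 1 else 0"]) auto
  next
    case False
    define i' where "i' = i - n"
    have ij: "i = n + i'" using False by (simp add: i'_def)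
    have "rep w r (\<lambda>env. \<Sum>x\<leftarrow>LG. (case x of (c,a,a',e) \<Rightarrow> (- c / \<gamma>) * m5 (k+a,k'+a',i'+e,j,l) env))"
    proof (rule rep_sum_list)
      fix x assume x: "x \<in> set LG"
      obtain c a a' e where xx: "x = (c,a,a',e)" by (metis prod.exhaust)
      then have "e < n" "a + a' + n * e \<le> n * n" using LG x by auto
      then have "i' + e < i" "k + a + (k' + a') + n * (i' + e + j) \<le> w" using ij less.prems by (auto simp: algebra_simps)
      then have "rep w r (m5 (k+a,k'+a',i'+e,j,l))" using less by blast
      from rep_scale[OF this, of "- c / \<gamma>"] show "rep w r (\<lambda>env. (case x of (c,a,a',e) \<Rightarrow> (- c / \<gamma>) * m5 (k+a,k'+a',i'+e,j,l) env))"
        unfolding xx by simp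
    qed
    then show ?thesis
    proof (rule rep_cong)
      fix env assume "env \<in> Yset"
      then have "Gc env = 0" by (simp add: Yset_def)
      then have e: "env 2 ^ n = - (\<Sum>(c,p)\<leftarrow>LG. c * m3 p env) / \<gamma>"
        using Gc_eq[of env] \<gamma>_nz by (simp add: field_simps eq_neg_iff_add_eq_0)
      have "m5 (k,k',i,j,l) env = m5 (k,k',i',j,l) env * env 2 ^ n" by (simp add: m5_def ij power_add)
      also have "\<dots> = m5 (k,k',i',j,l) env * (- (\<Sum>(c,p)\<leftarrow>LG. c * m3 p env) / \<gamma>)" unfolding e ..
      also have "m5 (k,k',i',j,l) env * (- (\<Sum>(c,p)\<leftarrow>L. c * m3 p env) / \<gamma>) =
        (\<Sum>x\<leftarrow>L. (case x of (c,a,a',e) \<Rightarrow> (- c / \<gamma>) * m5 (k+a,k'+a',i'+e,j,l) env))" for L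
      proof (induction L)
        case (Cons x L)
        obtain c a a' e where xx: "x = (c,a,a',e)" by (metis prod.exhaust)
        have h1: "m5 (k,k',i',j,l) env * (- (c * m3 (a,a',e) env) / \<gamma>) = (- c / \<gamma>) * m5 (k+a,k'+a',i'+e,j,l) env"
          by (simp add: m5_def m3_def power_add)
        have h2: "a * (- (b + d) / \<gamma>) = a * (- b / \<gamma>) + a * (- d / \<gamma>)" for a b d :: 'a
          using \<gamma>_nz by (simp add: field_simps)
        show ?case unfolding xx by (simp only: list.map sum_list.Cons prod.case h2 h1 Cons)
      qed simp
      finally show "m5 (k,k',i,j,l) env = (\<Sum>x\<leftarrow>LG. (case x of (c,a,a',e) \<Rightarrow> (- c / \<gamma>) * m5 (k+a,k'+a',i'+e,j,l) env))" .
    qed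
  qed
qed

text \<open>Dividing Gc(T) - Gc(t) by T - t leaves an equation of degree n - 1 in T with leading
  coefficient \<open>\<gamma>\<close>. It is available because the two roots are distinct.\<close>

lemma T_power_reduce:
  assumes "env \<in> Yset"
  shows "env 3 ^ (n - 1) = - (\<Sum>a<n-1. env 3 ^ a * env 2 ^ (n - 1 - a))
     - (\<Sum>(c,k,k',i)\<leftarrow>LG. (c / \<gamma>) * (env 0 ^ k * env 1 ^ k' * (\<Sum>a<i. env 3 ^ a * env 2 ^ (i - 1 - a))))"
proof -
  let ?t = "env 2" and ?T = "env 3"
  have y: "Gc env = 0" "Gc (env(2 := ?T)) = 0" "?t \<noteq> ?T" using assms by (auto simp: Yset_def)
  have dp: "?T ^ i - ?t ^ i = (?T - ?t) * (\<Sum>a<i. ?T ^ a * ?t ^ (i - 1 - a))" for i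
  proof (cases i)
    case (Suc i')
    then show ?thesis using power_diff_sumr2[of ?T "Suc i'" ?t] by (simp add: mult.commute)
  qed simp
  have "0 = Gc (env(2 := ?T)) - Gc env" using y by simp
  also have "\<dots> = \<gamma> * (?T ^ n - ?t ^ n) + ((\<Sum>(c,p)\<leftarrow>LG. c * m3 p (env(2:=?T))) - (\<Sum>(c,p)\<leftarrow>LG. c * m3 p env))"
    unfolding Gc_eq by (simp add: algebra_simps)
  also have "(\<Sum>(c,p)\<leftarrow>L. c * m3 p (env(2:=?T))) - (\<Sum>(c,p)\<leftarrow>L. c * m3 p env)
      = (?T - ?t) * (\<Sum>(c,k,k',i)\<leftarrow>L. c * (env 0 ^ k * env 1 ^ k' * (\<Sum>a<i. ?T ^ a * ?t ^ (i - 1 - a))))" for L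
  proof (induction L)
    case (Cons x L)
    obtain c k k' i where x: "x = (c,k,k',i)" by (metis prod.exhaust)
    have "c * m3 (k,k',i) (env(2:=?T)) - c * m3 (k,k',i) env = c * (env 0 ^ k * env 1 ^ k' * (?T ^ i - ?t ^ i))"
      by (simp add: m3_def algebra_simps)
    then show ?case using Cons unfolding x dp by (simp add: algebra_simps del: fun_upd_apply)
  qed simp
  finally have "0 = (?T - ?t) * (\<gamma> * (\<Sum>a<n. ?T ^ a * ?t ^ (n - 1 - a)) +
      (\<Sum>(c,k,k',i)\<leftarrow>LG. c * (env 0 ^ k * env 1 ^ k' * (\<Sum>a<i. ?T ^ a * ?t ^ (i - 1 - a)))))"
    unfolding dp by (simp add: algebra_simps)
  then have z: "\<gamma> * (\<Sum>a<n. ?T ^ a * ?t ^ (n - 1 - a)) +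
      (\<Sum>(c,k,k',i)\<leftarrow>LG. c * (env 0 ^ k * env 1 ^ k' * (\<Sum>a<i. ?T ^ a * ?t ^ (i - 1 - a)))) = 0"
    using y(3) by simp
  have "n = Suc (n - 1)" using n2 by simp
  then have "(\<Sum>a<n. ?T ^ a * ?t ^ (n - 1 - a)) = (\<Sum>a<n-1. ?T ^ a * ?t ^ (n - 1 - a)) + ?T ^ (n - 1)"
    by (metis (no_types, lifting) diff_self_eq_0 mult.right_neutral power_0 sum.lessThan_Suc)
  moreover have "(\<Sum>(c,k,k',i)\<leftarrow>L. c * (env 0 ^ k * env 1 ^ k' * (\<Sum>a<i. ?T ^ a * ?t ^ (i - 1 - a))))
     = \<gamma> * (\<Sum>(c,k,k',i)\<leftarrow>L. (c / \<gamma>) * (env 0 ^ k * env 1 ^ k' * (\<Sum>a<i. env 3 ^ a * env 2 ^ (i - 1 - a))))" for L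
    using \<gamma>_nz by (induction L) (auto simp: algebra_simps)
  ultimately have "\<gamma> * ((\<Sum>a<n-1. ?T ^ a * ?t ^ (n - 1 - a)) + ?T ^ (n - 1) + 
     (\<Sum>(c,k,k',i)\<leftarrow>LG. (c / \<gamma>) * (env 0 ^ k * env 1 ^ k' * (\<Sum>a<i. env 3 ^ a * env 2 ^ (i - 1 - a))))) = 0"
    using z by (simp only: distrib_left)
  then have "(\<Sum>a<n-1. ?T ^ a * ?t ^ (n - 1 - a)) + ?T ^ (n - 1) + 
     (\<Sum>(c,k,k',i)\<leftarrow>LG. (c / \<gamma>) * (env 0 ^ k * env 1 ^ k' * (\<Sum>a<i. env 3 ^ a * env 2 ^ (i - 1 - a)))) = 0"
    using \<gamma>_nz by (simp only: mult_eq_0_iff) blast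
  moreover have "a + b + d = 0 \<Longrightarrow> b = - a - d" for a b d :: 'a by (simp add: eq_neg_iff_add_eq_0 algebra_simps)
  ultimately show ?thesis by blast
qed

text \<open>T has to be reduced before t, because reducing T creates new powers of t, while
  replacing t^n afterwards leaves the exponent of T alone. Both replacements respect the
  weight.\<close>

lemma rep_monomial: "k + k' + n * (i + j) \<le> w \<Longrightarrow> l \<le> r \<Longrightarrow> rep w r (m5 (k,k',i,j,l))"
proof (induction j arbitrary: k k' i rule: less_induct)
  case (less j)
  show ?case
  proof (cases "j < n - 1")
    case True
    then show ?thesis using rep_monomial_t less.prems by blast
  next
    case False
    define j' where "j' = j - (n - 1)"
    have jj: "j = (n - 1) + j'" using False by (simp add: j'_def)
    define f1 where "f1 = (\<lambda>env. \<Sum>a<n-1. (-1) * m5 (k,k',i + (n - 1 - a),j' + a,l) env)"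
    define f2 where "f2 = (\<lambda>env. \<Sum>x\<leftarrow>LG. (case x of (c,b,b',e) \<Rightarrow> \<Sum>a<e. (- c / \<gamma>) * m5 (k+b,k'+b',i+(e-1-a),j'+a,l) env))"
    have r1: "rep w r f1" unfolding f1_def
    proof (intro rep_sum rep_scale)
      fix a assume a: "a \<in> {..<n-1}"
      then have "j' + a < j" "i + (n - 1 - a) + (j' + a) = i + j" using jj by auto
      then show "rep w r (m5 (k,k',i + (n - 1 - a),j' + a,l))" using less by metis
    qed
    have r2: "rep w r f2" unfolding f2_def
    proof (rule rep_sum_list)
      fix x assume x: "x \<in> set LG"
      obtain c b b' e where xx: "x = (c,b,b',e)" by (metis prod.exhaust)
      then have e: "e < n" "b + b' + n * e \<le> n * n" using LG x by auto
      have "rep w r (\<lambda>env. \<Sum>a<e. (- c / \<gamma>) * m5 (k+b,k'+b',i+(e-1-a),j'+a,l) env)"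
      proof (intro rep_sum rep_scale)
        fix a assume a: "a \<in> {..<e}"
        have 1: "j' + a < j" using a e jj by auto
        have 2: "i + (e - 1 - a) + (j' + a) = i + j' + (e - 1)" using a by auto
        have "n * (i + j' + (e - 1)) + n * n = n * (i + j) + n * e"
        proof -
          have "i + j' + (e - 1) + n = i + j + e" using a jj n2 by auto
          then show ?thesis by (metis distrib_left)
        qed
        then have "k + b + (k' + b') + n * (i + (e - 1 - a) + (j' + a)) \<le> w" using e less.prems unfolding 2 by linarith
        then show "rep w r (m5 (k+b,k'+b',i+(e-1-a),j'+a,l))" using less 1 by blast
      qed
      then show "rep w r (\<lambda>env. (case x of (c,b,b',e) \<Rightarrow> \<Sum>a<e. (- c / \<gamma>) * m5 (k+b,k'+b',i+(e-1-a),j'+a,l) env))"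
        unfolding xx by simp
    qed
    from rep_add[OF r1 r2] show ?thesis
    proof (rule rep_cong)
      fix env assume "env \<in> Yset"
      note T = T_power_reduce[OF this]
      let ?m = "m5 (k,k',i,j',l) env"
      have "m5 (k,k',i,j,l) env = ?m * env 3 ^ (n - 1)" by (simp add: m5_def jj power_add)
      also have "\<dots> = (\<Sum>a<n-1. (-1) * (?m * (env 3 ^ a * env 2 ^ (n - 1 - a)))) + - (?m * (\<Sum>(c,k,k',i)\<leftarrow>LG. (c / \<gamma>) * (env 0 ^ k * env 1 ^ k' * (\<Sum>a<i. env 3 ^ a * env 2 ^ (i - 1 - a)))))"
        unfolding T by (simp add: algebra_simps sum_distrib_left sum_negf)
      also have "(\<Sum>a<n-1. (-1) * (?m * (env 3 ^ a * env 2 ^ (n - 1 - a)))) = f1 env" unfolding f1_def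
        by (intro sum.cong refl) (simp only: m5_def prod.case power_add mult_ac)
      also have "- (?m * (\<Sum>(c,k,k',i)\<leftarrow>L. (c / \<gamma>) * (env 0 ^ k * env 1 ^ k' * (\<Sum>a<i. env 3 ^ a * env 2 ^ (i - 1 - a)))))
        = (\<Sum>x\<leftarrow>L. (case x of (c,b,b',e) \<Rightarrow> \<Sum>a<e. (- c / \<gamma>) * m5 (k+b,k'+b',i+(e-1-a),j'+a,l) env))" for L
      proof (induction L)
        case (Cons x L)
        obtain c b b' e where xx: "x = (c,b,b',e)" by (metis prod.exhaust)
        have "- (?m * ((c / \<gamma>) * (env 0 ^ b * env 1 ^ b' * (\<Sum>a<e. env 3 ^ a * env 2 ^ (e - 1 - a)))))
          = (\<Sum>a<e. (- c / \<gamma>) * m5 (k+b,k'+b',i+(e-1-a),j'+a,l) env)"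
        proof -
          have "- (?m * ((c / \<gamma>) * (env 0 ^ b * env 1 ^ b' * (\<Sum>a<e. env 3 ^ a * env 2 ^ (e - 1 - a)))))
            = (\<Sum>a<e. - (?m * ((c / \<gamma>) * (env 0 ^ b * env 1 ^ b' * (env 3 ^ a * env 2 ^ (e - 1 - a))))))"
            by (simp add: sum_distrib_left sum_negf)
          also have "\<dots> = (\<Sum>a<e. (- c / \<gamma>) * m5 (k+b,k'+b',i+(e-1-a),j'+a,l) env)"
            by (intro sum.cong refl) (simp only: m5_def prod.case power_add mult_ac minus_divide_left[symmetric] mult_minus_left mult_minus_right)
          finally show ?thesis .
        qed
        then show ?case using Cons unfolding xx by (simp add: algebra_simps)
      qed simp
      finally show "m5 (k,k',i,j,l) env = f1 env + f2 env" unfolding f2_def .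
    qed
  qed
qed

lemma pwE_rep:
  assumes f: "pwE n (int w) (int r) f"
  shows "rep w r f"
proof -
  obtain L where L: "\<forall>(c,ex)\<in>set L. (\<Sum>i<5. wtE n i * int (ex i)) \<le> int w \<and> (\<Sum>i<5. mtE i * int (ex i)) \<le> int r"
    "\<forall>v. f v = (\<Sum>(c,ex)\<leftarrow>L. c * (\<Prod>i<5. v i ^ ex i))" using pw_monomials[OF f] by fastforce
  have p5: "(\<Prod>i<5. h i) = h 0 * h 1 * h 2 * h 3 * h (4::nat)" for h :: "nat \<Rightarrow> 'a"
    by (simp add: eval_nat_numeral)
  have s5: "(\<Sum>i<5. h i) = h 0 + h 1 + h 2 + h 3 + h (4::nat)" for h :: "nat \<Rightarrow> int"
    by (simp add: eval_nat_numeral)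
  have "rep w r (\<lambda>v. \<Sum>x\<leftarrow>L. (case x of (c,ex) \<Rightarrow> c * m5 (ex 0, ex 1, ex 2, ex 3, ex 4) v))"
  proof (rule rep_sum_list)
    fix x assume x: "x \<in> set L"
    obtain c ex where xx: "x = (c,ex)" by force
    have "int (ex 0) + int (ex 1) + int n * (int (ex 2) + int (ex 3)) \<le> int w" "int (ex 4) \<le> int r"
      using L(1) x xx by (auto simp: s5 wtE_def mtE_def algebra_simps)
    then have "ex 0 + ex 1 + n * (ex 2 + ex 3) \<le> w" "ex 4 \<le> r" by (metis of_nat_add of_nat_le_iff of_nat_mult)+
    from rep_scale[OF rep_monomial[OF this], of c] show "rep w r (\<lambda>v. (case x of (c,ex) \<Rightarrow> c * m5 (ex 0, ex 1, ex 2, ex 3, ex 4) v))"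
      unfolding xx by simp
  qed
  then show ?thesis
  proof (rule rep_cong)
    fix env
    have "f env = (\<Sum>(c,ex)\<leftarrow>L. c * (\<Prod>i<5. env i ^ ex i))" using L(2) by blast
    then show "f env = (\<Sum>x\<leftarrow>L. (case x of (c,ex) \<Rightarrow> c * m5 (ex 0, ex 1, ex 2, ex 3, ex 4) env))"
      by (simp add: p5 m5_def)
  qed
qed

section \<open>The linear system for the auxiliary polynomial\<close>

definition mon :: "'a \<Rightarrow> nat \<times> nat \<times> nat \<Rightarrow> (nat \<Rightarrow> 'a poly) \<Rightarrow> 'a poly" where
  "mon x0 = (\<lambda>(k,k',i) v. (v 0 - [:x0:]) ^ k * v 1 ^ k' * v 2 ^ i)"

text \<open>The value of the Frobenius factor over a K-rational pair (x, s): there x^q = x and s^q =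
  s, so only t is replaced, by the second root T = t^q in variable 3. The shift \<open>y0\<close>
  will be x0^q.\<close>

definition monE :: "'a \<Rightarrow> nat \<times> nat \<times> nat \<Rightarrow> (nat \<Rightarrow> 'a) \<Rightarrow> 'a" where
  "monE y0 = (\<lambda>(l,l',j) env. (env 0 - y0) ^ l * env 1 ^ l' * env 3 ^ j)"

definition Al :: "nat \<Rightarrow> (nat \<times> nat \<times> nat) set" where
  "Al a = (\<lambda>((k,k'),i). (k,k',i)) ` (tri a \<times> {..<n})"

lemma finite_Al [simp]: "finite (Al a)" by (simp add: Al_def)

lemma card_Al: "card (Al a) = card (tri a) * n"
proof -
  have "inj_on (\<lambda>((k,k'),i). (k,k',i)) (tri a \<times> {..<n})" by (auto simp: inj_on_def)
  then show ?thesis unfolding Al_def by (simp add: card_image card_cartesian_product)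
qed

lemma mem_Al: "(k,k',i) \<in> Al a \<longleftrightarrow> k + k' \<le> a \<and> i < n"
  by (force simp: Al_def tri_def)

lemma mon_pw: "pwR n 3 (int (k + k' + n * i)) (mon x0 (k,k',i))"
proof -
  have 0: "pwR n 3 1 (\<lambda>v. v 0 - [:x0:])"
    by (rule pw_diff) (auto intro!: pw.var pw.const simp: wtR_def)
  have 1: "pwR n 3 1 (\<lambda>v. v 1)" and 2: "pwR n 3 (int n) (\<lambda>v. v 2)" by (auto intro!: pw.var simp: wtR_def)
  have "pwR n 3 (int k + int k') (\<lambda>v. (v 0 - [:x0:]) ^ k * v 1 ^ k')"
    using pw_mult'[OF pw_power[OF 0, of k] pw_power[OF 1, of k']] by simp
  from pw_mult'[OF this pw_power[OF 2, of i]] show ?thesis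
    unfolding mon_def prod.case by (simp add: algebra_simps)
qed

lemma monE_pw: "pwE n (int (l + l' + n * j)) 0 (monE y0 (l,l',j))"
proof -
  have 0: "pwE n 1 0 (\<lambda>v. v 0 - y0)"
    by (rule pw_diff) (auto intro!: pw.var pw.const simp: wtE_def mtE_def)
  have 1: "pwE n 1 0 (\<lambda>v. v 1)" and 2: "pwE n (int n) 0 (\<lambda>v. v 3)" by (auto intro!: pw.var simp: wtE_def mtE_def)
  have "pwE n (int l + int l') 0 (\<lambda>v. (v 0 - y0) ^ l * v 1 ^ l')"
    using pw_mult'[OF pw_power[OF 0, of l] pw_power[OF 1, of l']] by simp
  from pw_mult'[OF this pw_power[OF 2, of j]] show ?thesis
    unfolding monE_def prod.case by (simp add: algebra_simps)
qed

text \<open>Origin of the bound: the exponents of t and T are below n and together add at most 2 n^2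
  to a + b, and each of the at most m - 1 orders in Y costs c0 \<le> 2 n^2.\<close>

lemma coeff_mon_rep:
  assumes "\<alpha> \<in> Al a" "\<beta> \<in> Al b" "r < m"
  shows "rep (a + b + 2 * n * n * m) r (\<lambda>env. coeff (mon x0 \<alpha> (sh m env)) r * monE y0 \<beta> env)"
proof -
  obtain k k' i where al: "\<alpha> = (k,k',i)" by (metis prod.exhaust)
  obtain l l' j where be: "\<beta> = (l,l',j)" by (metis prod.exhaust)
  have w: "k + k' \<le> a" "i < n" "l + l' \<le> b" "j < n" using assms by (auto simp: al be mem_Al)
  have "eclass n c0 (int (k + k' + n * i)) (\<lambda>env. mon x0 \<alpha> (sh m env))"
    unfolding al by (rule eclass_subst[OF mon_pw eclass_sh])
  then have 1: "pwE n (int (k + k' + n * i) + int r * c0) (int r) (\<lambda>env. coeff (mon x0 \<alpha> (sh m env)) r)"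
    unfolding eclass_def by blast
  have 2: "pwE n (int (l + l' + n * j)) 0 (monE y0 \<beta>)" unfolding be by (rule monE_pw)
  have "int (k + k' + n * i) + int r * c0 + int (l + l' + n * j) \<le> int (a + b + 2 * n * n * m)"
  proof -
    have "n * i \<le> n * n" "n * j \<le> n * n" using w by auto
    then have "k + k' + n * i + (l + l' + n * j) \<le> a + b + 2 * n * n" using w by linarith
    then have A: "int (k + k' + n * i) + int (l + l' + n * j) \<le> int (a + b) + 2 * int n * int n"
      by (metis (mono_tags, lifting) of_nat_add of_nat_le_iff of_nat_mult of_nat_numeral)
    have "c0 \<le> 2 * int n * int n" unfolding c0_def by simp
    moreover have "0 \<le> c0" unfolding c0_def
    proof -
      have "int n * 2 \<le> int n * int n" using n2 by (intro mult_left_mono) auto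
      then show "0 \<le> 2 * (int (n * n) - int n) - 1" using n2 by simp
    qed
    ultimately have "int r * c0 \<le> (int m - 1) * (2 * int n * int n)" using assms(3) by (intro mult_mono) auto
    also have "\<dots> = 2 * int n * int n * int m - 2 * int n * int n" by (simp add: algebra_simps)
    finally show ?thesis using A by simp
  qed
  then have "pwE n (int (a + b + 2 * n * n * m)) (int r) (\<lambda>env. coeff (mon x0 \<alpha> (sh m env)) r * monE y0 \<beta> env)"
    using pw_mult'[OF 1 2] by auto
  then show ?thesis by (rule pwE_rep)
qed

text \<open>The unknowns are the coefficients \<open>c\<close>; a condition is the vanishing of one
  basis coefficient in one of the m lowest Taylor coefficients. The slope \<mu> is a variable of the
  basis, so the same \<open>c\<close> serves all lines at once; the factor \<open>r + 1\<close>
  counts its powers.\<close>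

lemma ex_auxiliary_coefficients:
  assumes "card (tri (a + b + 2 * n * n * m)) * n * (n - 1) * (\<Sum>r<m. r + 1) < (card (tri a) * n) * (card (tri b) * n)"
  shows "\<exists>c. (\<exists>\<alpha>\<in>Al a. \<exists>\<beta>\<in>Al b. c (\<alpha>,\<beta>) \<noteq> 0) \<and>
    (\<forall>env\<in>Yset. \<forall>r<m. (\<Sum>(\<alpha>,\<beta>)\<in>Al a \<times> Al b. c (\<alpha>,\<beta>) * (coeff (mon x0 \<alpha> (sh m env)) r * monE y0 \<beta> env)) = 0)"
proof -
  define w where "w = a + b + 2 * n * n * m"
  define E where "E = Sigma {..<m} (\<lambda>r. basis w r)"
  define Lc where "Lc = (\<lambda>\<alpha> \<beta> r. SOME c. \<forall>env\<in>Yset. coeff (mon x0 \<alpha> (sh m env)) r * monE y0 \<beta> env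
     = (\<Sum>bb\<in>basis w r. c bb * m5 bb env))"
  have Lc: "coeff (mon x0 \<alpha> (sh m env)) r * monE y0 \<beta> env = (\<Sum>bb\<in>basis w r. Lc \<alpha> \<beta> r bb * m5 bb env)"
    if "\<alpha> \<in> Al a" "\<beta> \<in> Al b" "r < m" "env \<in> Yset" for \<alpha> \<beta> r env
  proof -
    have "\<exists>c. \<forall>env\<in>Yset. coeff (mon x0 \<alpha> (sh m env)) r * monE y0 \<beta> env = (\<Sum>bb\<in>basis w r. c bb * m5 bb env)"
      using coeff_mon_rep[OF that(1-3)] unfolding rep_def w_def .
    from someI_ex[OF this] show ?thesis unfolding Lc_def using that(4) by (rule bspec)
  qed
  have "card E = (\<Sum>r<m. card (basis w r))" unfolding E_def by (rule card_SigmaI) auto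
  also have "\<dots> = card (tri w) * n * (n - 1) * (\<Sum>r<m. r + 1)" by (simp add: card_basis sum_distrib_left mult.assoc)
  also have "\<dots> < card (Al a \<times> Al b)" using assms by (simp add: card_cartesian_product card_Al w_def)
  finally have "card E < card (Al a \<times> Al b)" .
  moreover have "finite E" unfolding E_def by auto
  ultimately obtain c where c: "\<exists>x\<in>Al a \<times> Al b. c x \<noteq> 0"
    "\<forall>e\<in>E. (\<Sum>x\<in>Al a \<times> Al b. (case e of (r,bb) \<Rightarrow> case x of (\<alpha>,\<beta>) \<Rightarrow> Lc \<alpha> \<beta> r bb) * c x) = 0"
    using homogeneous_system_nontrivial[of E "Al a \<times> Al b" "\<lambda>e x. case e of (r,bb) \<Rightarrow> case x of (\<alpha>,\<beta>) \<Rightarrow> Lc \<alpha> \<beta> r bb"] by auto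
  have "(\<Sum>(\<alpha>,\<beta>)\<in>Al a \<times> Al b. c (\<alpha>,\<beta>) * (coeff (mon x0 \<alpha> (sh m env)) r * monE y0 \<beta> env)) = 0"
    if "env \<in> Yset" "r < m" for env r
  proof -
    have "(\<Sum>(\<alpha>,\<beta>)\<in>Al a \<times> Al b. c (\<alpha>,\<beta>) * (coeff (mon x0 \<alpha> (sh m env)) r * monE y0 \<beta> env))
      = (\<Sum>(\<alpha>,\<beta>)\<in>Al a \<times> Al b. \<Sum>bb\<in>basis w r. (Lc \<alpha> \<beta> r bb * c (\<alpha>,\<beta>)) * m5 bb env)"
      by (intro sum.cong refl, clarify, subst Lc) (use that in \<open>auto simp: sum_distrib_left mult_ac\<close>)
    also have "\<dots> = (\<Sum>bb\<in>basis w r. \<Sum>(\<alpha>,\<beta>)\<in>Al a \<times> Al b. (Lc \<alpha> \<beta> r bb * c (\<alpha>,\<beta>)) * m5 bb env)"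
      unfolding split_def by (rule sum.swap)
    also have "\<dots> = (\<Sum>bb\<in>basis w r. (\<Sum>(\<alpha>,\<beta>)\<in>Al a \<times> Al b. Lc \<alpha> \<beta> r bb * c (\<alpha>,\<beta>)) * m5 bb env)"
      by (simp add: sum_distrib_right split_def)
    also have "\<dots> = 0"
    proof (rule sum.neutral, intro ballI)
      fix bb assume "bb \<in> basis w r"
      then have "(r,bb) \<in> E" using that by (auto simp: E_def)
      then have "(\<Sum>x\<in>Al a \<times> Al b. (case x of (\<alpha>,\<beta>) \<Rightarrow> Lc \<alpha> \<beta> r bb) * c x) = 0" using c(2) by fastforce
      then show "(\<Sum>(\<alpha>,\<beta>)\<in>Al a \<times> Al b. Lc \<alpha> \<beta> r bb * c (\<alpha>,\<beta>)) * m5 bb env = 0" by (simp add: split_def)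
    qed
    finally show ?thesis .
  qed
  moreover have "\<exists>\<alpha>\<in>Al a. \<exists>\<beta>\<in>Al b. c (\<alpha>,\<beta>) \<noteq> 0" using c(1) by auto
  ultimately show ?thesis by blast
qed

end

section \<open>Vanishing forces divisibility by G\<close>

lemma Y_power_dvd_cancel:
  fixes d p :: "'k::field poly"
  assumes "[:0,1:] ^ m dvd d * p" "coeff d 0 \<noteq> 0"
  shows "[:0,1:] ^ m dvd p"
  using assms(1)
proof (induction m)
  case (Suc m)
  have "[:0,1:] ^ m dvd d * p" using Suc.prems by (rule power_le_dvd) simp
  then obtain h where h: "p = [:0,1:] ^ m * h" using Suc.IH by (auto elim: dvdE)
  have "[:0,1:] ^ m * [:0,1:] dvd [:0,1:] ^ m * (d * h)" using Suc.prems unfolding h by (simp add: mult_ac del: mult_pCons_left mult_pCons_right)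
  then have "[:0,1:] ^ 1 dvd d * h" by (simp del: mult_pCons_left mult_pCons_right)
  then have "coeff (d * h) 0 = 0" unfolding Y_power_dvd_iff by simp
  then have "coeff h 0 = 0" using assms(2) by (simp add: coeff_mult_0)
  then have "[:0,1:] ^ 1 dvd h" unfolding Y_power_dvd_iff by simp
  then have "[:0,1:] ^ m * [:0,1:] dvd p" unfolding h by (simp del: mult_pCons_left mult_pCons_right)
  then show ?case by (simp only: power_Suc2)
qed simp

text \<open>The roots have distinct constant terms, so their differences are invertible modulo
  powers of Y. Synthetic division by one root therefore passes the divisibility on to a quotient of
  smaller degree with the remaining roots.\<close>

lemma vandermonde_dvd:
  fixes P :: "'k::field poly poly" and \<tau> :: "'k \<Rightarrow> 'k poly"
  assumes "finite R" "degree P < card R" "\<And>r. r \<in> R \<Longrightarrow> coeff (\<tau> r) 0 = r"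
    "\<And>r. r \<in> R \<Longrightarrow> [:0,1:] ^ m dvd poly P (\<tau> r)"
  shows "[:0,1:] ^ m dvd coeff P i"
  using assms
proof (induction R arbitrary: P i rule: finite_induct)
  case (insert r R)
  let ?c = "\<tau> r" and ?S = "synthetic_div P (\<tau> r)"
  show ?case
  proof (cases "degree P = 0")
    case True
    then obtain a where "P = [:a:]" using degree_eq_zeroE by blast
    then show ?thesis using insert.prems(3)[of r] by (cases i) auto
  next
    case False
    have eq: "P + smult ?c ?S = pCons (poly P ?c) ?S" by (rule synthetic_div_correct)
    have S: "[:0,1:] ^ m dvd coeff ?S j" for j
    proof (rule insert.IH)
      show "degree ?S < card R" using insert.prems(1) insert.hyps False by (simp add: degree_synthetic_div)
      show "coeff (\<tau> r') 0 = r'" if "r' \<in> R" for r' using insert.prems(2) that by auto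
      fix r' assume r': "r' \<in> R"
      have "poly P (\<tau> r') + ?c * poly ?S (\<tau> r') = poly P ?c + \<tau> r' * poly ?S (\<tau> r')"
        using arg_cong[OF eq, of "\<lambda>p. poly p (\<tau> r')"] by simp
      then have "(\<tau> r' - ?c) * poly ?S (\<tau> r') = poly P (\<tau> r') - poly P ?c" by (simp add: algebra_simps)
      then have "[:0,1:] ^ m dvd (\<tau> r' - ?c) * poly ?S (\<tau> r')"
        using insert.prems(3) r' by (metis dvd_diff insertCI)
      moreover have "coeff (\<tau> r' - ?c) 0 \<noteq> 0" using insert.prems(2) insert.hyps r' by auto
      ultimately show "[:0,1:] ^ m dvd poly ?S (\<tau> r')" by (rule Y_power_dvd_cancel)
    qed
    have "coeff P i = coeff (pCons (poly P ?c) ?S) i - ?c * coeff ?S i"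
      using arg_cong[OF eq, of "\<lambda>p. coeff p i"] by (simp add: algebra_simps)
    moreover have "[:0,1:] ^ m dvd coeff (pCons (poly P ?c) ?S) i"
      using S insert.prems(3)[of r] by (cases i) auto
    ultimately show ?thesis using S by (auto intro: dvd_diff dvd_mult)
  qed
qed simp

lemma prod_linear_power_dvd:
  fixes p :: "'k::field poly"
  assumes "finite S" "\<And>x. x \<in> S \<Longrightarrow> [:-x,1:] ^ m dvd p"
  shows "(\<Prod>x\<in>S. [:-x,1:] ^ m) dvd p"
  using assms
proof (induction S arbitrary: p rule: finite_induct)
  case (insert x S)
  show ?case
  proof (cases "p = 0")
    case False
    obtain h where h: "p = [:-x,1:] ^ m * h" using insert.prems[of x] by (auto elim: dvdE)
    have "[:-y,1:] ^ m dvd h" if "y \<in> S" for y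
    proof -
      have "x \<noteq> y" using that insert.hyps by auto
      have "h \<noteq> 0" "[:-x,1:] ^ m \<noteq> 0" using h False by auto
      have "order y ([:-x,1:] ^ m) = 0" using \<open>x \<noteq> y\<close> by (intro order_0I) (simp add: poly_power)
      then have "order y p = order y h" unfolding h using order_mult[of "[:-x,1:] ^ m" h y] \<open>h \<noteq> 0\<close> by (simp del: mult_eq_0_iff add: no_zero_divisors)
      then show ?thesis using insert.prems[of y] that False \<open>h \<noteq> 0\<close> by (simp add: order_divides)
    qed
    then have "(\<Prod>x\<in>S. [:-x,1:] ^ m) dvd h" by (rule insert.IH)
    then show ?thesis using insert.hyps unfolding h by (simp del: mult_pCons_left mult_pCons_right)
  qed simp
qed simp

lemma many_roots_zero:
  fixes p :: "'k::field poly"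
  assumes "finite S" "\<And>x. x \<in> S \<Longrightarrow> [:-x,1:] ^ m dvd p" "degree p < m * card S"
  shows "p = 0"
proof (rule ccontr)
  assume "p \<noteq> 0"
  have "degree (\<Prod>x\<in>S. [:-x,1:] ^ m) \<le> degree p"
    using prod_linear_power_dvd[OF assms(1,2)] \<open>p \<noteq> 0\<close> by (rule dvd_imp_degree_le)
  moreover have "degree (\<Prod>x\<in>S. [:-x,1:] ^ m) = (\<Sum>x\<in>S. m)"
    by (subst degree_prod_eq_sum_degree) (auto simp: degree_power_eq)
  ultimately show False using assms(3) by (simp add: mult.commute)
qed

section \<open>Bivariate polynomials restricted to lines\<close>

definition P2 :: "(nat \<times> nat \<Rightarrow> 'k::field) \<Rightarrow> nat \<Rightarrow> 'k poly \<Rightarrow> 'k poly \<Rightarrow> 'k poly" where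
  "P2 c w u v = (\<Sum>(k,k')\<in>tri w. [:c (k,k'):] * (u ^ k * v ^ k'))"

lemma degree_P2: "degree u \<le> 1 \<Longrightarrow> degree v \<le> 1 \<Longrightarrow> degree (P2 c w u v) \<le> w"
  unfolding P2_def
proof (rule degree_sum_le[OF finite_tri], clarify)
  fix k k' assume uv: "degree u \<le> 1" "degree v \<le> 1" and kk: "(k,k') \<in> tri w"
  have "degree ([:c (k,k'):] * (u ^ k * v ^ k')) \<le> degree (u ^ k * v ^ k')"
    using degree_mult_le[of "[:c (k,k'):]"] by simp
  also have "\<dots> \<le> degree (u ^ k) + degree (v ^ k')" by (rule degree_mult_le)
  also have "\<dots> \<le> degree u * k + degree v * k'" by (intro add_mono degree_power_le)
  also have "\<dots> \<le> 1 * k + 1 * k'" using uv by (intro add_mono mult_right_mono) auto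
  also have "\<dots> \<le> w" using kk by (simp add: tri_def)
  finally show "degree ([:c (k, k'):] * (u ^ k * v ^ k')) \<le> w" .
qed

lemma pcompose_pow: "pcompose (p ^ k) r = pcompose p r ^ k" for p :: "'k::field poly"
  by (induction k) (auto simp: pcompose_mult pcompose_1)

lemma P2_pcompose: "pcompose (P2 c w u v) r = P2 c w (pcompose u r) (pcompose v r)"
  unfolding P2_def by (simp add: split_def pcompose_sum pcompose_mult pcompose_pow pcompose_smult)

lemma P2_const: "P2 c w [:x:] [:s:] = [:\<Sum>(k,k')\<in>tri w. c (k,k') * (x ^ k * s ^ k'):]"
proof -
  have "(\<Sum>p\<in>A. [:f p:]) = [:\<Sum>p\<in>A. f p:]" for A and f :: "nat \<times> nat \<Rightarrow> 'a"
    by (induction A rule: infinite_finite_induct) auto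
  then show ?thesis unfolding P2_def by (simp add: split_def poly_const_pow mult_ac)
qed

lemma poly_P2: "poly (P2 c w u v) y = (\<Sum>(k,k')\<in>tri w. c (k,k') * (poly u y ^ k * poly v y ^ k'))"
  unfolding P2_def by (simp add: split_def poly_sum poly_power)

text \<open>The lines s = s0 + \<mu> x with parameters in K meet the vertical line x = u, for u
  outside K, in pairwise distinct points. If the polynomial does not vanish identically on x = u,
  each line in its zero set yields a root of its own of a polynomial of degree at most
  \<open>w\<close>.\<close>

lemma card_lines_in_zero_set:
  fixes c :: "nat \<times> nat \<Rightarrow> 'k::field"
  assumes nz: "\<exists>p\<in>tri w. c p \<noteq> 0" and inf: "infinite (UNIV :: 'k set)" and "finite K"
    and sub: "\<And>x y. x \<in> K \<Longrightarrow> y \<in> K \<Longrightarrow> x - y \<in> K" "\<And>x y. x \<in> K \<Longrightarrow> y \<in> K \<Longrightarrow> x / y \<in> K"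
  shows "card {l \<in> K \<times> K. P2 c w [:0,1:] [:snd l, fst l:] = 0} \<le> w"
proof -
  obtain k0 k0' where k0: "(k0,k0') \<in> tri w" "c (k0,k0') \<noteq> 0" using nz by auto
  \<comment> \<open>\<open>r\<close> is the coefficient of the power of s with exponent
    \<open>k0'\<close>, as a polynomial in x; any u that is not a root of it keeps the polynomial
    nonzero on x = u.\<close>
  define r where "r = (\<Sum>k\<le>w. monom (if (k,k0') \<in> tri w then c (k,k0') else 0) k)"
  have "coeff r k0 = c (k0,k0')" using k0 by (simp add: r_def coeff_sum tri_def)
  then have "r \<noteq> 0" using k0 by auto
  then have "finite {u. poly r u = 0}" by (rule poly_roots_finite)
  then have "finite (K \<union> {u. poly r u = 0})" using assms(3) by simp
  then obtain u where u: "u \<notin> K" "poly r u \<noteq> 0" using inf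
    by (metis (mono_tags, lifting) UnI1 UnI2 UNIV_eq_I mem_Collect_eq)
  define B where "B = (\<Sum>(k,k')\<in>tri w. monom (c (k,k') * u ^ k) k')"
  have cB: "coeff B k0' = poly r u"
  proof -
    have "coeff B k0' = (\<Sum>(k,k')\<in>tri w. if k' = k0' then c (k,k0') * u ^ k else 0)"
      unfolding B_def coeff_sum by (intro sum.cong) auto
    also have "\<dots> = (\<Sum>p\<in>{p\<in>tri w. snd p = k0'}. c p * u ^ fst p)"
      by (subst sum.inter_filter) (auto intro!: sum.cong simp: split_def)
    also have "\<dots> = (\<Sum>k\<in>{k. (k,k0') \<in> tri w}. c (k,k0') * u ^ k)"
      by (rule sum.reindex_bij_witness[of _ "\<lambda>k. (k,k0')" fst]) auto
    also have "\<dots> = (\<Sum>k\<le>w. (if (k,k0') \<in> tri w then c (k,k0') else 0) * u ^ k)"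
      by (rule sum.mono_neutral_cong_left) (auto simp: tri_def)
    also have "\<dots> = poly r u" unfolding r_def by (simp add: poly_sum poly_monom)
    finally show ?thesis .
  qed
  then have "B \<noteq> 0" using u by auto
  have dB: "degree B \<le> w" unfolding B_def
    by (rule degree_sum_le[OF finite_tri]) (auto intro: order.trans[OF degree_monom_le] simp: tri_def)
  define L where "L = {l \<in> K \<times> K. P2 c w [:0,1:] [:snd l, fst l:] = 0}"
  have "inj_on (\<lambda>l. snd l + u * fst l) L"
  proof (rule inj_onI)
    fix l l' assume l: "l \<in> L" "l' \<in> L" and e: "snd l + u * fst l = snd l' + u * fst l'"
    have "fst l = fst l'"
    proof (rule ccontr)
      assume "fst l \<noteq> fst l'"
      then have "u = (snd l' - snd l) / (fst l - fst l')" using e by (simp add: field_simps)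
      moreover have "\<dots> \<in> K" using l by (intro sub) (auto simp: L_def)
      ultimately show False using u by simp
    qed
    then show "l = l'" using e by (simp add: prod_eq_iff)
  qed
  moreover have "(\<lambda>l. snd l + u * fst l) ` L \<subseteq> {s. poly B s = 0}"
  proof clarify
    fix \<mu> s0 assume "(\<mu>,s0) \<in> L"
    then have "poly (P2 c w [:0,1:] [:s0, \<mu>:]) u = 0" by (simp add: L_def)
    then show "poly B (snd (\<mu>, s0) + u * fst (\<mu>, s0)) = 0"
      unfolding poly_P2 B_def by (simp add: poly_sum split_def poly_monom mult.assoc)
  qed
  ultimately have "card L \<le> card {s. poly B s = 0}"
    by (rule card_inj_on_le) (rule poly_roots_finite[OF \<open>B \<noteq> 0\<close>])
  also have "\<dots> \<le> degree B" by (rule card_poly_roots_bound[OF \<open>B \<noteq> 0\<close>])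
  finally show ?thesis using dB unfolding L_def by simp
qed

lemma pw_pcompose:
  assumes "pw wt mt (range (\<lambda>c. [:c:])) N w r f"
  shows "f (\<lambda>i. pcompose (v i) p) = pcompose (f v) p"
  using assms by (induction rule: pw.induct) (auto simp: pcompose_add pcompose_mult)

lemma poly_pcompose_const_arg: "pcompose p [:t:] = [:poly p t:]" for p :: "'k::field poly"
proof (induction p)
  case (pCons a p)
  then show ?case by (simp add: pcompose_pCons mult.commute)
qed simp

context lead_curve begin

lemma pwR_red:
  assumes f: "pwR n 3 (int w) f"
  shows "red w f"
proof -
  have m: "a * b \<in> range (\<lambda>c::'a. [:c:])" if ab: "a \<in> range (\<lambda>c::'a. [:c:])" "b \<in> range (\<lambda>c::'a. [:c:])" for a b
  proof -
    obtain a' b' where "a = [:a':]" "b = [:b':]" using ab by auto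
    then have "a * b = [:a' * b':]" by simp
    then show ?thesis by blast
  qed
  obtain L where L: "\<forall>(c,ex)\<in>set L. c \<in> range (\<lambda>c. [:c:]) \<and> (\<Sum>i<3. wtR n i * int (ex i)) \<le> int w \<and> (\<Sum>i<3. (0::int) * int (ex i)) \<le> 0"
    "\<forall>v. f v = (\<Sum>(c,ex)\<leftarrow>L. c * (\<Prod>i<3. v i ^ ex i))" using pw_monomials[OF f const_polys(3) m] by fast
  have p3: "(\<Prod>i<3. h i) = h 0 * h 1 * h (2::nat)" for h :: "nat \<Rightarrow> 'a poly"
    by (simp add: eval_nat_numeral)
  have s3: "(\<Sum>i<3. h i) = h 0 + h 1 + h (2::nat)" for h :: "nat \<Rightarrow> int"
    by (simp add: eval_nat_numeral)
  have "red w (\<lambda>v. \<Sum>x\<leftarrow>L. (case x of (c,ex) \<Rightarrow> c * m3 (ex 0, ex 1, ex 2) v))"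
  proof (rule red_sum_list)
    fix x assume x: "x \<in> set L"
    obtain c ex where xx: "x = (c,ex)" by force
    then obtain d where d: "c = [:d:]" using L(1) x by auto
    have "int (ex 0) + int (ex 1) + int n * int (ex 2) \<le> int w"
      using L(1) x xx by (auto simp: s3 wtR_def algebra_simps)
    then have "ex 0 + ex 1 + n * ex 2 \<le> w" by (metis of_nat_add of_nat_le_iff of_nat_mult)
    from red_scale[OF red_monomial[OF this], of d] show "red w (\<lambda>v. (case x of (c,ex) \<Rightarrow> c * m3 (ex 0, ex 1, ex 2) v))"
      unfolding xx d prod.case .
  qed
  moreover have "f = (\<lambda>v. \<Sum>x\<leftarrow>L. (case x of (c,ex) \<Rightarrow> c * m3 (ex 0, ex 1, ex 2) v))"
    using L(2) by (auto simp: p3 m3_def)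
  ultimately show ?thesis by simp
qed

section \<open>The fibre polynomial in t over a point (x, s)\<close>

definition Pt :: "'a \<Rightarrow> 'a \<Rightarrow> 'a poly" where
  "Pt x s = G (vec3 [:x:] [:s:] [:0,1:])"

lemma Pt_pcompose: "pcompose (Pt x s) p = G (vec3 [:x:] [:s:] p)"
proof -
  have "pcompose (Pt x s) p = G (\<lambda>i. pcompose (vec3 [:x:] [:s:] [:0,1:] i) p)"
    unfolding Pt_def by (rule pw_pcompose[OF G, symmetric])
  also have "(\<lambda>i. pcompose (vec3 [:x:] [:s:] [:0,1:] i) p) = vec3 [:x:] [:s:] p"
    by (auto simp: vec3_def pcompose_pCons)
  finally show ?thesis .
qed

lemma poly_Pt: "poly (Pt x s) t = Gc (vec3 x s t)"
proof -
  have "[:poly (Pt x s) t:] = pcompose (Pt x s) [:t:]" using poly_pcompose_const_arg by metis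
  also have "\<dots> = G (vec3 [:x:] [:s:] [:t:])" by (rule Pt_pcompose)
  also have "vec3 [:x:] [:s:] [:t:] = (\<lambda>i. [:vec3 x s t i:])" by (auto simp: vec3_def)
  finally show ?thesis by (simp add: G_const)
qed

lemma Pt_degree: "degree (Pt x s) = n"
proof -
  have e: "Pt x s = monom \<gamma> n + (\<Sum>(c,p)\<leftarrow>LG. [:c:] * m3 p (vec3 [:x:] [:s:] [:0,1:]))"
  proof -
    have "vec3 [:x:] [:s:] [:0,1:] 2 = [:0,1:]" by (simp add: vec3_def)
    moreover have "monom \<gamma> n = [:\<gamma>:] * [:0,1:] ^ n" by (simp add: monom_altdef)
    ultimately show ?thesis unfolding Pt_def by (simp only: G_eq)
  qed
  have "degree (\<Sum>(c,p)\<leftarrow>L. [:c:] * m3 p (vec3 [:x:] [:s:] [:0,1:])) < n" if "set L \<subseteq> set LG" for L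
    using that
  proof (induction L)
    case Nil
    then show ?case using n2 by simp
  next
    case (Cons x' L)
    obtain c k k' i where xx: "x' = (c,k,k',i)" by (metis prod.exhaust)
    then have "i < n" using LG Cons.prems by auto
    have "[:c:] * m3 (k,k',i) (vec3 [:x:] [:s:] [:0,1:]) = monom (c * x ^ k * s ^ k') i"
    proof -
      have "m3 (k,k',i) (vec3 [:x:] [:s:] [:0,1:]) = [:x:] ^ k * [:s:] ^ k' * [:0,1:] ^ i"
        unfolding m3_def prod.case by (simp only: vec3_def) simp
      also have "\<dots> = smult (x ^ k * s ^ k') ([:0,1:] ^ i)" by (simp add: poly_const_pow mult.commute)
      finally show ?thesis unfolding monom_altdef by (simp add: mult_ac)
    qed
    then have "degree ([:c:] * m3 (k,k',i) (vec3 [:x:] [:s:] [:0,1:])) < n"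
      using degree_monom_le[of "c * x ^ k * s ^ k'" i] \<open>i < n\<close> by simp
    then show ?case using Cons unfolding xx by (auto intro!: degree_add_less)
  qed
  from this[of LG] have "degree (\<Sum>(c,p)\<leftarrow>LG. [:c:] * m3 p (vec3 [:x:] [:s:] [:0,1:])) < n" by simp
  then show ?thesis unfolding e using \<gamma>_nz by (subst degree_add_eq_left) (auto simp: degree_monom_eq)
qed

text \<open>\<open>g\<close> is known only through the Taylor identity. Comparing coefficients of Y
  in the expansion at t identifies it with the derivative of \<open>Pt\<close>, which a double root
  would annihilate.\<close>

lemma Pt_simple_root:
  assumes "poly (Pt x s) t = 0" "g (vec3 x s t) \<noteq> 0"
  shows "\<not> [:-t,1:]\<^sup>2 dvd Pt x s"
proof
  assume "[:-t,1:]\<^sup>2 dvd Pt x s"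
  then obtain h where "Pt x s = [:-t,1:]\<^sup>2 * h" by (auto elim: dvdE)
  then have "pcompose (Pt x s) [:t,1:] = [:0,1:]\<^sup>2 * pcompose h [:t,1:]"
    by (simp add: pcompose_mult pcompose_pow pcompose_pCons)
  then have c1: "coeff (pcompose (Pt x s) [:t,1:]) 1 = 0" by (simp add: Y_power_mult_coeff del: mult_pCons_left)
  define u where "u = (\<lambda>i::nat. if i = 0 then [:x:] else if i = 1 then [:s:] else if i = 2 then [:t:] else if i = 5 then [:0,1:] else 0)"
  have "pcompose (Pt x s) [:t,1:] = G (shift6 u)" unfolding Pt_pcompose
    by (rule pw_cong[OF G]) (auto simp: shift6_def u_def vec3_def)
  also have "\<dots> = G u + u 5 * D u + u 3 * A u + u 4 * B u + (u 5)\<^sup>2 * C u" by (rule taylor)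
  also have "G u = [:Gc (vec3 x s t):]" unfolding G_const[symmetric]
    by (rule pw_cong[OF G]) (auto simp: u_def vec3_def)
  also have "D u = [:g (vec3 x s t):]" unfolding D_const[symmetric]
    by (rule pw_cong[OF D]) (auto simp: u_def vec3_def)
  also have "[:Gc (vec3 x s t):] = 0" using assms(1) by (simp add: poly_Pt)
  finally have "pcompose (Pt x s) [:t,1:] = [:0,1:] * [:g (vec3 x s t):] + [:0,1:]\<^sup>2 * C u" by (simp add: u_def)
  then have "coeff (pcompose (Pt x s) [:t,1:]) 1 = g (vec3 x s t)" by (simp add: Y_power_mult_coeff del: mult_pCons_left)
  then show False using c1 assms(2) by simp
qed

end

locale acf_curve = lead_curve n G D A B C for n and G D A B C :: "(nat \<Rightarrow> 'k::alg_closed_field poly) \<Rightarrow> 'k poly"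
begin

lemma Pt_roots:
  assumes "\<And>t. Gc (vec3 x s t) = 0 \<Longrightarrow> g (vec3 x s t) \<noteq> 0"
  shows "card {t. Gc (vec3 x s t) = 0} = n" "finite {t. Gc (vec3 x s t) = 0}"
proof -
  have nz: "Pt x s \<noteq> 0" using Pt_degree[of x s] n2 by auto
  obtain M where M: "size M = n" "Pt x s = smult (lead_coeff (Pt x s)) (\<Prod>a\<in>#M. [:-a,1:])"
    using alg_closed_imp_factorization[OF nz] Pt_degree by metis
  define l where "l = lead_coeff (Pt x s)"
  have l: "l \<noteq> 0" using nz by (simp add: l_def)
  have set: "{t. Gc (vec3 x s t) = 0} = set_mset M"
  proof -
    have "poly (Pt x s) t = l * (\<Prod>a\<in>#M. t - a)" for t
      by (subst M(2)) (simp add: l_def poly_prod_mset image_mset.compositionality o_def)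
    then have "poly (Pt x s) t = 0 \<longleftrightarrow> t \<in># M" for t using l by auto
    then show ?thesis by (auto simp: poly_Pt)
  qed
  have "count M t \<le> 1" for t
  proof (rule ccontr)
    assume "\<not> count M t \<le> 1"
    then have "t \<in># M" "t \<in># M - {#t#}" by (auto simp: not_le simp flip: count_greater_zero_iff)
    then obtain M' where "M = add_mset t (add_mset t M')" by (metis insert_DiffM)
    then have "[:-t,1:]\<^sup>2 dvd Pt x s" by (subst M(2)) (auto intro!: dvd_smult simp: power2_eq_square simp flip: mult.assoc simp del: mult_pCons_left mult_pCons_right)
    moreover have "Gc (vec3 x s t) = 0" using set \<open>t \<in># M\<close> by auto
    ultimately show False using Pt_simple_root[of x s t] assms[of t] by (simp add: poly_Pt)
  qed
  then have "M = mset_set (set_mset M)"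
    by (intro multiset_eqI) (metis One_nat_def count_eq_zero_iff count_mset_set(1) count_mset_set(3) finite_set_mset le_Suc_eq le_zero_eq)
  then have "n = card (set_mset M)" using M(1) by (metis size_mset_set)
  then show "card {t. Gc (vec3 x s t) = 0} = n" "finite {t. Gc (vec3 x s t) = 0}" unfolding set by auto
qed

end

lemma Y_dvd_pcompose: "[:0,1:] ^ m dvd p \<Longrightarrow> [:0,1:] ^ m dvd pcompose p [:0,a:]" for p :: "'k::field poly"
proof -
  assume "[:0,1:] ^ m dvd p"
  then obtain h where "p = [:0,1:] ^ m * h" by (auto elim: dvdE)
  then have "pcompose p [:0,a:] = [:0,a:] ^ m * pcompose h [:0,a:]"
    by (simp add: pcompose_mult pcompose_pow pcompose_pCons)
  moreover have "[:0,a:] ^ m = [:0,1:] ^ m * [:a:] ^ m" by (simp flip: power_mult_distrib)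
  ultimately have "pcompose p [:0,a:] = [:0,1:] ^ m * ([:a:] ^ m * pcompose h [:0,a:])" by (simp only: mult.assoc)
  then show ?thesis by (metis dvd_triv_left)
qed

text \<open>\<open>Gfrob\<close> expresses that the coefficients of the surface are fixed by
  Frobenius, so that t^q is again a root over a K-rational base point. \<open>Bad\<close> is meant
  for the values of x over which the family might produce only elements of K.\<close>

locale frob_curve = acf_curve n G D A B C for n and G D A B C :: "(nat \<Rightarrow> 'k::alg_closed_field poly) \<Rightarrow> 'k poly" +
  fixes q :: nat and K Bad :: "'k set" and x0 :: 'k
  assumes frob: "\<And>x y :: 'k poly. (x + y) ^ q = x ^ q + y ^ q"
    and q2: "q \<ge> 2"
    and K: "K = {x. x ^ q = x}" and cardK: "card K = q"
    and Gfrob: "\<And>env. Gc (\<lambda>i. env i ^ q) = Gc env ^ q"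
    and Bad: "finite Bad"
    and empt: "\<And>x s t. x \<in> K \<Longrightarrow> x \<notin> Bad \<Longrightarrow> s \<in> K \<Longrightarrow> t \<in> K \<Longrightarrow> Gc (vec3 x s t) \<noteq> 0"
begin

lemma frob_k: "(x + y) ^ q = x ^ q + y ^ q" for x y :: 'k
proof -
  have "[:(x + y) ^ q:] = [:x ^ q + y ^ q:]" using frob[of "[:x:]" "[:y:]"] by (simp add: poly_const_pow)
  then show ?thesis by simp
qed

lemma frob_minus: "(- x) ^ q = - (x ^ q)" for x :: 'k
  using frob_k[of x "-x"] q2 by (simp add: eq_neg_iff_add_eq_0 add.commute power_0_left)

lemma K_finite: "finite K" using cardK q2 by (metis card.infinite not_numeral_le_zero)

lemma K_diff: "x \<in> K \<Longrightarrow> y \<in> K \<Longrightarrow> x - y \<in> K"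
  using frob_k[of x "-y"] frob_minus[of y] by (simp add: K)

lemma K_add: "x \<in> K \<Longrightarrow> y \<in> K \<Longrightarrow> x + y \<in> K"
  using frob_k[of x y] by (simp add: K)

lemma K_div: "x \<in> K \<Longrightarrow> y \<in> K \<Longrightarrow> x / y \<in> K" by (simp add: K power_divide)

lemma K_mult: "x \<in> K \<Longrightarrow> y \<in> K \<Longrightarrow> x * y \<in> K" by (simp add: K power_mult_distrib)

definition \<Psi> :: "((nat \<times> nat \<times> nat) \<times> (nat \<times> nat \<times> nat) \<Rightarrow> 'k) \<Rightarrow> nat \<Rightarrow> nat \<Rightarrow> (nat \<Rightarrow> 'k poly) \<Rightarrow> 'k poly" where
  "\<Psi> c a b v = (\<Sum>(\<alpha>,\<beta>)\<in>Al a \<times> Al b. [:c (\<alpha>,\<beta>):] * (mon x0 \<alpha> v * mon (x0 ^ q) \<beta> (\<lambda>i. v i ^ q)))"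

lemma \<Psi>_pw: "pwR n 3 (int (a + n * n + q * (b + n * n))) (\<Psi> c a b)"
proof -
  have "pwR n 3 (int (a + n * n + q * (b + n * n))) (\<lambda>v. [:c (\<alpha>,\<beta>):] * (mon x0 \<alpha> v * mon (x0 ^ q) \<beta> (\<lambda>i. v i ^ q)))"
    if "\<alpha> \<in> Al a" "\<beta> \<in> Al b" for \<alpha> \<beta>
  proof -
    obtain k k' i where al: "\<alpha> = (k,k',i)" by (metis prod.exhaust)
    obtain l l' j where be: "\<beta> = (l,l',j)" by (metis prod.exhaust)
    have w: "k + k' \<le> a" "i < n" "l + l' \<le> b" "j < n" using that by (auto simp: al be mem_Al)
    have 1: "pwR n 3 (int (k + k' + n * i)) (mon x0 \<alpha>)" unfolding al by (rule mon_pw)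
    have v: "pwR n 3 (int q * wtR n i) (\<lambda>v. v i ^ q)" if "i < 3" for i
    proof -
      have "pwR n 3 (wtR n i) (\<lambda>v. v i)" using that by (intro pw.var) auto
      from pw_power[OF this, of q] show ?thesis by simp
    qed
    have 2: "pwR n 3 (int q * int (l + l' + n * j)) (\<lambda>v. mon (x0 ^ q) \<beta> (\<lambda>i. v i ^ q))"
    proof -
      have 0: "pwR n 3 (int q) (\<lambda>v. v 0 ^ q - [:x0 ^ q:])"
        using v[of 0] by (intro pw_diff pw.const) (auto simp: wtR_def)
      have 1: "pwR n 3 (int q) (\<lambda>v. v 1 ^ q)" and 2: "pwR n 3 (int q * int n) (\<lambda>v. v 2 ^ q)" 
        using v[of 1] v[of 2] by (auto simp: wtR_def)
      have "pwR n 3 (int q * int l + int q * int l') (\<lambda>v. (v 0 ^ q - [:x0 ^ q:]) ^ l * (v 1 ^ q) ^ l')"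
        using pw_mult'[OF pw_power[OF 0, of l] pw_power[OF 1, of l']] by (simp add: mult.commute)
      from pw_mult'[OF this pw_power[OF 2, of j]] show ?thesis
        unfolding mon_def be prod.case by (simp add: algebra_simps)
    qed
    have 3: "pwR n 3 0 (\<lambda>_. [:c (\<alpha>,\<beta>):])" by (rule pw.const) auto
    have ni: "n * i \<le> n * n" "n * j \<le> n * n" using w by auto
    then have "l + l' + n * j \<le> b + n * n" "k + k' + n * i \<le> a + n * n" using w by linarith+
    then have "k + k' + n * i + q * (l + l' + n * j) \<le> a + n * n + q * (b + n * n)"
      by (meson add_mono mult_le_mono2)
    then have le: "0 + (int (k + k' + n * i) + int q * int (l + l' + n * j)) \<le> int (a + n * n + q * (b + n * n))"
      by (metis add_0 of_nat_add of_nat_le_iff of_nat_mult)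
    show ?thesis by (rule pw_mult'[OF 3 pw.mult[OF 1 2] le]) simp
  qed
  then show ?thesis unfolding \<Psi>_def[abs_def] split_def by (intro pw_sum) (auto simp: split_def)
qed

text \<open>Along the Newton arc q-th powers are constant modulo Y^q: those of x and s reduce to the
  base point, that of t to the conjugate root. As m \<le> q, \<open>\<Psi>\<close> agrees modulo Y^m
  with the linear form whose first m coefficients \<open>c\<close> was chosen to kill.\<close>

lemma local_vanishing:
  assumes c: "\<forall>env\<in>Yset. \<forall>r<m. (\<Sum>(\<alpha>,\<beta>)\<in>Al a \<times> Al b. c (\<alpha>,\<beta>) * (coeff (mon x0 \<alpha> (sh m env)) r * monE (x0 ^ q) \<beta> env)) = 0"
    and m: "m \<le> q" and x1: "x1 \<in> K" "x1 \<notin> Bad" and s1: "s1 \<in> K"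
    and t1: "Gc (vec3 x1 s1 t1) = 0" "g (vec3 x1 s1 t1) \<noteq> 0"
  shows "\<exists>\<tau>. coeff \<tau> 0 = t1 \<and> [:0,1:] ^ m dvd G (vec3 [:x1,1:] [:s1,\<mu>:] \<tau>)
     \<and> [:0,1:] ^ m dvd \<Psi> c a b (vec3 [:x1,1:] [:s1,\<mu>:] \<tau>)"
proof -
  define env where "env = (\<lambda>i::nat. if i < 3 then vec3 x1 s1 t1 i else if i = 3 then t1 ^ q else \<mu>)"
  have Gcc: "Gc e = Gc e'" if "\<And>i. i < 3 \<Longrightarrow> e i = e' i" for e e'
    unfolding Gc_def using pw_cong[OF G, of "\<lambda>i. [:e i:]" "\<lambda>i. [:e' i:]"] that by simp
  have gcc: "g e = g e'" if "\<And>i. i < 3 \<Longrightarrow> e i = e' i" for e e'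
    unfolding g_def using pw_cong[OF D, of "\<lambda>i. [:e i:]" "\<lambda>i. [:e' i:]"] that by simp
  have e0: "Gc env = 0" "g env = g (vec3 x1 s1 t1)" using t1 Gcc[of env "vec3 x1 s1 t1"] gcc[of env "vec3 x1 s1 t1"] by (auto simp: env_def)
  have "Gc (env(2 := t1 ^ q)) = Gc (\<lambda>i. vec3 x1 s1 t1 i ^ q)"
    using x1 s1 by (intro Gcc) (auto simp: env_def vec3_def K)
  then have e1: "Gc (env(2 := env 3)) = 0" using Gfrob[of "vec3 x1 s1 t1"] t1 q2 by (simp add: env_def)
  \<comment> \<open>Here the absence of K-points enters: t1^q is a root different from t1, so the
    pair lies in \<open>Yset\<close>.\<close>
  have "t1 \<notin> K" using empt[OF x1 s1] t1 by auto
  then have "t1 \<noteq> t1 ^ q" by (auto simp: K)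
  then have Y: "env \<in> Yset" using e0 e1 by (auto simp: Yset_def env_def vec3_def)
  define h where "h = g env"
  have h: "h \<noteq> 0" using e0 t1 by (simp add: h_def)
  define v where "v = sh m env"
  have v0: "v 0 = [:x1, h\<^sup>2:]" "v 1 = [:s1, \<mu> * h\<^sup>2:]" "v 2 = [:t1:] + [:h:] * W m env"
    using sh_simps[of m env] by (auto simp: v_def h_def env_def vec3_def)
  have vq: "[:0,1:] ^ q dvd v i ^ q - [:vec3 x1 s1 (t1 ^ q) i:]" if i3: "i < 3" for i
  proof -
    have "\<exists>u. v i = [:vec3 x1 s1 t1 i:] + [:0,1:] * u"
    proof -
      consider "i = 0" | "i = 1" | "i = 2" using i3 by linarith
      then show ?thesis
      proof cases
        case 1 then show ?thesis using v0 by (intro exI[of _ "[:h\<^sup>2:]"]) (simp add: vec3_def)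
      next
        case 2 then show ?thesis using v0 by (intro exI[of _ "[:\<mu> * h\<^sup>2:]"]) (simp add: vec3_def)
      next
        case 3
        obtain u where "W m env = [:0,1:] * u" using Y_dvd_W[of m env] unfolding dvd_def by blast
        then show ?thesis using v0 3 by (intro exI[of _ "[:h:] * u"]) (simp add: vec3_def)
      qed
    qed
    then obtain u where u: "v i = [:vec3 x1 s1 t1 i:] + [:0,1:] * u" by blast
    have "v i ^ q = [:vec3 x1 s1 t1 i ^ q:] + [:0,1:] ^ q * u ^ q"
      unfolding u frob by (simp only: poly_const_pow power_mult_distrib)
    moreover have "vec3 x1 s1 t1 i ^ q = vec3 x1 s1 (t1 ^ q) i" using x1 s1 by (auto simp: vec3_def K)
    ultimately show ?thesis by (metis add_diff_cancel_left' dvd_triv_left)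
  qed
  have mq: "[:0,1:] ^ q dvd mon (x0 ^ q) \<beta> (\<lambda>i. v i ^ q) - [:monE (x0 ^ q) \<beta> env:]" for \<beta>
  proof -
    obtain l l' j where be: "\<beta> = (l,l',j)" by (metis prod.exhaust)
    have "[:0,1:] ^ q dvd mon (x0 ^ q) \<beta> (\<lambda>i. v i ^ q) - mon (x0 ^ q) \<beta> (\<lambda>i. [:vec3 x1 s1 (t1 ^ q) i:])"
      unfolding be using vq by (intro pw_cong_dvd[OF mon_pw])
    also have "mon (x0 ^ q) \<beta> (\<lambda>i. [:vec3 x1 s1 (t1 ^ q) i:]) = [:monE (x0 ^ q) \<beta> env:]"
      by (simp add: be mon_def monE_def vec3_def env_def poly_const_pow mult_ac)
    finally show ?thesis .
  qed
  have "[:0,1:] ^ m dvd \<Psi> c a b v"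
  proof -
    define R where "R = (\<Sum>(\<alpha>,\<beta>)\<in>Al a \<times> Al b. [:c (\<alpha>,\<beta>):] * (mon x0 \<alpha> v * [:monE (x0 ^ q) \<beta> env:]))"
    have "\<Psi> c a b v - R = (\<Sum>(\<alpha>,\<beta>)\<in>Al a \<times> Al b. [:c (\<alpha>,\<beta>):] * (mon x0 \<alpha> v * (mon (x0 ^ q) \<beta> (\<lambda>i. v i ^ q) - [:monE (x0 ^ q) \<beta> env:])))"
      unfolding \<Psi>_def R_def by (simp only: split_def sum_subtractf[symmetric] right_diff_distrib)
    also have "[:0,1:] ^ q dvd \<dots>"
      by (rule dvd_sum) (auto simp del: mult_pCons_left mult_pCons_right intro!: dvd_mult mq)
    finally have 1: "[:0,1:] ^ m dvd \<Psi> c a b v - R" using m by (meson dvd_trans le_imp_power_dvd)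
    have "coeff R r = 0" if "r < m" for r
    proof -
      have "coeff R r = (\<Sum>(\<alpha>,\<beta>)\<in>Al a \<times> Al b. c (\<alpha>,\<beta>) * (coeff (mon x0 \<alpha> v) r * monE (x0 ^ q) \<beta> env))"
        unfolding R_def coeff_sum by (intro sum.cong) (auto simp: mult.commute)
      then show ?thesis using c Y that unfolding v_def by auto
    qed
    then have "[:0,1:] ^ m dvd R" unfolding Y_power_dvd_iff by blast
    from dvd_add[OF 1 this] show ?thesis by simp
  qed
  moreover have "[:0,1:] ^ m dvd G v" using G_sh_dvd[OF e0(1), of m] unfolding v_def by (rule power_le_dvd) simp
  \<comment> \<open>Undoes the denominator-free scaling: Y becomes Y / h^2, and the arc runs along
    the line with unit speed in x.\<close>
  moreover define r where "r = [:0, 1 / h\<^sup>2:]"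
  define \<tau> where "\<tau> = pcompose (v 2) r"
  have vr: "pcompose (v 0) r = [:x1,1:]" "pcompose (v 1) r = [:s1,\<mu>:]" unfolding v0 r_def using h by (auto simp: pcompose_pCons)
  have vec: "vec3 [:x1,1:] [:s1,\<mu>:] \<tau> i = pcompose (v i) r" if i3: "i < 3" for i
  proof -
    consider "i = 0" | "i = 1" | "i = 2" using i3 by linarith
    then show ?thesis by cases (use vr in \<open>auto simp: vec3_def \<tau>_def\<close>)
  qed
  have Gr: "G (vec3 [:x1,1:] [:s1,\<mu>:] \<tau>) = pcompose (G v) r"
    unfolding pw_pcompose[OF G, symmetric] using vec by (rule pw_cong[OF G])
  have Pr: "\<Psi> c a b (vec3 [:x1,1:] [:s1,\<mu>:] \<tau>) = pcompose (\<Psi> c a b v) r"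
    unfolding pw_pcompose[OF \<Psi>_pw, symmetric] using vec by (rule pw_cong[OF \<Psi>_pw])
  have "coeff \<tau> 0 = t1"
  proof -
    have "coeff (W m env) 0 = 0" using Y_dvd_W[of m env] Y_power_dvd_iff[of 1 "W m env"] by simp
    then show ?thesis unfolding \<tau>_def v0 r_def by (simp add: pcompose_add pcompose_smult coeff_pcompose_0 poly_0_coeff_0)
  qed
  ultimately show ?thesis using Gr Pr Y_dvd_pcompose unfolding r_def by metis
qed

end

lemma infinite_alg_closed: "infinite (UNIV :: 'k::alg_closed_field set)"
proof
  assume fin: "finite (UNIV :: 'k set)"
  define p :: "'k poly" where "p = (\<Prod>a\<in>UNIV. [:-a,1:]) + 1"
  have "degree (\<Prod>a\<in>(UNIV::'k set). [:-a,1:]) = card (UNIV :: 'k set)"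
    by (subst degree_prod_eq_sum_degree) auto
  moreover have "card (UNIV :: 'k set) > 0" using fin by (simp add: finite_UNIV_card_ge_0)
  ultimately have "degree p > 0" unfolding p_def by (subst degree_add_eq_left) auto
  then obtain z where "poly p z = 0" using alg_closed_imp_poly_has_root by blast
  moreover have "poly p z = 1" unfolding p_def poly_add poly_prod using fin by (subst prod_zero) auto
  ultimately show False by simp
qed

lemma pcompose_shift_dvd:
  fixes p :: "'k::field poly"
  assumes "[:0,1:] ^ m dvd pcompose p [:x,1:]"
  shows "[:-x,1:] ^ m dvd p"
proof -
  obtain h where h: "pcompose p [:x,1:] = [:0,1:] ^ m * h" using assms by (auto elim: dvdE)
  have "p = pcompose (pcompose p [:x,1:]) [:-x,1:]"
    unfolding pcompose_assoc[symmetric] by (simp add: pcompose_pCons pcompose_idR)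
  also have "\<dots> = [:-x,1:] ^ m * pcompose h [:-x,1:]" unfolding h by (simp add: pcompose_mult pcompose_pow pcompose_pCons)
  finally show ?thesis by (metis dvd_triv_left)
qed

context frob_curve begin

text \<open>On a line not contained in the discriminant, the \<open>n\<close> local roots over each of the many points give a Vandermonde system that forces the
  coefficients of the remainder of \<open>\<Psi>\<close> modulo \<open>G\<close> to vanish to order \<open>m\<close>, so they vanish on the line, and then identically.\<close>

lemma \<Psi>_multiple_of_G:
  assumes c: "\<forall>env\<in>Yset. \<forall>r<m. (\<Sum>(\<alpha>,\<beta>)\<in>Al a \<times> Al b. c (\<alpha>,\<beta>) * (coeff (mon x0 \<alpha> (sh m env)) r * monE (x0 ^ q) \<beta> env)) = 0"
    and m: "m \<le> q"
    and \<rho>: "\<exists>p\<in>tri w. \<rho> p \<noteq> 0"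
    and disc: "\<And>x s t. Gc (vec3 x s t) = 0 \<Longrightarrow> g (vec3 x s t) = 0 \<Longrightarrow> (\<Sum>(k,k')\<in>tri w. \<rho> (k,k') * (x ^ k * s ^ k')) = 0"
    and N1: "a + n * n + q * (b + n * n) < m * (q - card Bad - w)"
    and N2: "a + n * n + q * (b + n * n) + w < q * q"
  shows "\<exists>Q. \<forall>v. \<Psi> c a b v = G v * Q v"
proof -
  define Wt where "Wt = a + n * n + q * (b + n * n)"
  have "red Wt (\<Psi> c a b)" unfolding Wt_def by (rule pwR_red[OF \<Psi>_pw])
  then obtain cc Q where cc: "\<And>v. \<Psi> c a b v = (\<Sum>i<n. P2 (cc i) Wt (v 0) (v 1) * v 2 ^ i) + G v * Q v"
    unfolding red_def P2_def by blast
  have "cc i p = 0" if i: "i < n" and p: "p \<in> tri Wt" for i p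
  proof (rule ccontr)
    assume "cc i p \<noteq> 0"
    then have "\<exists>p\<in>tri Wt. cc i p \<noteq> 0" using p by blast
    from card_lines_in_zero_set[OF this infinite_alg_closed K_finite K_diff K_div]
    have f1: "card {l \<in> K \<times> K. P2 (cc i) Wt [:0,1:] [:snd l, fst l:] = 0} \<le> Wt" .
    from card_lines_in_zero_set[OF \<rho> infinite_alg_closed K_finite K_diff K_div]
    have f2: "card {l \<in> K \<times> K. P2 \<rho> w [:0,1:] [:snd l, fst l:] = 0} \<le> w" .
    have "P2 (cc i) Wt [:0,1:] [:s0, \<mu>:] = 0" if l: "\<mu> \<in> K" "s0 \<in> K" and good: "P2 \<rho> w [:0,1:] [:s0, \<mu>:] \<noteq> 0" for \<mu> s0
    proof -
      define rl where "rl = P2 \<rho> w [:0,1:] [:s0, \<mu>:]"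
      define S where "S = {x\<in>K. x \<notin> Bad \<and> poly rl x \<noteq> 0}"
      have drl: "degree rl \<le> w" unfolding rl_def by (rule degree_P2) auto
      have "card S \<ge> q - card Bad - w"
      proof -
        have "finite {x. poly rl x = 0}" "card {x. poly rl x = 0} \<le> w"
          using good drl poly_roots_finite[of rl] card_poly_roots_bound[of rl] by (auto simp: rl_def)
        moreover have "K - Bad - {x. poly rl x = 0} = S" by (auto simp: S_def)
        ultimately show ?thesis using cardK Bad K_finite
          by (metis diff_card_le_card_Diff diff_le_mono2 le_diff_conv2 order.trans diff_le_mono)
      qed
      \<comment> \<open>The degree along the line is compared with m zeros at each good point; the
        points of \<open>Bad\<close> and at most \<open>w\<close> zeros of \<rho> on the line are
        lost.\<close>
      then have "Wt < m * card S" using N1 unfolding Wt_def by (meson le_trans mult_le_mono2 not_le)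
      moreover have "finite S" using K_finite by (simp add: S_def)
      moreover have "[:-x1,1:] ^ m dvd P2 (cc i) Wt [:0,1:] [:s0, \<mu>:]" if x1: "x1 \<in> S" for x1
      proof (rule pcompose_shift_dvd)
        define s1 where "s1 = s0 + \<mu> * x1"
        have x1': "x1 \<in> K" "x1 \<notin> Bad" "poly rl x1 \<noteq> 0" using x1 by (auto simp: S_def)
        have s1: "s1 \<in> K" unfolding s1_def using l x1' by (intro K_add K_mult)
        have rho: "(\<Sum>(k,k')\<in>tri w. \<rho> (k,k') * (x1 ^ k * s1 ^ k')) \<noteq> 0"
          using x1'(3) unfolding rl_def poly_P2 by (simp add: s1_def mult.commute)
        have simple: "g (vec3 x1 s1 t) \<noteq> 0" if "Gc (vec3 x1 s1 t) = 0" for t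
          using disc[OF that] rho by blast
        define R where "R = {t. Gc (vec3 x1 s1 t) = 0}"
        have R: "card R = n" "finite R" unfolding R_def using Pt_roots[of x1 s1] simple by auto
        have "\<exists>\<tau>. coeff \<tau> 0 = t \<and> [:0,1:] ^ m dvd G (vec3 [:x1,1:] [:s1,\<mu>:] \<tau>)
           \<and> [:0,1:] ^ m dvd \<Psi> c a b (vec3 [:x1,1:] [:s1,\<mu>:] \<tau>)" if "t \<in> R" for t
          using that simple unfolding R_def by (intro local_vanishing[OF c m x1'(1,2) s1]) auto
        then obtain \<tau> where \<tau>: "\<And>t. t \<in> R \<Longrightarrow> coeff (\<tau> t) 0 = t"
          "\<And>t. t \<in> R \<Longrightarrow> [:0,1:] ^ m dvd G (vec3 [:x1,1:] [:s1,\<mu>:] (\<tau> t))"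
          "\<And>t. t \<in> R \<Longrightarrow> [:0,1:] ^ m dvd \<Psi> c a b (vec3 [:x1,1:] [:s1,\<mu>:] (\<tau> t))" by metis
        define P where "P = (\<Sum>i<n. monom (P2 (cc i) Wt [:x1,1:] [:s1,\<mu>:]) i)"
        have "degree P < card R" unfolding P_def R
          by (rule degree_sum_less) (use n2 in \<open>auto intro: le_less_trans[OF degree_monom_le]\<close>)
        moreover have "[:0,1:] ^ m dvd poly P (\<tau> t)" if t: "t \<in> R" for t
        proof -
          have "poly P (\<tau> t) = \<Psi> c a b (vec3 [:x1,1:] [:s1,\<mu>:] (\<tau> t)) - G (vec3 [:x1,1:] [:s1,\<mu>:] (\<tau> t)) * Q (vec3 [:x1,1:] [:s1,\<mu>:] (\<tau> t))"
            unfolding cc P_def by (simp add: poly_sum poly_monom vec3_def)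
          then show ?thesis using \<tau>(2,3)[OF t] by (metis dvd_diff dvd_mult2)
        qed
        ultimately have "[:0,1:] ^ m dvd coeff P i" using \<tau>(1) R(2) by (intro vandermonde_dvd)
        moreover have "coeff P i = P2 (cc i) Wt [:x1,1:] [:s1,\<mu>:]" using i by (simp add: P_def coeff_sum)
        moreover have "\<dots> = pcompose (P2 (cc i) Wt [:0,1:] [:s0, \<mu>:]) [:x1,1:]"
          unfolding P2_pcompose by (simp add: pcompose_pCons s1_def mult.commute)
        ultimately show "[:0,1:] ^ m dvd pcompose (P2 (cc i) Wt [:0,1:] [:s0, \<mu>:]) [:x1,1:]" by simp
      qed
      moreover have "degree (P2 (cc i) Wt [:0,1:] [:s0, \<mu>:]) \<le> Wt" by (rule degree_P2) auto
      ultimately show ?thesis by (intro many_roots_zero[of S m]) auto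
    qed
    \<comment> \<open>Every line over K lies in the zero set of \<open>cc i\<close> or of \<rho>,
      but these contain at most \<open>Wt\<close> and \<open>w\<close> of the q^2 lines.\<close>
    then have "K \<times> K \<subseteq> {l \<in> K \<times> K. P2 (cc i) Wt [:0,1:] [:snd l, fst l:] = 0} \<union> {l \<in> K \<times> K. P2 \<rho> w [:0,1:] [:snd l, fst l:] = 0}"
      by auto
    then have "card (K \<times> K) \<le> card ({l \<in> K \<times> K. P2 (cc i) Wt [:0,1:] [:snd l, fst l:] = 0} \<union> {l \<in> K \<times> K. P2 \<rho> w [:0,1:] [:snd l, fst l:] = 0})"
      using K_finite by (intro card_mono) auto
    also have "\<dots> \<le> Wt + w" using f1 f2 by (meson add_mono card_Un_le le_trans)
    finally show False using N2 cardK by (simp add: card_cartesian_product Wt_def)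
  qed
  then have "P2 (cc i) Wt u v = 0" if "i < n" for i u v
    unfolding P2_def using that by (intro sum.neutral) auto
  then show ?thesis using cc by (intro exI[of _ Q]) auto
qed

end

section \<open>Expansion at the ramified place\<close>

text \<open>A \<theta> of least order is used to raise the order of the others; by additivity of the
  q-th power the same elimination acts on the \<theta>^q, with coefficients c^q. The combined
  coefficient \<open>e\<close> of the chosen term is either zero, and induction drops the term, or
  has order below q. In the latter case its contribution has order below q (o' + 1), where all
  others begin.\<close>

lemma frobenius_independence:
  fixes \<theta> \<epsilon> :: "'i \<Rightarrow> 'k::field poly"
  assumes frob: "\<And>x y :: 'k poly. (x + y) ^ q = x ^ q + y ^ q" and q: "q > 0"
    and "finite B"
    and \<theta>: "\<And>d. (\<exists>\<beta>\<in>B. d \<beta> \<noteq> 0) \<Longrightarrow> \<not> [:0,1:] ^ Suc M dvd (\<Sum>\<beta>\<in>B. [:d \<beta>:] * \<theta> \<beta>)"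
    and \<epsilon>: "\<And>d. (\<Sum>\<beta>\<in>B. [:d \<beta>:] * \<epsilon> \<beta>) = 0 \<or> \<not> [:0,1:] ^ q dvd (\<Sum>\<beta>\<in>B. [:d \<beta>:] * \<epsilon> \<beta>)"
    and nz: "\<exists>\<beta>\<in>B. \<epsilon> \<beta> \<noteq> 0"
  shows "\<not> [:0,1:] ^ (q * Suc M) dvd (\<Sum>\<beta>\<in>B. \<epsilon> \<beta> * \<theta> \<beta> ^ q)"
  using assms(3-)
proof (induction "card B" arbitrary: B \<theta> rule: less_induct)
  case less
  let ?Y = "[:0,1::'k:]"
  have single: "\<not> ?Y ^ Suc M dvd \<theta> \<beta>" if "\<beta> \<in> B" for \<beta>
  proof -
    have "(\<Sum>b\<in>B. [:if b = \<beta> then 1 else 0:] * \<theta> b) = (\<Sum>b\<in>B. if b = \<beta> then \<theta> b else 0)"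
      by (rule sum.cong) auto
    then have "(\<Sum>b\<in>B. [:if b = \<beta> then 1 else 0:] * \<theta> b) = \<theta> \<beta>" using that less.prems(1) by simp
    then show ?thesis using less.prems(2)[of "\<lambda>b. if b = \<beta> then 1 else 0"] that by auto
  qed
  define Q where "Q = (\<lambda>o'. \<forall>\<beta>\<in>B. ?Y ^ o' dvd \<theta> \<beta>)"
  obtain b0 where b0: "b0 \<in> B" using less.prems(4) by auto
  have bound: "o' \<le> M" if "Q o'" for o'
  proof (rule ccontr)
    assume "\<not> o' \<le> M"
    then have "?Y ^ Suc M dvd \<theta> b0" using that b0 unfolding Q_def by (metis not_less_eq_eq power_le_dvd)
    then show False using single b0 by blast
  qed
  have "Q 0" by (simp add: Q_def)
  define o' where "o' = Greatest Q"
  have Qo: "Q o'" unfolding o'_def using \<open>Q 0\<close> bound by (intro GreatestI_nat[of Q 0 M]) auto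
  have "\<not> Q (Suc o')" using Greatest_le_nat[of Q "Suc o'" M] bound unfolding o'_def by (metis Suc_n_not_le_n)
  then obtain \<beta>0 where \<beta>0: "\<beta>0 \<in> B" "\<not> ?Y ^ Suc o' dvd \<theta> \<beta>0" by (auto simp: Q_def)
  have co: "coeff (\<theta> \<beta>) i = 0" if "\<beta> \<in> B" "i < o'" for \<beta> i using Qo that unfolding Q_def Y_power_dvd_iff by blast
  then have c0: "coeff (\<theta> \<beta>0) o' \<noteq> 0" using \<beta>0 unfolding Y_power_dvd_iff by (metis less_antisym)
  define c where "c = (\<lambda>\<gamma>. coeff (\<theta> \<gamma>) o' / coeff (\<theta> \<beta>0) o')"
  define \<theta>' where "\<theta>' = (\<lambda>\<gamma>. \<theta> \<gamma> - [:c \<gamma>:] * \<theta> \<beta>0)"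
  have \<theta>'o: "?Y ^ Suc o' dvd \<theta>' \<gamma>" if "\<gamma> \<in> B" for \<gamma>
    unfolding Y_power_dvd_iff
  proof (intro allI impI)
    fix i assume "i < Suc o'"
    then consider "i < o'" | "i = o'" by linarith
    then show "coeff (\<theta>' \<gamma>) i = 0" using co[OF that] co[OF \<beta>0(1)] c0 by cases (auto simp: \<theta>'_def c_def)
  qed
  define B' where "B' = B - {\<beta>0}"
  have B': "finite B'" "card B' < card B" using less.prems(1) card_Diff1_less[OF less.prems(1) \<beta>0(1)] unfolding B'_def by auto
  have rem: "(\<Sum>\<beta>\<in>B. f \<beta>) = f \<beta>0 + (\<Sum>\<beta>\<in>B'. f \<beta>)" for f :: "'i \<Rightarrow> 'k poly"
    unfolding B'_def using less.prems(1) \<beta>0(1) by (rule sum.remove)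
  define e where "e = \<epsilon> \<beta>0 + (\<Sum>\<gamma>\<in>B'. [:c \<gamma> ^ q:] * \<epsilon> \<gamma>)"
  have frobd: "\<theta> \<gamma> ^ q = [:c \<gamma> ^ q:] * \<theta> \<beta>0 ^ q + \<theta>' \<gamma> ^ q" for \<gamma>
  proof -
    have "\<theta> \<gamma> = [:c \<gamma>:] * \<theta> \<beta>0 + \<theta>' \<gamma>" by (simp add: \<theta>'_def)
    then have "\<theta> \<gamma> ^ q = ([:c \<gamma>:] * \<theta> \<beta>0) ^ q + \<theta>' \<gamma> ^ q" by (metis frob)
    then show ?thesis by (simp only: power_mult_distrib poly_const_pow)
  qed
  have split: "(\<Sum>\<beta>\<in>B. \<epsilon> \<beta> * \<theta> \<beta> ^ q) = e * \<theta> \<beta>0 ^ q + (\<Sum>\<gamma>\<in>B'. \<epsilon> \<gamma> * \<theta>' \<gamma> ^ q)"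
  proof -
    have "(\<Sum>\<gamma>\<in>B'. \<epsilon> \<gamma> * \<theta> \<gamma> ^ q) = (\<Sum>\<gamma>\<in>B'. [:c \<gamma> ^ q:] * \<epsilon> \<gamma>) * \<theta> \<beta>0 ^ q + (\<Sum>\<gamma>\<in>B'. \<epsilon> \<gamma> * \<theta>' \<gamma> ^ q)"
      unfolding sum_distrib_right sum.distrib[symmetric]
      by (intro sum.cong refl, subst frobd, simp only: algebra_simps)
    then show ?thesis unfolding rem e_def by (simp only: distrib_right add.assoc)
  qed
  have oM: "o' \<le> M" using bound Qo by blast
  have inner: "[:d1:] * x + [:d2:] * x = [:d1 + d2:] * x" for d1 d2 and x :: "'k poly" by (simp add: smult_add_left)
  show ?case
  proof (cases "e = 0")
    case False
    have "e = (\<Sum>\<beta>\<in>B. [:if \<beta> = \<beta>0 then 1 else c \<beta> ^ q:] * \<epsilon> \<beta>)"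
      unfolding rem e_def by (simp add: B'_def cong: sum.cong) (rule sum.cong, auto)
    then have ne: "\<not> ?Y ^ q dvd e" using less.prems(3)[of "\<lambda>\<beta>. if \<beta> = \<beta>0 then 1 else c \<beta> ^ q"] False by auto
    have "?Y ^ (q * Suc o') dvd (\<Sum>\<gamma>\<in>B'. \<epsilon> \<gamma> * \<theta>' \<gamma> ^ q)"
    proof (rule dvd_sum)
      fix \<gamma> assume "\<gamma> \<in> B'"
      then have "?Y ^ Suc o' dvd \<theta>' \<gamma>" using \<theta>'o by (auto simp: B'_def)
      then have "(?Y ^ Suc o') ^ q dvd \<theta>' \<gamma> ^ q" by (rule dvd_power_same)
      then have "?Y ^ (q * Suc o') dvd \<theta>' \<gamma> ^ q" by (simp only: power_mult[symmetric] mult.commute)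
      then show "?Y ^ (q * Suc o') dvd \<epsilon> \<gamma> * \<theta>' \<gamma> ^ q" by (rule dvd_mult)
    qed
    moreover have "\<not> ?Y ^ (q * Suc o') dvd e * \<theta> \<beta>0 ^ q"
    proof
      assume a: "?Y ^ (q * Suc o') dvd e * \<theta> \<beta>0 ^ q"
      have "?Y ^ o' dvd \<theta> \<beta>0" using Qo \<beta>0 by (simp add: Q_def)
      then obtain u where u: "\<theta> \<beta>0 = ?Y ^ o' * u" unfolding dvd_def by blast
      have u0: "coeff u 0 \<noteq> 0" using c0 unfolding u Y_power_mult_coeff by simp
      have "e * \<theta> \<beta>0 ^ q = ?Y ^ (q * o') * (u ^ q * e)" unfolding u
        by (simp only: power_mult_distrib power_mult[symmetric] mult_ac)
      moreover have "?Y ^ (q * Suc o') = ?Y ^ (q * o') * ?Y ^ q" by (simp only: power_add[symmetric] mult_Suc_right add.commute)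
      ultimately have "?Y ^ (q * o') * ?Y ^ q dvd ?Y ^ (q * o') * (u ^ q * e)" using a by metis
      then have "?Y ^ q dvd u ^ q * e" by (simp del: mult_pCons_left mult_pCons_right)
      moreover have "coeff (u ^ q) 0 \<noteq> 0" using u0 by (simp add: coeff_0_power)
      ultimately show False using ne Y_power_dvd_cancel by blast
    qed
    ultimately have "\<not> ?Y ^ (q * Suc o') dvd (\<Sum>\<beta>\<in>B. \<epsilon> \<beta> * \<theta> \<beta> ^ q)" unfolding split by (simp add: dvd_add_left_iff)
    moreover have "?Y ^ (q * Suc o') dvd ?Y ^ (q * Suc M)" using oM by (intro le_imp_power_dvd) simp
    ultimately show ?thesis by (meson dvd_trans)
  next
    case True
    have "\<not> ?Y ^ (q * Suc M) dvd (\<Sum>\<gamma>\<in>B'. \<epsilon> \<gamma> * \<theta>' \<gamma> ^ q)"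
    proof (rule less.hyps[OF B'(2) B'(1)])
      fix d :: "'i \<Rightarrow> 'k" assume d: "\<exists>\<beta>\<in>B'. d \<beta> \<noteq> 0"
      define d' where "d' = (\<lambda>\<beta>. if \<beta> = \<beta>0 then - (\<Sum>\<gamma>\<in>B'. d \<gamma> * c \<gamma>) else d \<beta>)"
      have 1: "(\<Sum>\<beta>\<in>B'. [:d' \<beta>:] * \<theta> \<beta>) = (\<Sum>\<beta>\<in>B'. [:d \<beta>:] * \<theta> \<beta>)" by (rule sum.cong) (auto simp: d'_def B'_def)
      have 2: "(\<Sum>\<gamma>\<in>A. [:d \<gamma>:] * ([:c \<gamma>:] * x)) = [:\<Sum>\<gamma>\<in>A. d \<gamma> * c \<gamma>:] * x" for A x
        by (induction A rule: infinite_finite_induct) (auto simp: smult_add_left mult.commute)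
      have "(\<Sum>\<beta>\<in>B'. [:d \<beta>:] * \<theta>' \<beta>) = (\<Sum>\<beta>\<in>B'. [:d \<beta>:] * \<theta> \<beta>) - (\<Sum>\<gamma>\<in>B'. [:d \<gamma>:] * ([:c \<gamma>:] * \<theta> \<beta>0))"
        unfolding \<theta>'_def by (simp only: right_diff_distrib sum_subtractf)
      also have "\<dots> = (\<Sum>\<beta>\<in>B. [:d' \<beta>:] * \<theta> \<beta>)" unfolding rem 1 2 by (simp add: d'_def)
      finally have 3: "(\<Sum>\<beta>\<in>B'. [:d \<beta>:] * \<theta>' \<beta>) = (\<Sum>\<beta>\<in>B. [:d' \<beta>:] * \<theta> \<beta>)" .
      obtain \<beta> where "\<beta> \<in> B'" "d \<beta> \<noteq> 0" using d by blast
      then have "\<exists>\<beta>\<in>B. d' \<beta> \<noteq> 0" by (intro bexI[of _ \<beta>]) (auto simp: d'_def B'_def)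
      from less.prems(2)[OF this] show "\<not> ?Y ^ Suc M dvd (\<Sum>\<beta>\<in>B'. [:d \<beta>:] * \<theta>' \<beta>)" unfolding 3 .
    next
      fix d :: "'i \<Rightarrow> 'k"
      have "(\<Sum>\<beta>\<in>B'. [:d \<beta>:] * \<epsilon> \<beta>) = (\<Sum>\<beta>\<in>B. [:if \<beta> = \<beta>0 then 0 else d \<beta>:] * \<epsilon> \<beta>)"
        unfolding rem by (auto simp: B'_def intro!: sum.cong)
      then show "(\<Sum>\<beta>\<in>B'. [:d \<beta>:] * \<epsilon> \<beta>) = 0 \<or> \<not> ?Y ^ q dvd (\<Sum>\<beta>\<in>B'. [:d \<beta>:] * \<epsilon> \<beta>)"
        using less.prems(3) by metis
    next
      show "\<exists>\<beta>\<in>B'. \<epsilon> \<beta> \<noteq> 0"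
      proof (rule ccontr)
        assume a: "\<not> ?thesis"
        then have "e = \<epsilon> \<beta>0" by (simp add: e_def)
        then show False using True a less.prems(4) by (auto simp: B'_def)
      qed
    qed
    then show ?thesis unfolding split using True by simp
  qed
qed

text \<open>The prefactors of successive levels differ by Y^N, so divisibility beyond level \<kappa>
  leaves the inner sum at the lowest level divisible by Y^N.\<close>

lemma leading_level:
  fixes h :: "'i \<Rightarrow> 'k::field poly"
  assumes "finite S" "\<And>x. x \<in> S \<Longrightarrow> f x < \<kappa> \<Longrightarrow> h x = 0"
    "[:0,1:] ^ (N * Suc \<kappa>) dvd (\<Sum>x\<in>S. [:0,1:] ^ (N * f x) * h x)"
  shows "[:0,1:] ^ N dvd (\<Sum>x\<in>{x\<in>S. f x = \<kappa>}. h x)"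
proof -
  let ?Y = "[:0,1::'k:]"
  have "(\<Sum>x\<in>S. ?Y ^ (N * f x) * h x) = (\<Sum>x\<in>{x\<in>S. f x = \<kappa>}. ?Y ^ (N * f x) * h x) + (\<Sum>x\<in>{x\<in>S. f x \<noteq> \<kappa>}. ?Y ^ (N * f x) * h x)"
    using assms(1) by (subst sum.union_disjoint[symmetric]) (auto intro!: sum.cong)
  moreover have "?Y ^ (N * Suc \<kappa>) dvd (\<Sum>x\<in>{x\<in>S. f x \<noteq> \<kappa>}. ?Y ^ (N * f x) * h x)"
  proof (rule dvd_sum)
    fix x assume x: "x \<in> {x\<in>S. f x \<noteq> \<kappa>}"
    show "?Y ^ (N * Suc \<kappa>) dvd ?Y ^ (N * f x) * h x"
    proof (cases "f x < \<kappa>")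
      case True
      then show ?thesis using assms(2) x by simp
    next
      case False
      then have "Suc \<kappa> \<le> f x" using x by auto
      then show ?thesis by (intro dvd_mult2 le_imp_power_dvd mult_le_mono2)
    qed
  qed
  ultimately have "?Y ^ (N * Suc \<kappa>) dvd (\<Sum>x\<in>{x\<in>S. f x = \<kappa>}. ?Y ^ (N * f x) * h x)"
    using assms(3) by (simp add: dvd_add_left_iff)
  also have "(\<Sum>x\<in>{x\<in>S. f x = \<kappa>}. ?Y ^ (N * f x) * h x) = ?Y ^ (N * \<kappa>) * (\<Sum>x\<in>{x\<in>S. f x = \<kappa>}. h x)"
    unfolding sum_distrib_left by (rule sum.cong) auto
  also have "?Y ^ (N * Suc \<kappa>) = ?Y ^ (N * \<kappa>) * ?Y ^ N" by (simp only: power_add[symmetric] mult_Suc_right add.commute)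
  finally show ?thesis by (simp del: mult_pCons_left mult_pCons_right)
qed

text \<open>\<open>irr\<close> is irreducibility of the fibre over x0 in quantitative form: a
  nonzero polynomial in s and t of degree at most d in s, reduced to degree below n in t, cannot
  vanish to high order on the branch. The branch is given only modulo Y^N, by a polynomial \<tau>
  instead of a power series.\<close>

locale place_curve = frob_curve n G D A B C q K Bad x0
  for n and G D A B C :: "(nat \<Rightarrow> 'k::alg_closed_field poly) \<Rightarrow> 'k poly" and q K Bad x0 +
  fixes s0 :: 'k
  assumes p0: "Gc (vec3 x0 s0 0) = 0" "g (vec3 x0 s0 0) \<noteq> 0"
    and irr: "\<And>d e \<tau> N. (\<exists>k\<le>d. \<exists>i<n. e k i \<noteq> 0) \<Longrightarrow> coeff \<tau> 0 = 0 \<Longrightarrow> 2 * (n + 1) * (d + 1) < N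
      \<Longrightarrow> [:0,1:] ^ N dvd G (vec3 [:x0:] [:s0,1:] \<tau>)
      \<Longrightarrow> \<not> [:0,1:] ^ Suc (2 * (n + 1) * (d + 1)) dvd (\<Sum>k\<le>d. \<Sum>i<n. [:e k i:] * ([:s0,1:] ^ k * \<tau> ^ i))"
begin

text \<open>x leaves x0 only at order N. Modulo Y^N the arc therefore lies in the special fibre, and
  every factor x - x0 becomes Y^N, which sorts the powers of x - x0 into levels.\<close>

lemma branch_at_place:
  assumes "N > 0" "N \<le> M"
  shows "\<exists>\<tau>. coeff \<tau> 0 = 0 \<and> [:0,1:] ^ M dvd G (vec3 ([:x0:] + [:0,1:] ^ N) [:s0,1:] \<tau>) \<and>
      [:0,1:] ^ N dvd G (vec3 [:x0:] [:s0,1:] \<tau>)"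
proof -
  let ?v = "vec3 ([:x0:] + [:0,1:] ^ N) [:s0,1:] 0"
  have "coeff (?v i) 0 = vec3 x0 s0 0 i" if i2: "i < 2" for i
  proof -
    consider "i = 0" | "i = 1" using i2 by linarith
    then show ?thesis by cases (use assms in \<open>auto simp: vec3_def coeff_0_power\<close>)
  qed
  from hensel_lift[OF p0, of ?v, OF this, of M] obtain \<tau> where
    t: "coeff \<tau> 0 = vec3 x0 s0 0 2" "[:0,1:] ^ M dvd G (?v(2 := \<tau>))" by blast
  have 1: "G (?v(2 := \<tau>)) = G (vec3 ([:x0:] + [:0,1:] ^ N) [:s0,1:] \<tau>)"
    by (rule pw_cong[OF G]) (auto simp: vec3_def)
  have d1: "[:0,1:] ^ N dvd G (vec3 ([:x0:] + [:0,1:] ^ N) [:s0,1:] \<tau>) - G (vec3 [:x0:] [:s0,1:] \<tau>)"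
    by (rule pw_cong_dvd[OF G]) (auto simp: vec3_def)
  have d2: "[:0,1:] ^ N dvd G (vec3 ([:x0:] + [:0,1:] ^ N) [:s0,1:] \<tau>)"
    using t(2) assms(2) unfolding 1 by (rule power_le_dvd)
  have "[:0,1:] ^ N dvd G (vec3 [:x0:] [:s0,1:] \<tau>)" using dvd_diff[OF d2 d1] by simp
  then show ?thesis using t unfolding 1 by (auto simp: vec3_def)
qed

lemma mon_place:
  "mon x0 (k,k',i) (vec3 ([:x0:] + [:0,1:] ^ N) [:s0,1:] \<tau>) = [:0,1:] ^ (N * k) * ([:s0,1:] ^ k' * \<tau> ^ i)"
  by (simp add: mon_def vec3_def power_mult mult.assoc)

lemma mon_place_frob:
  "mon (x0 ^ q) (l,l',j) (\<lambda>i. vec3 ([:x0:] + [:0,1:] ^ N) [:s0,1:] \<tau> i ^ q) = [:0,1:] ^ (N * (q * l)) * ([:s0,1:] ^ l' * \<tau> ^ j) ^ q"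
proof -
  have "([:x0:] + [:0,1:] ^ N) ^ q - [:x0 ^ q:] = ([:0,1:] ^ N) ^ q" unfolding frob by (simp add: poly_const_pow)
  then show ?thesis by (simp add: mon_def vec3_def power_mult[symmetric] power_mult_distrib mult_ac)
qed

text \<open>A substitute for the resultant, by linear algebra: \<open>F\<close> has more unknown
  coefficients than there are conditions for the remainder of D F modulo G to be free of t, ...,
  t^(n-1). What remains is \<rho>(x, s). If it were zero, D F would be a multiple of G; as D is a
  unit at the special place, \<open>F\<close> would vanish there to an order that \<open>irr\<close>
  forbids.\<close>

lemma discriminant:
  assumes num: "(n - 1) * card (tri (d + 2 * n * n)) < n * card (tri d)"
  shows "\<exists>\<rho>. (\<exists>p\<in>tri (d + 2 * n * n). \<rho> p \<noteq> 0) \<and>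
    (\<forall>x s t. Gc (vec3 x s t) = 0 \<longrightarrow> g (vec3 x s t) = 0 \<longrightarrow> (\<Sum>(k,k')\<in>tri (d + 2 * n * n). \<rho> (k,k') * (x ^ k * s ^ k')) = 0)"
proof -
  define w where "w = d + 2 * n * n"
  have "\<forall>\<alpha>\<in>Al d. \<exists>p. \<forall>v. D v * mon x0 \<alpha> v = (\<Sum>i<n. P2 (fst p i) w (v 0) (v 1) * v 2 ^ i) + G v * snd p v"
  proof
    fix \<alpha> assume al: "\<alpha> \<in> Al d"
    obtain k k' i where a: "\<alpha> = (k,k',i)" by (metis prod.exhaust)
    have kk: "k + k' \<le> d" "i < n" using al by (auto simp: a mem_Al)
    have "n * i \<le> n * n" using kk by auto
    then have "k + k' + n * i \<le> d + n * n" using kk by linarith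
    then have "int (k + k' + n * i) \<le> int d + int (n * n)" by (metis of_nat_add of_nat_le_iff)
    then have "int (n * n) - int n + int (k + k' + n * i) \<le> int w" unfolding w_def by simp
    then have "pwR n 3 (int w) (\<lambda>v. D v * mon x0 \<alpha> v)" unfolding a by (intro pw_mult'[OF D mon_pw]) auto
    from pwR_red[OF this] obtain cc Q where "\<forall>v. D v * mon x0 \<alpha> v = (\<Sum>i<n. P2 (cc i) w (v 0) (v 1) * v 2 ^ i) + G v * Q v"
      unfolding red_def P2_def by blast
    then show "\<exists>p. \<forall>v. D v * mon x0 \<alpha> v = (\<Sum>i<n. P2 (fst p i) w (v 0) (v 1) * v 2 ^ i) + G v * snd p v"
      by (intro exI[of _ "(cc,Q)"]) simp
  qed
  from bchoice[OF this] obtain f where f: "\<forall>\<alpha>\<in>Al d. \<forall>v. D v * mon x0 \<alpha> v = (\<Sum>i<n. P2 (fst (f \<alpha>) i) w (v 0) (v 1) * v 2 ^ i) + G v * snd (f \<alpha>) v"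
    by blast
  define cc Q where "cc = (\<lambda>\<alpha>. fst (f \<alpha>))" and "Q = (\<lambda>\<alpha>. snd (f \<alpha>))"
  have cc: "D v * mon x0 \<alpha> v = (\<Sum>i<n. P2 (cc \<alpha> i) w (v 0) (v 1) * v 2 ^ i) + G v * Q \<alpha> v" if "\<alpha> \<in> Al d" for \<alpha> v
    using f that unfolding cc_def Q_def by blast
  have "card ({1..<n} \<times> tri w) < card (Al d)" using num by (simp add: card_cartesian_product card_Al w_def mult.commute)
  then obtain c where c: "\<exists>\<alpha>\<in>Al d. c \<alpha> \<noteq> 0"
    "\<forall>e\<in>{1..<n} \<times> tri w. (\<Sum>\<alpha>\<in>Al d. cc \<alpha> (fst e) (snd e) * c \<alpha>) = 0"
    using homogeneous_system_nontrivial[of "{1..<n} \<times> tri w" "Al d" "\<lambda>e \<alpha>. cc \<alpha> (fst e) (snd e)"] by auto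
  define \<rho> where "\<rho> = (\<lambda>p. \<Sum>\<alpha>\<in>Al d. c \<alpha> * cc \<alpha> 0 p)"
  define F where "F = (\<lambda>v. \<Sum>\<alpha>\<in>Al d. [:c \<alpha>:] * mon x0 \<alpha> v)"
  define Q' where "Q' = (\<lambda>v. \<Sum>\<alpha>\<in>Al d. [:c \<alpha>:] * Q \<alpha> v)"
  have P2s: "(\<Sum>\<alpha>\<in>S. [:c \<alpha>:] * P2 (cc \<alpha> i) w x s) = P2 (\<lambda>p. \<Sum>\<alpha>\<in>S. c \<alpha> * cc \<alpha> i p) w x s" for S i x s
  proof (induction S rule: infinite_finite_induct)
    case (insert \<alpha> S)
    have "[:c \<alpha>:] * P2 (cc \<alpha> i) w x s + P2 h w x s = P2 (\<lambda>p. c \<alpha> * cc \<alpha> i p + h p) w x s" for h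
      unfolding P2_def sum_distrib_left sum.distrib[symmetric]
      by (intro sum.cong refl) (auto simp: smult_add_left)
    then show ?case using insert by simp
  qed (auto simp: P2_def split_def)
  have DF: "D v * F v = P2 \<rho> w (v 0) (v 1) + G v * Q' v" for v
  proof -
    have "D v * F v = (\<Sum>\<alpha>\<in>Al d. [:c \<alpha>:] * (D v * mon x0 \<alpha> v))" unfolding F_def sum_distrib_left by (simp only: mult_ac)
    also have "\<dots> = (\<Sum>\<alpha>\<in>Al d. (\<Sum>i<n. [:c \<alpha>:] * P2 (cc \<alpha> i) w (v 0) (v 1) * v 2 ^ i) + G v * ([:c \<alpha>:] * Q \<alpha> v))"
      by (intro sum.cong refl) (simp only: cc distrib_left sum_distrib_left mult_ac)
    also have "\<dots> = (\<Sum>\<alpha>\<in>Al d. \<Sum>i<n. [:c \<alpha>:] * P2 (cc \<alpha> i) w (v 0) (v 1) * v 2 ^ i) + G v * Q' v"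
      unfolding sum.distrib Q'_def sum_distrib_left ..
    also have "(\<Sum>\<alpha>\<in>Al d. \<Sum>i<n. [:c \<alpha>:] * P2 (cc \<alpha> i) w (v 0) (v 1) * v 2 ^ i)
        = (\<Sum>i<n. (\<Sum>\<alpha>\<in>Al d. [:c \<alpha>:] * P2 (cc \<alpha> i) w (v 0) (v 1)) * v 2 ^ i)"
      unfolding sum_distrib_right by (rule sum.swap)
    also have "\<dots> = (\<Sum>i<n. P2 (\<lambda>p. \<Sum>\<alpha>\<in>Al d. c \<alpha> * cc \<alpha> i p) w (v 0) (v 1) * v 2 ^ i)" unfolding P2s ..
    also have "\<dots> = (\<Sum>i<n. if i = 0 then P2 \<rho> w (v 0) (v 1) else 0)"
    proof (rule sum.cong[OF refl])
      fix i assume i: "i \<in> {..<n}"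
      show "P2 (\<lambda>p. \<Sum>\<alpha>\<in>Al d. c \<alpha> * cc \<alpha> i p) w (v 0) (v 1) * v 2 ^ i = (if i = 0 then P2 \<rho> w (v 0) (v 1) else 0)"
      proof (cases "i = 0")
        case True
        then show ?thesis by (simp add: \<rho>_def)
      next
        case False
        then have "(\<Sum>\<alpha>\<in>Al d. c \<alpha> * cc \<alpha> i p) = 0" if "p \<in> tri w" for p
          using c(2) i that by (force simp: mult.commute)
        then have "P2 (\<lambda>p. \<Sum>\<alpha>\<in>Al d. c \<alpha> * cc \<alpha> i p) w (v 0) (v 1) = 0" unfolding P2_def by (intro sum.neutral) auto
        then show ?thesis using False by simp
      qed
    qed
    also have "\<dots> = P2 \<rho> w (v 0) (v 1)" using n2 by simp
    finally show ?thesis .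
  qed
  have "\<exists>p\<in>tri w. \<rho> p \<noteq> 0"
  proof (rule ccontr)
    assume "\<not> ?thesis"
    then have "P2 \<rho> w x s = 0" for x s unfolding P2_def by (intro sum.neutral) auto
    then have DF0: "D v * F v = G v * Q' v" for v using DF by simp
    define P where "P = (\<lambda>k. \<exists>k' i. (k,k',i) \<in> Al d \<and> c (k,k',i) \<noteq> 0)"
    obtain k1 where "P k1" using c(1) by (auto simp: P_def)
    \<comment> \<open>The least exponent of x - x0 that occurs in \<open>F\<close>; its level is the
      one to which \<open>irr\<close> applies.\<close>
    define \<kappa> where "\<kappa> = Least P"
    have P\<kappa>: "P \<kappa>" unfolding \<kappa>_def using \<open>P k1\<close> by (rule LeastI)
    have less\<kappa>: "\<not> P k" if "k < \<kappa>" for k using that not_less_Least unfolding \<kappa>_def by blast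
    define N where "N = Suc (2 * (n + 1) * (d + 1))"
    have "N > 0" "N \<le> N * Suc \<kappa>" by (auto simp: N_def)
    from branch_at_place[OF this] obtain \<tau> where \<tau>: "coeff \<tau> 0 = 0"
      "[:0,1:] ^ (N * Suc \<kappa>) dvd G (vec3 ([:x0:] + [:0,1:] ^ N) [:s0,1:] \<tau>)"
      "[:0,1:] ^ N dvd G (vec3 [:x0:] [:s0,1:] \<tau>)" by blast
    let ?v = "vec3 ([:x0:] + [:0,1:] ^ N) [:s0,1:] \<tau>"
    have D0: "coeff (D ?v) 0 = g (vec3 x0 s0 0)"
    proof -
      have "coeff (D ?v) 0 = coeff (D (\<lambda>i. [:coeff (?v i) 0:])) 0" by (rule pwR_coeff_0[OF D])
      also have "(\<lambda>i. [:coeff (?v i) 0:]) = (\<lambda>i. [:vec3 x0 s0 0 i:])" using \<tau>(1) \<open>N > 0\<close> by (auto simp: vec3_def coeff_0_power)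
      finally show ?thesis by (simp add: g_def)
    qed
    have "[:0,1:] ^ (N * Suc \<kappa>) dvd D ?v * F ?v" unfolding DF0 using \<tau>(2) by (rule dvd_mult2)
    from Y_power_dvd_cancel[OF this] have "[:0,1:] ^ (N * Suc \<kappa>) dvd F ?v" using p0(2) D0 by metis
    moreover have "F ?v = (\<Sum>\<alpha>\<in>Al d. [:0,1:] ^ (N * fst \<alpha>) * ([:c \<alpha>:] * ([:s0,1:] ^ fst (snd \<alpha>) * \<tau> ^ snd (snd \<alpha>))))"
      unfolding F_def
    proof (rule sum.cong[OF refl])
      fix \<alpha> :: "nat \<times> nat \<times> nat"
      obtain k k' i where a: "\<alpha> = (k,k',i)" by (metis prod.exhaust)
      show "[:c \<alpha>:] * mon x0 \<alpha> ?v = [:0,1:] ^ (N * fst \<alpha>) * ([:c \<alpha>:] * ([:s0,1:] ^ fst (snd \<alpha>) * \<tau> ^ snd (snd \<alpha>)))"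
        unfolding a mon_place fst_conv snd_conv by (simp only: mult_ac)
    qed
    ultimately have "[:0,1:] ^ N dvd (\<Sum>\<alpha>\<in>{\<alpha>\<in>Al d. fst \<alpha> = \<kappa>}. [:c \<alpha>:] * ([:s0,1:] ^ fst (snd \<alpha>) * \<tau> ^ snd (snd \<alpha>)))"
      using less\<kappa> by (intro leading_level) (auto simp: P_def)
    also have "(\<Sum>\<alpha>\<in>{\<alpha>\<in>Al d. fst \<alpha> = \<kappa>}. [:c \<alpha>:] * ([:s0,1:] ^ fst (snd \<alpha>) * \<tau> ^ snd (snd \<alpha>)))
      = (\<Sum>p\<in>{..d} \<times> {..<n}. [:if (\<kappa>, p) \<in> Al d then c (\<kappa>, p) else 0:] * ([:s0,1:] ^ fst p * \<tau> ^ snd p))"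
    proof -
      have "(\<Sum>\<alpha>\<in>{\<alpha>\<in>Al d. fst \<alpha> = \<kappa>}. [:c \<alpha>:] * ([:s0,1:] ^ fst (snd \<alpha>) * \<tau> ^ snd (snd \<alpha>)))
        = (\<Sum>p\<in>{p. (\<kappa>,p) \<in> Al d}. [:c (\<kappa>,p):] * ([:s0,1:] ^ fst p * \<tau> ^ snd p))"
        by (rule sum.reindex_bij_witness[of _ "Pair \<kappa>" snd]) auto
      also have "\<dots> = (\<Sum>p\<in>{..d} \<times> {..<n}. [:if (\<kappa>, p) \<in> Al d then c (\<kappa>, p) else 0:] * ([:s0,1:] ^ fst p * \<tau> ^ snd p))"
        by (rule sum.mono_neutral_cong_left) (auto simp: mem_Al)
      finally show ?thesis .
    qed
    also have "\<dots> = (\<Sum>k\<le>d. \<Sum>i<n. [:if (\<kappa>,k,i) \<in> Al d then c (\<kappa>,k,i) else 0:] * ([:s0,1:] ^ k * \<tau> ^ i))"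
      unfolding sum.cartesian_product by (rule sum.cong) auto
    finally have dvd: "[:0,1:] ^ N dvd \<dots>" .
    obtain k' i where ki: "(\<kappa>,k',i) \<in> Al d" "c (\<kappa>,k',i) \<noteq> 0" using P\<kappa> by (auto simp: P_def)
    then have ex: "\<exists>k\<le>d. \<exists>i<n. (if (\<kappa>,k,i) \<in> Al d then c (\<kappa>,k,i) else 0) \<noteq> 0" by (intro exI[of _ k'] conjI exI[of _ i]) (auto simp: mem_Al)
    from irr[of d "\<lambda>k i. if (\<kappa>,k,i) \<in> Al d then c (\<kappa>,k,i) else 0", OF ex \<tau>(1) _ \<tau>(3)] dvd
    show False by (simp only: N_def lessI simp_thms)
  qed
  moreover have "(\<Sum>(k,k')\<in>tri w. \<rho> (k,k') * (x ^ k * s ^ k')) = 0"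
    if "Gc (vec3 x s t) = 0" "g (vec3 x s t) = 0" for x s t
  proof -
    have "[:\<Sum>(k,k')\<in>tri w. \<rho> (k,k') * (x ^ k * s ^ k'):] = P2 \<rho> w [:x:] [:s:]" by (simp only: P2_const)
    also have "\<dots> = D (\<lambda>i. [:vec3 x s t i:]) * F (\<lambda>i. [:vec3 x s t i:]) - G (\<lambda>i. [:vec3 x s t i:]) * Q' (\<lambda>i. [:vec3 x s t i:])"
      unfolding DF by (simp add: vec3_def)
    also have "\<dots> = 0" unfolding D_const G_const that by simp
    finally show ?thesis by simp
  qed
  ultimately show ?thesis unfolding w_def by blast
qed

text \<open>The monomials sit on the levels k + q l, and because of k \<le> a < q the lowest level
  determines k and l. On it remains a sum of terms \<epsilon> \<theta>^q, where by
  \<open>irr\<close> every nonzero combination of the \<epsilon> has order below q. Frobenius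
  independence bounds the order of this sum, while G, and with it \<open>\<Psi>\<close>, vanishes to
  any prescribed order on the arc.\<close>

lemma \<Psi>_not_multiple:
  assumes c: "\<exists>\<alpha>\<in>Al a. \<exists>\<beta>\<in>Al b. c (\<alpha>,\<beta>) \<noteq> 0"
    and aq: "2 * (n + 1) * (a + 1) < q"
    and \<Psi>: "\<And>v. \<Psi> c a b v = G v * Q v"
  shows False
proof -
  have aq': "a < q" using aq by (auto simp: algebra_simps)
  define P where "P = (\<lambda>\<kappa>. \<exists>k k' i l l' j. (k,k',i) \<in> Al a \<and> (l,l',j) \<in> Al b \<and> c ((k,k',i),(l,l',j)) \<noteq> 0 \<and> \<kappa> = k + q * l)"
  have "\<exists>\<kappa>. P \<kappa>" using c unfolding P_def by (metis prod.exhaust)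
  then obtain \<kappa>1 where "P \<kappa>1" by blast
  define \<kappa> where "\<kappa> = Least P"
  have P\<kappa>: "P \<kappa>" unfolding \<kappa>_def using \<open>P \<kappa>1\<close> by (rule LeastI)
  have less\<kappa>: "\<not> P k" if "k < \<kappa>" for k using that not_less_Least unfolding \<kappa>_def by blast
  obtain k1 k1' i1 l1 l1' j1 where k1: "(k1,k1',i1) \<in> Al a" "(l1,l1',j1) \<in> Al b" "c ((k1,k1',i1),(l1,l1',j1)) \<noteq> 0" "\<kappa> = k1 + q * l1"
    using P\<kappa> unfolding P_def by blast
  define M where "M = 2 * (n + 1) * (b + 1)"
  \<comment> \<open>Exceeds q (M + 1), the order excluded by Frobenius independence, and is large
    enough for \<open>irr\<close> with both degree bounds a and b.\<close>
  define N where "N = q * Suc M + q + 1"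
  have N: "N > 0" "N \<le> N * Suc \<kappa>" "M < N" "q < N" "q * Suc M \<le> N"
    using q2 by (auto simp: N_def)
      (metis add.commute add_lessD1 le_add1 le_less_trans less_add_Suc2 mult_le_mono1 nat_mult_1 one_le_numeral order.trans)
  from branch_at_place[OF N(1,2)] obtain \<tau> where \<tau>: "coeff \<tau> 0 = 0"
    "[:0,1:] ^ (N * Suc \<kappa>) dvd G (vec3 ([:x0:] + [:0,1:] ^ N) [:s0,1:] \<tau>)"
    "[:0,1:] ^ N dvd G (vec3 [:x0:] [:s0,1:] \<tau>)" by blast
  let ?v = "vec3 ([:x0:] + [:0,1:] ^ N) [:s0,1:] \<tau>"
  define lev where "lev = (\<lambda>(\<alpha>::nat \<times> nat \<times> nat, \<beta>::nat \<times> nat \<times> nat). fst \<alpha> + q * fst \<beta>)"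
  define h where "h = (\<lambda>(\<alpha>,\<beta>). [:c (\<alpha>,\<beta>):] * (([:s0,1:] ^ fst (snd \<alpha>) * \<tau> ^ snd (snd \<alpha>)) * ([:s0,1:] ^ fst (snd \<beta>) * \<tau> ^ snd (snd \<beta>)) ^ q))"
  have "\<Psi> c a b ?v = (\<Sum>x\<in>Al a \<times> Al b. [:0,1:] ^ (N * lev x) * h x)"
    unfolding \<Psi>_def
  proof (rule sum.cong[OF refl], clarify)
    fix k k' i l l' j
    have "[:0,1:] ^ (N * (k + q * l)) = [:0,1:] ^ (N * k) * [:0,1::'k:] ^ (N * (q * l))"
      by (simp only: distrib_left power_add)
    then show "[:c ((k,k',i),(l,l',j)):] * (mon x0 (k,k',i) ?v * mon (x0 ^ q) (l,l',j) (\<lambda>i. ?v i ^ q)) = [:0,1:] ^ (N * lev ((k,k',i),(l,l',j))) * h ((k,k',i),(l,l',j))"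
      unfolding mon_place mon_place_frob lev_def h_def prod.case fst_conv snd_conv by (simp only: mult_ac)
  qed
  moreover have "[:0,1:] ^ (N * Suc \<kappa>) dvd \<Psi> c a b ?v" unfolding \<Psi> using \<tau>(2) by (rule dvd_mult2)
  moreover have "h x = 0" if "x \<in> Al a \<times> Al b" "lev x < \<kappa>" for x
  proof -
    obtain k k' i l l' j where x: "x = ((k,k',i),(l,l',j))" by (metis prod.exhaust)
    have "c x = 0"
    proof (rule ccontr)
      assume "c x \<noteq> 0"
      then have "P (lev x)" unfolding P_def using that(1)
        by (intro exI[of _ k] exI[of _ k'] exI[of _ i] exI[of _ l] exI[of _ l'] exI[of _ j]) (auto simp: x lev_def)
      then show False using less\<kappa>[OF that(2)] by blast
    qed
    then show ?thesis by (simp add: x h_def)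
  qed
  ultimately have dv: "[:0,1:] ^ N dvd (\<Sum>x\<in>{x\<in>Al a \<times> Al b. lev x = \<kappa>}. h x)"
    by (intro leading_level) auto
  define C' where "C' = (\<lambda>p r. if (k1,p) \<in> Al a \<and> (l1,r) \<in> Al b then c ((k1,p),(l1,r)) else 0)"
  have levk: "k = k1 \<and> l = l1" if "k \<le> a" "k + q * l = \<kappa>" for k l
  proof -
    have "k1 \<le> a" using k1 by (auto simp: mem_Al)
    then have "k < q" "k1 < q" using that aq' by auto
    have e: "k + q * l = k1 + q * l1" using that(2) k1(4) by simp
    then have "(k + q * l) mod q = (k1 + q * l1) mod q" by simp
    then have "k = k1" using \<open>k < q\<close> \<open>k1 < q\<close> by simp
    then show ?thesis using e q2 by auto
  qed
  define \<theta> where "\<theta> = (\<lambda>r. [:s0,1:] ^ fst r * \<tau> ^ snd r)"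
  define \<epsilon> where "\<epsilon> = (\<lambda>r. \<Sum>p\<in>{..a} \<times> {..<n}. [:C' p r:] * \<theta> p)"
  have "(\<Sum>x\<in>{x\<in>Al a \<times> Al b. lev x = \<kappa>}. h x) = (\<Sum>(r,p)\<in>({..b} \<times> {..<n}) \<times> ({..a} \<times> {..<n}). [:C' p r:] * (\<theta> p * \<theta> r ^ q))"
  proof -
    have "(\<Sum>x\<in>{x\<in>Al a \<times> Al b. lev x = \<kappa>}. h x) = (\<Sum>(r,p)\<in>{(r,p). (k1,p) \<in> Al a \<and> (l1,r) \<in> Al b}. [:C' p r:] * (\<theta> p * \<theta> r ^ q))"
    proof (rule sum.reindex_bij_witness[of _ "\<lambda>(r,p). ((k1,p),(l1,r))" "\<lambda>x. (snd (snd x), snd (fst x))"])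
      fix x assume x: "x \<in> {x\<in>Al a \<times> Al b. lev x = \<kappa>}"
      obtain k k' i l l' j where xx: "x = ((k,k',i),(l,l',j))" by (metis prod.exhaust)
      have "k \<le> a" "k + q * l = \<kappa>" using x by (auto simp: xx mem_Al lev_def)
      then have kl: "k = k1" "l = l1" using levk by auto
      show "(case (snd (snd x), snd (fst x)) of (r, p) \<Rightarrow> ((k1, p), l1, r)) = x" by (simp add: xx kl)
      show "(snd (snd x), snd (fst x)) \<in> {(r, p). (k1, p) \<in> Al a \<and> (l1, r) \<in> Al b}" using x by (auto simp: xx kl)
      show "(case (snd (snd x), snd (fst x)) of (r, p) \<Rightarrow> [:C' p r:] * (\<theta> p * \<theta> r ^ q)) = h x"
        using x by (auto simp: xx kl h_def C'_def \<theta>_def)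
    qed (use k1 in \<open>auto simp: lev_def\<close>)
    also have "\<dots> = (\<Sum>(r,p)\<in>({..b} \<times> {..<n}) \<times> ({..a} \<times> {..<n}). [:C' p r:] * (\<theta> p * \<theta> r ^ q))"
      by (rule sum.mono_neutral_left) (auto simp: mem_Al C'_def split: if_splits)
    finally show ?thesis .
  qed
  also have "\<dots> = (\<Sum>r\<in>{..b} \<times> {..<n}. \<epsilon> r * \<theta> r ^ q)"
    unfolding \<epsilon>_def sum_distrib_right sum.cartesian_product by (rule sum.cong[OF refl]) (simp add: split_def mult_ac)
  finally have dv2: "[:0,1:] ^ N dvd (\<Sum>r\<in>{..b} \<times> {..<n}. \<epsilon> r * \<theta> r ^ q)" using dv by simp
  have comb: "(\<Sum>p\<in>{..d} \<times> {..<n}. [:e p:] * \<theta> p) = (\<Sum>k\<le>d. \<Sum>i<n. [:e (k,i):] * ([:s0,1:] ^ k * \<tau> ^ i))" for d and e :: "nat \<times> nat \<Rightarrow> 'k"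
    by (simp add: sum.cartesian_product split_def \<theta>_def)
  have irr': "\<not> [:0,1:] ^ Suc (2 * (n + 1) * (d + 1)) dvd (\<Sum>p\<in>{..d} \<times> {..<n}. [:e p:] * \<theta> p)"
    if ex: "\<exists>p\<in>{..d} \<times> {..<n}. e p \<noteq> 0" and dN: "2 * (n + 1) * (d + 1) < N" for d and e :: "nat \<times> nat \<Rightarrow> 'k"
  proof -
    have "\<exists>k\<le>d. \<exists>i<n. e (k,i) \<noteq> 0" using ex by auto
    from irr[of d "\<lambda>k i. e (k,i)", OF this \<tau>(1) dN \<tau>(3)] show ?thesis unfolding comb .
  qed
  have "\<not> [:0,1:] ^ (q * Suc M) dvd (\<Sum>r\<in>{..b} \<times> {..<n}. \<epsilon> r * \<theta> r ^ q)"
  proof (rule frobenius_independence[OF frob])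
    show "q > 0" using q2 by simp
    show "\<not> [:0,1:] ^ Suc M dvd (\<Sum>\<beta>\<in>{..b} \<times> {..<n}. [:d \<beta>:] * \<theta> \<beta>)" if "\<exists>\<beta>\<in>{..b} \<times> {..<n}. d \<beta> \<noteq> 0" for d
      using irr'[OF that] N(3) unfolding M_def by blast
    have comb2: "(\<Sum>\<beta>\<in>{..b} \<times> {..<n}. [:d \<beta>:] * \<epsilon> \<beta>) = (\<Sum>p\<in>{..a} \<times> {..<n}. [:\<Sum>\<beta>\<in>{..b} \<times> {..<n}. d \<beta> * C' p \<beta>:] * \<theta> p)" for d
    proof -
      have s: "(\<Sum>\<beta>\<in>S. [:f \<beta>:]) = [:\<Sum>\<beta>\<in>S. f \<beta>:]" for S and f :: "nat \<times> nat \<Rightarrow> 'k" by (induction S rule: infinite_finite_induct) auto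
      have "(\<Sum>\<beta>\<in>{..b} \<times> {..<n}. [:d \<beta>:] * \<epsilon> \<beta>) = (\<Sum>\<beta>\<in>{..b} \<times> {..<n}. \<Sum>p\<in>{..a} \<times> {..<n}. [:d \<beta> * C' p \<beta>:] * \<theta> p)"
        unfolding \<epsilon>_def sum_distrib_left by (simp only: const_poly_mult mult.assoc)
      also have "\<dots> = (\<Sum>p\<in>{..a} \<times> {..<n}. \<Sum>\<beta>\<in>{..b} \<times> {..<n}. [:d \<beta> * C' p \<beta>:] * \<theta> p)" by (rule sum.swap)
      finally show ?thesis unfolding sum_distrib_right[symmetric] s .
    qed
    show "(\<Sum>\<beta>\<in>{..b} \<times> {..<n}. [:d \<beta>:] * \<epsilon> \<beta>) = 0 \<or> \<not> [:0,1:] ^ q dvd (\<Sum>\<beta>\<in>{..b} \<times> {..<n}. [:d \<beta>:] * \<epsilon> \<beta>)" for d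
    proof (cases "\<exists>p\<in>{..a} \<times> {..<n}. (\<Sum>\<beta>\<in>{..b} \<times> {..<n}. d \<beta> * C' p \<beta>) \<noteq> 0")
      case True
      have "2 * (n + 1) * (a + 1) < N" using aq N(4) by simp
      from irr'[OF True this] have "\<not> [:0,1:] ^ Suc (2 * (n + 1) * (a + 1)) dvd (\<Sum>\<beta>\<in>{..b} \<times> {..<n}. [:d \<beta>:] * \<epsilon> \<beta>)"
        unfolding comb2 .
      then show ?thesis using aq by (meson Suc_leI power_le_dvd)
    next
      case False
      then show ?thesis unfolding comb2 by (auto intro!: sum.neutral)
    qed
    have kk: "(k1',i1) \<in> {..a} \<times> {..<n}" "(l1',j1) \<in> {..b} \<times> {..<n}" using k1 by (auto simp: mem_Al)
    have "\<exists>p\<in>{..a} \<times> {..<n}. C' p (l1',j1) \<noteq> 0" using kk k1 by (intro bexI[of _ "(k1',i1)"]) (auto simp: C'_def)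
    moreover have "2 * (n + 1) * (a + 1) < N" using aq N(4) by simp
    ultimately have "\<not> [:0,1:] ^ Suc (2 * (n + 1) * (a + 1)) dvd \<epsilon> (l1',j1)" unfolding \<epsilon>_def by (rule irr')
    then have "\<epsilon> (l1',j1) \<noteq> 0" by auto
    then show "\<exists>\<beta>\<in>{..b} \<times> {..<n}. \<epsilon> \<beta> \<noteq> 0" using kk by blast
  qed auto
  moreover have "[:0,1:] ^ (q * Suc M) dvd (\<Sum>r\<in>{..b} \<times> {..<n}. \<epsilon> r * \<theta> r ^ q)"
    using dv2 N(5) by (rule power_le_dvd)
  ultimately show False by blast
qed

theorem no_such_curve:
  assumes "card (tri (a + b + 2 * n * n * m)) * n * (n - 1) * (\<Sum>r<m. r + 1) < (card (tri a) * n) * (card (tri b) * n)"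
    and "(n - 1) * card (tri (d + 2 * n * n)) < n * card (tri d)"
    and "m \<le> q" "2 * (n + 1) * (a + 1) < q"
    and "a + n * n + q * (b + n * n) < m * (q - card Bad - (d + 2 * n * n))"
    and "a + n * n + q * (b + n * n) + (d + 2 * n * n) < q * q"
  shows False
proof -
  obtain c where c: "\<exists>\<alpha>\<in>Al a. \<exists>\<beta>\<in>Al b. c (\<alpha>,\<beta>) \<noteq> 0"
    "\<forall>env\<in>Yset. \<forall>r<m. (\<Sum>(\<alpha>,\<beta>)\<in>Al a \<times> Al b. c (\<alpha>,\<beta>) * (coeff (mon x0 \<alpha> (sh m env)) r * monE (x0 ^ q) \<beta> env)) = 0"
    using ex_auxiliary_coefficients[OF assms(1)] by blast
  obtain \<rho> where "\<exists>p\<in>tri (d + 2 * n * n). \<rho> p \<noteq> 0"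
    "\<And>x s t. Gc (vec3 x s t) = 0 \<Longrightarrow> g (vec3 x s t) = 0 \<Longrightarrow> (\<Sum>(k,k')\<in>tri (d + 2 * n * n). \<rho> (k,k') * (x ^ k * s ^ k')) = 0"
    using discriminant[OF assms(2)] by blast
  note rho = this
  have "\<exists>Q. \<forall>v. \<Psi> c a b v = G v * Q v"
    by (rule \<Psi>_multiple_of_G[OF c(2) assms(3) rho(1) _ assms(5,6)]) (rule rho(2))
  then obtain Q where "\<And>v. \<Psi> c a b v = G v * Q v" by blast
  from \<Psi>_not_multiple[OF c(1) assms(4) this] show False .
qed

end

section \<open>Choice of the parameters\<close>

text \<open>Cubing clears the denominator of the exponent and leaves 2^(13 n + 12). The factor 600
  fits the case n = 5 with little room; afterwards the power of 2 grows by 2^13 = 8192 per step and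
  the cube of 600 n^7 by at most (6/5)^21.\<close>

lemma q_large:
  assumes "n \<ge> 5" "real q \<ge> 2 powr (13 / 3 * real n + 4)"
  shows "q \<ge> 600 * n ^ 7"
proof (rule ccontr)
  assume "\<not> q \<ge> 600 * n ^ 7"
  then have "q < 600 * n ^ 7" by simp
  then have "q ^ 3 < (600 * n ^ 7) ^ 3" by (intro power_strict_mono) auto
  moreover have "(600 * n ^ 7) ^ 3 \<le> 2 ^ (13 * n + 12)" using assms(1)
  proof (induction n rule: dec_induct)
    case base
    show ?case by simp
  next
    case (step n)
    have "5 * (n + 1) \<le> 6 * n" using step by simp
    then have "(5 * (n + 1)) ^ 21 \<le> (6 * n) ^ 21" by (rule power_mono) simp
    then have "5 ^ 21 * (n + 1) ^ 21 \<le> 6 ^ 21 * n ^ 21" by (simp only: power_mult_distrib)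
    also have "\<dots> \<le> (8192 * 5 ^ 21) * n ^ 21" by (intro mult_right_mono) auto
    finally have "(n + 1) ^ 21 \<le> 8192 * n ^ 21" by simp
    then have "600 ^ 3 * (n + 1) ^ 21 \<le> 8192 * (600 ^ 3 * n ^ 21)" by simp
    also have "600 ^ 3 * n ^ 21 = (600 * n ^ 7) ^ 3" by (simp add: power_mult_distrib flip: power_mult)
    also have "8192 * (600 * n ^ 7) ^ 3 \<le> 8192 * 2 ^ (13 * n + 12)" using step by simp
    also have "\<dots> = 2 ^ (13 * Suc n + 12)" by (simp add: power_add)
    finally show ?case by (simp add: power_mult_distrib flip: power_mult)
  qed
  ultimately have "real q ^ 3 < 2 ^ (13 * n + 12)" by (metis of_nat_less_iff of_nat_numeral of_nat_power order_less_le_trans)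
  moreover have "(2 powr (13 / 3 * real n + 4)) ^ 3 = (2::real) ^ (13 * n + 12)"
  proof -
    have "(2 powr (13 / 3 * real n + 4)) ^ 3 = (2::real) powr (real 3 * (13 / 3 * real n + 4))"
      by (simp add: powr_power mult.commute)
    also have "real 3 * (13 / 3 * real n + 4) = real (13 * n + 12)" by simp
    also have "2 powr real (13 * n + 12) = (2::real) ^ (13 * n + 12)" by (rule powr_realpow) simp
    finally show ?thesis .
  qed
  moreover have "(2 powr (13 / 3 * real n + 4)) ^ 3 \<le> real q ^ 3" using assms(2) by (intro power_mono) auto
  ultimately show False by simp
qed

lemma sum_Suc_lessThan: "2 * (\<Sum>r<m. r + 1) = m * (m + 1)" for m :: nat
  by (induction m) auto

text \<open>\<open>m\<close> is the least value for which m q exceeds q (b + n^2). The choice of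
  \<open>b\<close> makes m / (b + 1) and (m + 1) / (b + 2) at most 1 + 1 / (5 n), and that of
  \<open>a\<close> does the same for the two factors of the growth from a to a + \<Delta>; the
  product of the four stays below n / (n - 1). For \<open>d\<close> there are two factors of at most
  1 + 1 / (4 n), as 2 n^2 / d = 1 / (4 n). The resulting \<open>a\<close> is of order n^6, whence
  n^7 in the bound on q. \<open>B\<close> stands for the number of bad base points.\<close>

lemma stepanov_parameters:
  fixes n q B :: nat
  assumes n: "n \<ge> 5" and q: "q \<ge> 600 * n ^ 7" and B: "B \<le> 2 * n"
  shows "\<exists>a b m d. card (tri (a + b + 2 * n * n * m)) * n * (n - 1) * (\<Sum>r<m. r + 1) < (card (tri a) * n) * (card (tri b) * n)
    \<and> (n - 1) * card (tri (d + 2 * n * n)) < n * card (tri d)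
    \<and> m \<le> q \<and> 2 * (n + 1) * (a + 1) < q
    \<and> a + n * n + q * (b + n * n) < m * (q - B - (d + 2 * n * n))
    \<and> a + n * n + q * (b + n * n) + (d + 2 * n * n) < q * q"
proof -
  define b where "b = 5 * n ^ 3"
  define m where "m = b + n * n + 1"
  define \<Delta> where "\<Delta> = b + 2 * n * n * m"
  define a where "a = 5 * n * \<Delta>"
  define d where "d = 8 * n ^ 3"
  have pw: "5 * n ^ k \<le> n ^ Suc k" for k using n by simp
  have p: "5 * n \<le> n ^ 2" "5 * n ^ 2 \<le> n ^ 3" "5 * n ^ 3 \<le> n ^ 4" "5 * n ^ 4 \<le> n ^ 5" "5 * n ^ 5 \<le> n ^ 6" "5 * n ^ 6 \<le> n ^ 7"
    using pw[of 1] pw[of 2] pw[of 3] pw[of 4] pw[of 5] pw[of 6] by (simp_all add: eval_nat_numeral)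
  have nn: "n * n = n ^ 2" by (simp add: power2_eq_square)
  have De: "\<Delta> = 10 * n ^ 5 + 2 * n ^ 4 + 5 * n ^ 3 + 2 * n ^ 2"
    unfolding \<Delta>_def m_def b_def by (simp add: eval_nat_numeral algebra_simps)
  have D11: "\<Delta> \<le> 11 * n ^ 5" unfolding De using p by linarith
  have a55: "a \<le> 55 * n ^ 6"
  proof -
    have "a \<le> 5 * n * (11 * n ^ 5)" unfolding a_def using D11 by simp
    then show ?thesis by (simp add: eval_nat_numeral algebra_simps)
  qed
  have m7: "m \<le> 6 * n ^ 3" unfolding m_def b_def nn using p n by linarith
  have n1: "(n - 1) * y = n * y - y" for y :: nat by (simp add: diff_mult_distrib)
  have n1': "n ^ 7 \<ge> 1" using n by simp
  have n6: "n * n ^ 6 = n ^ 7" by (simp add: eval_nat_numeral)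
  have 4: "2 * (n + 1) * (a + 1) < q"
  proof -
    have "2 * (n + 1) * (a + 1) \<le> (3 * n) * (56 * n ^ 6)"
    proof (rule mult_le_mono)
      show "2 * (n + 1) \<le> 3 * n" using n by simp
      have "n ^ 6 \<ge> 1" using n by simp
      then show "a + 1 \<le> 56 * n ^ 6" using a55 by linarith
    qed
    also have "\<dots> = 168 * n ^ 7" by (simp add: n6[symmetric])
    also have "\<dots> < 600 * n ^ 7" using n by simp
    finally show ?thesis using q by linarith
  qed
  have 3: "m \<le> q" using m7 p q by linarith
  define E where "E = B + (d + 2 * n * n)"
  have E9: "E \<le> 9 * n ^ 3" unfolding E_def d_def mult.assoc nn using B p n by linarith
  have mE: "m * E \<le> 54 * n ^ 6"
  proof -
    have "m * E \<le> (6 * n ^ 3) * (9 * n ^ 3)" using m7 E9 by (rule mult_le_mono)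
    then show ?thesis by (simp add: eval_nat_numeral algebra_simps)
  qed
  have 5: "a + n * n + q * (b + n * n) < m * (q - B - (d + 2 * n * n))"
  proof -
    have h1: "q - B - (d + 2 * n * n) = q - E" by (simp add: E_def)
    have h2: "m * (q - E) = m * q - m * E" by (simp add: diff_mult_distrib2)
    have h3: "m * q = q * (b + n * n) + q" by (simp add: m_def algebra_simps)
    have h4: "a + n * n + m * E < q" using a55 mE q p n1' unfolding nn by linarith
    show ?thesis unfolding h1 h2 h3 using h4 by linarith
  qed
  have 6: "a + n * n + q * (b + n * n) + (d + 2 * n * n) < q * q"
  proof -
    have "b + n * n \<le> 6 * n ^ 3" using m7 by (simp add: m_def)
    then have "q * (b + n * n) \<le> q * (6 * n ^ 3)" by simp
    moreover have "a + n * n + (d + 2 * n * n) < q" using a55 q p n1' unfolding d_def mult.assoc nn by linarith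
    moreover have "q * (6 * n ^ 3) + q \<le> q * q"
    proof -
      have "6 * n ^ 3 + 1 \<le> q" using q p n1' by linarith
      then have "q * (6 * n ^ 3 + 1) \<le> q * q" by (rule mult_le_mono2)
      then show ?thesis by simp
    qed
    ultimately show ?thesis by linarith
  qed
  have 1: "card (tri (a + b + 2 * n * n * m)) * n * (n - 1) * (\<Sum>r<m. r + 1) < (card (tri a) * n) * (card (tri b) * n)"
  proof -
    have aD: "a + b + 2 * n * n * m = a + \<Delta>" by (simp add: \<Delta>_def)
    let ?f = "5 * n" let ?g = "5 * n + 1"
    have a1: "?f * (a + \<Delta> + 1) \<le> ?g * (a + 1)" "?f * (a + \<Delta> + 2) \<le> ?g * (a + 2)" by (auto simp: a_def algebra_simps)
    have fb: "?f * (n * n) = b" by (simp add: b_def power3_eq_cube)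
    have b1: "?f * m \<le> ?g * (b + 1)" "?f * (m + 1) \<le> ?g * (b + 2)"
    proof -
      have "?f * m = ?f * (b + 1) + ?f * (n * n)" "?f * (m + 1) = ?f * (b + 2) + ?f * (n * n)"
        by (simp_all add: m_def algebra_simps)
      then show "?f * m \<le> ?g * (b + 1)" "?f * (m + 1) \<le> ?g * (b + 2)" unfolding fb by (auto simp: algebra_simps)
    qed
    define Z where "Z = (a + 1) * (a + 2) * ((b + 1) * (b + 2))"
    define V where "V = (a + \<Delta> + 1) * (a + \<Delta> + 2) * (m * (m + 1))"
    have "(?f * (a + \<Delta> + 1)) * (?f * (a + \<Delta> + 2)) * ((?f * m) * (?f * (m + 1))) \<le> (?g * (a + 1)) * (?g * (a + 2)) * ((?g * (b + 1)) * (?g * (b + 2)))"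
      by (intro mult_le_mono a1 b1)
    then have VZ: "?f ^ 4 * V \<le> ?g ^ 4 * Z" unfolding V_def Z_def by (simp only: power4_eq_xxxx mult_ac)
    have Zp: "Z > 0" by (simp add: Z_def)
    have fg: "(n - 1) * ?g ^ 4 < n * ?f ^ 4"
    proof -
      have h0: "n * n ^ 4 > 0" using n by simp
      have g4: "?g ^ 4 = 625 * n ^ 4 + 500 * n ^ 3 + 150 * n ^ 2 + 20 * n + 1" by (simp add: power4_eq_xxxx power3_eq_cube power2_eq_square algebra_simps)
      have h1: "n * (625 * n ^ 4 + 500 * n ^ 3 + 150 * n ^ 2 + 20 * n + 1) = 625 * (n * n ^ 4) + 500 * n ^ 4 + 150 * n ^ 3 + 20 * n ^ 2 + n" by (simp add: power4_eq_xxxx power3_eq_cube power2_eq_square algebra_simps)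
      have h2: "n * ?f ^ 4 = 625 * (n * n ^ 4)" by (simp add: power4_eq_xxxx power3_eq_cube power2_eq_square algebra_simps)
      show ?thesis unfolding n1 g4 h1 h2 using p n h0 by linarith
    qed
    have "?f ^ 4 * ((n - 1) * V) < ?f ^ 4 * (n * Z)"
    proof -
      have "?f ^ 4 * ((n - 1) * V) = (n - 1) * (?f ^ 4 * V)" by (simp only: mult_ac)
      also have "\<dots> \<le> (n - 1) * (?g ^ 4 * Z)" using VZ by (rule mult_le_mono2)
      also have "\<dots> = ((n - 1) * ?g ^ 4) * Z" by (simp only: mult_ac)
      also have "\<dots> < (n * ?f ^ 4) * Z" using fg Zp by (rule mult_strict_right_mono)
      finally show ?thesis by (simp only: mult_ac)
    qed
    then have V: "(n - 1) * V < n * Z" by simp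
    have "4 * (card (tri (a + \<Delta>)) * n * (n - 1) * (\<Sum>r<m. r + 1)) = n * ((n - 1) * ((2 * card (tri (a + \<Delta>))) * (2 * (\<Sum>r<m. r + 1))))"
      by simp
    also have "\<dots> = n * ((n - 1) * V)" unfolding card_tri sum_Suc_lessThan V_def ..
    also have "\<dots> < n * (n * Z)" using V n by simp
    also have "\<dots> = n * (n * ((2 * card (tri a)) * (2 * card (tri b))))" unfolding card_tri Z_def ..
    also have "\<dots> = 4 * ((card (tri a) * n) * (card (tri b) * n))" by simp
    finally show ?thesis unfolding aD by simp
  qed
  have 2: "(n - 1) * card (tri (d + 2 * n * n)) < n * card (tri d)"
  proof -
    let ?f = "4 * n" let ?g = "4 * n + 1"
    have fd: "?f * (2 * n * n) = d" by (simp add: d_def power3_eq_cube)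
    have d1: "?f * (d + 2 * n * n + 1) \<le> ?g * (d + 1)" "?f * (d + 2 * n * n + 2) \<le> ?g * (d + 2)"
    proof -
      have "?f * (d + 2 * n * n + 1) = ?f * (d + 1) + ?f * (2 * n * n)" "?f * (d + 2 * n * n + 2) = ?f * (d + 2) + ?f * (2 * n * n)"
        by (simp_all add: algebra_simps)
      then show "?f * (d + 2 * n * n + 1) \<le> ?g * (d + 1)" "?f * (d + 2 * n * n + 2) \<le> ?g * (d + 2)" unfolding fd by (auto simp: algebra_simps)
    qed
    define Z where "Z = (d + 1) * (d + 2)"
    define V where "V = (d + 2 * n * n + 1) * (d + 2 * n * n + 2)"
    have "(?f * (d + 2 * n * n + 1)) * (?f * (d + 2 * n * n + 2)) \<le> (?g * (d + 1)) * (?g * (d + 2))"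
      by (intro mult_le_mono d1)
    then have VZ: "?f ^ 2 * V \<le> ?g ^ 2 * Z" unfolding V_def Z_def by (simp only: power2_eq_square mult_ac)
    have Zp: "Z > 0" by (simp add: Z_def)
    have fg: "(n - 1) * ?g ^ 2 < n * ?f ^ 2"
    proof -
      have h0: "n * n ^ 2 > 0" using n by simp
      have g4: "?g ^ 2 = 16 * n ^ 2 + 8 * n + 1" by (simp add: power4_eq_xxxx power3_eq_cube power2_eq_square algebra_simps)
      have h1: "n * (16 * n ^ 2 + 8 * n + 1) = 16 * (n * n ^ 2) + 8 * n ^ 2 + n" by (simp add: power4_eq_xxxx power3_eq_cube power2_eq_square algebra_simps)
      have h2: "n * ?f ^ 2 = 16 * (n * n ^ 2)" by (simp add: power4_eq_xxxx power3_eq_cube power2_eq_square algebra_simps)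
      show ?thesis unfolding n1 g4 h1 h2 using p n h0 by linarith
    qed
    have "?f ^ 2 * ((n - 1) * V) < ?f ^ 2 * (n * Z)"
    proof -
      have "?f ^ 2 * ((n - 1) * V) = (n - 1) * (?f ^ 2 * V)" by (simp only: mult_ac)
      also have "\<dots> \<le> (n - 1) * (?g ^ 2 * Z)" using VZ by (rule mult_le_mono2)
      also have "\<dots> = ((n - 1) * ?g ^ 2) * Z" by (simp only: mult_ac)
      also have "\<dots> < (n * ?f ^ 2) * Z" using fg Zp by (rule mult_strict_right_mono)
      finally show ?thesis by (simp only: mult_ac)
    qed
    then have V: "(n - 1) * V < n * Z" by simp
    have "2 * ((n - 1) * card (tri (d + 2 * n * n))) = (n - 1) * (2 * card (tri (d + 2 * n * n)))" by simp
    also have "\<dots> = (n - 1) * V" unfolding card_tri V_def ..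
    also have "\<dots> < n * Z" by (rule V)
    also have "\<dots> = 2 * (n * card (tri d))" unfolding Z_def card_tri[symmetric] by simp
    finally show ?thesis by simp
  qed
  show ?thesis using 1 2 3 4 5 6 by blast
qed

section \<open>The special fibre\<close>

text \<open>The values of \<open>a_i\<close> at the special point are \<open>\<theta> ^ r i\<close> for a generic \<open>\<theta>\<close>. Making exactly one edge \<open>{i, i + I}\<close> degenerate, and no edge
  \<open>{i, i + J}\<close>, produces the ramified branch; \<open>r J = r (n - J)\<close> removes the linear term there.\<close>

lemma gluing:
  fixes n I J :: nat
  assumes n: "n \<ge> 5" and I: "0 < I" "I < n" and J: "0 < J" "J < n" and IJ: "I \<noteq> J" "I + J \<noteq> n"
    and I2: "2 * I \<noteq> n" and J3: "3 * J \<noteq> n" "3 * J \<noteq> 2 * n"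
  shows "\<exists>r i1. (\<forall>i<n. r i < n) \<and> r J = r (n - J) \<and> i1 < n \<and> i1 \<noteq> 0 \<and> i1 \<noteq> n - I \<and> r ((i1 + I) mod n) = r i1
     \<and> (\<forall>i<n. i \<noteq> 0 \<longrightarrow> i \<noteq> n - I \<longrightarrow> i \<noteq> i1 \<longrightarrow> r ((i + I) mod n) \<noteq> r i)
     \<and> (\<forall>i<n. i \<noteq> 0 \<longrightarrow> i \<noteq> n - J \<longrightarrow> r ((i + J) mod n) \<noteq> r i)
     \<and> r I \<noteq> r J \<and> r (n - I) \<noteq> r J"
proof -
  have step: "(i + m) mod n = i + m \<or> (i + m) mod n + n = i + m" "(i + m) mod n < n" if "i < n" "m < n" for i m :: nat
    using that by (auto simp: mod_if)
  have card4: "card {a, b, c, d} \<le> 4" for a b c d :: nat using card_length[of "[a,b,c,d]"] by simp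
  have card6: "card {a, b, c, d, e, f} \<le> 6" for a b c d e f :: nat using card_length[of "[a,b,c,d,e,f]"] by simp
  define J' I' where "J' = n - J" and "I' = n - I"
  have J': "J + J' = n" "0 < J'" "J' < n" and I': "I + I' = n" "0 < I'" "I' < n"
    using I J by (auto simp: J'_def I'_def)
  have stepI: "(i + I) mod n \<noteq> 0" "(i + I) mod n \<noteq> i" if "i < n" "i \<noteq> 0" "i \<noteq> I'" for i
    using step[OF that(1) I(2)] that I I' by linarith+
  have stepJ: "(i + J) mod n \<noteq> 0" "(i + J) mod n \<noteq> i" if "i < n" "i \<noteq> 0" "i \<noteq> J'" for i
    using step[OF that(1) J(2)] that J J' by linarith+
  have edge3: False if "i = J" "(i + J) mod n = J'" for i
    using that step[OF J(2) J(2)] J J' J3 by auto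
  have edgeIJ: False if "i < n" "j < n" "(i + I) mod n = j" "(i + J) mod n = j \<or> (j + J) mod n = i" for i j
    using that(3,4) step[OF that(1) I(2)] step[OF that(1) J(2)] step[OF that(2) J(2)] I J IJ by (elim disjE) auto
  have edgeI: False if "i < n" "j < n" "(i + I) mod n = j" "(j + I) mod n = i" for i j
    using that(3,4) step[OF that(1) I(2)] step[OF that(2) I(2)] I I2 by (elim disjE) auto
  \<comment> \<open>It suffices that \<open>r\<close> identifies the pair J, J' and one I-edge i1,
    i2 and nothing else, provided that the pair is this edge, or is disjoint from it and not an
    I-edge.\<close>
  have glued: ?thesis if i1: "i1 < n" "i1 \<noteq> 0" "i1 \<noteq> I'" "(i1 + I) mod n = i2" and rb: "\<forall>i<n. r i < n" and r: "r J = r J'" "r i1 = r i2"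
    and S: "{i1, i2} = {J, J'} \<or> (J \<noteq> J' \<longrightarrow> (J + I) mod n \<noteq> J' \<and> (J' + I) mod n \<noteq> J) \<and> i1 \<notin> {J, J'} \<and> i2 \<notin> {J, J'}"
    and req: "\<And>a b. r a = r b \<Longrightarrow> a = b \<or> {a, b} = {J, J'} \<or> {a, b} = {i1, i2}" for r i1 i2
  proof -
    have i2: "i2 < n" using i1 n by auto
    have 1: "r ((i + I) mod n) \<noteq> r i" if i: "i < n" "i \<noteq> 0" "i \<noteq> I'" "i \<noteq> i1" for i
    proof
      define y where "y = (i + I) mod n"
      have y: "y \<noteq> i" using stepI(2)[OF i(1-3)] by (simp add: y_def)
      assume "r ((i + I) mod n) = r i"
      then have "r y = r i" by (simp add: y_def)
      from req[OF this] y consider "{y, i} = {i1, i2}" | "{y, i} = {J, J'}" "{i1, i2} \<noteq> {J, J'}" by blast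
      then show False
      proof cases
        case 1
        then have "i = i2" "y = i1" using i(4) by (simp_all only: doubleton_eq_iff, blast+)
        then show False using edgeI[of i1 i2] i1 i2 unfolding y_def by blast
      next
        case 2
        then have "y = J \<and> i = J' \<or> y = J' \<and> i = J" by (simp only: doubleton_eq_iff)
        then show False using 2(2) S y unfolding y_def by metis
      qed
    qed
    have 2: "r ((i + J) mod n) \<noteq> r i" if i: "i < n" "i \<noteq> 0" "i \<noteq> J'" for i
    proof
      define y where "y = (i + J) mod n"
      have y: "y \<noteq> i" using stepJ(2)[OF i] by (simp add: y_def)
      assume "r ((i + J) mod n) = r i"
      then have "r y = r i" by (simp add: y_def)
      from req[OF this] y consider "{y, i} = {J, J'}" | "{y, i} = {i1, i2}" by blast
      then show False
      proof cases
        case 1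
        then have "y = J' \<and> i = J" using i(3) by (simp only: doubleton_eq_iff) blast
        then show False using edge3[of i] unfolding y_def by metis
      next
        case 2
        then have "y = i1 \<and> i = i2 \<or> y = i2 \<and> i = i1" by (simp only: doubleton_eq_iff)
        then show False using edgeIJ[of i1 i2] i1(1,4) i2 unfolding y_def by metis
      qed
    qed
    have ne: "I \<noteq> J" "I \<noteq> J'" "I' \<noteq> J" "I' \<noteq> J'" using IJ I' J' by linarith+
    have 3: "r I \<noteq> r J" using req[of I J] ne S unfolding doubleton_eq_iff by blast
    have 4: "r I' \<noteq> r J" using req[of I' J] ne S unfolding doubleton_eq_iff by blast
    show ?thesis unfolding J'_def[symmetric] I'_def[symmetric] using i1 rb r 1 2 3 4 by (intro exI[of _ r] exI[of _ i1]) simp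
  qed
  show ?thesis
  proof (cases "J \<noteq> J' \<and> ((J + I) mod n = J' \<or> (J' + I) mod n = J)")
    case True
    \<comment> \<open>The pair J, J' is itself an I-edge, so one identification serves both
      purposes.\<close>
    define r where "r = (\<lambda>i. if i = J' then J else i)"
    have r: "\<forall>i<n. r i < n" "r J = r J'" using J by (auto simp: r_def)
    have req: "r a = r b \<Longrightarrow> a = b \<or> {a, b} = {J, J'}" for a b unfolding r_def by (auto split: if_splits)
    have ne: "J \<noteq> I'" "J' \<noteq> I'" using IJ I' J' by linarith+
    show ?thesis
    proof (cases "(J + I) mod n = J'")
      case True
      show ?thesis by (rule glued[of J J' r]) (use True r req J ne in auto)
    next
      case False
      then have "(J' + I) mod n = J" using True by blast
      then show ?thesis by (intro glued[of J' J r]) (use r req J' ne in auto)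
    qed
  next
    case False
    \<comment> \<open>The forbidden starting points: those for which the edge i1, i1 + I meets 0, J
      or J'.\<close>
    define B where "B = {0, J, J', I', (J + I') mod n, (J' + I') mod n}"
    have "card B < n"
    proof (cases "n \<ge> 7")
      case True
      have "card B \<le> 6" unfolding B_def by (rule card6)
      then show ?thesis using True by simp
    next
      \<comment> \<open>For n = 5 and n = 6 six forbidden points could be too many; here the present
        case forces J = J', and at most four remain.\<close>
      case f7: False
      have "J = J'"
      proof (rule ccontr)
        assume "J \<noteq> J'"
        then have "(J + I) mod n \<noteq> J'" "(J' + I) mod n \<noteq> J" using False by auto
        then have *: "J + I \<noteq> J'" "J + I \<noteq> J' + n" "J' + I \<noteq> J" "J' + I \<noteq> J + n"
          using J J' by auto
        consider "n = 5" | "n = 6" using n f7 by linarith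
        then show False
        proof cases
          case 1
          then have "I = 1 \<or> I = 2 \<or> I = 3 \<or> I = 4" using I by linarith
          moreover have "J = 1 \<or> J = 2 \<or> J = 3 \<or> J = 4" using J 1 by linarith
          ultimately show False using * J'(1) IJ 1 by (elim disjE) simp_all
        next
          case 2
          have "3 * J \<noteq> 6" "3 * J \<noteq> 12" "J \<noteq> 3" using J3 2 J' \<open>J \<noteq> J'\<close> by auto
          then have "J = 1 \<or> J = 5" using J 2 by linarith
          moreover have "I = 2 \<or> I = 4" using I IJ I2 2 calculation by linarith
          ultimately show False using * J' 2 by (elim disjE) simp_all
        qed
      qed
      then have "B = {0, J, I', (J + I') mod n}" unfolding B_def by auto
      moreover have "card {0, J, I', (J + I') mod n} \<le> 4" by (rule card4)
      ultimately show ?thesis using n by simp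
    qed
    then have "\<not> {..<n} \<subseteq> B" using card_mono[of B "{..<n}"] by (auto simp: B_def)
    then obtain i1 where i1: "i1 < n" "i1 \<notin> B" by auto
    define i2 where "i2 = (i1 + I) mod n"
    have inv: "i1 = (m + I') mod n" if "i2 = m" "m < n" for m
      using that(1) step[OF i1(1) I(2)] step[OF that(2) I'(3)] i1 I I' unfolding i2_def by (elim disjE) auto
    have i1': "i1 \<noteq> 0" "i1 \<noteq> J" "i1 \<noteq> J'" "i1 \<noteq> I'" using i1 by (auto simp: B_def)
    have i2: "i2 \<noteq> J" "i2 \<noteq> J'" using inv[of J] inv[of J'] i1 J J' by (auto simp: B_def)
    define r where "r = (\<lambda>i. if i = J' then J else if i = i2 then i1 else i)"
    have "\<forall>i<n. r i < n" "r J = r J'" "r i1 = r i2" using J i1 i1' i2 by (auto simp: r_def)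
    moreover have "r a = r b \<Longrightarrow> a = b \<or> {a, b} = {J, J'} \<or> {a, b} = {i1, i2}" for a b
      unfolding r_def using i1' i2 by (auto split: if_splits)
    ultimately show ?thesis using i1 i1' i2 False by (intro glued[of i1 i2 r]) (auto simp: i2_def)
  qed
qed

section \<open>Auxiliary facts on univariate polynomials\<close>

lemma common_nonroot:
  fixes P :: "'t \<Rightarrow> 'k::field poly"
  assumes "finite T" "\<And>x. x \<in> T \<Longrightarrow> P x \<noteq> 0" "\<And>x. x \<in> T \<Longrightarrow> degree (P x) \<le> D" "card T * D < card F"
  obtains x where "x \<in> F" "\<And>y. y \<in> T \<Longrightarrow> poly (P y) x \<noteq> 0"
proof -
  have fin: "finite (\<Union>y\<in>T. {x. poly (P y) x = 0})" using assms(1,2) by (auto intro: poly_roots_finite)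
  have "card (\<Union>y\<in>T. {x. poly (P y) x = 0}) \<le> (\<Sum>y\<in>T. card {x. poly (P y) x = 0})" by (rule card_UN_le[OF assms(1)])
  also have "\<dots> \<le> (\<Sum>y\<in>T. D)"
    by (intro sum_mono) (use assms(2,3) card_poly_roots_bound order.trans in blast)
  finally have "card (\<Union>y\<in>T. {x. poly (P y) x = 0}) < card F" using assms(4) by simp
  then have "\<not> F \<subseteq> (\<Union>y\<in>T. {x. poly (P y) x = 0})" using card_mono[OF fin] by (metis not_le)
  then show thesis using that by blast
qed

lemma prod_cyclic_shift:
  fixes h :: "nat \<Rightarrow> 'b::comm_monoid_mult"
  assumes "h n = h 0"
  shows "(\<Prod>i<n. h (Suc i)) = (\<Prod>i<n. h i)"
proof (cases n)
  case (Suc m)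
  have "(\<Prod>i<n. h (Suc i)) = (\<Prod>i<m. h (Suc i)) * h n" unfolding Suc by simp
  also have "\<dots> = h 0 * (\<Prod>i<m. h (Suc i))" using assms by (simp add: mult.commute)
  also have "\<dots> = (\<Prod>i<n. h i)" unfolding Suc prod.lessThan_Suc_shift ..
  finally show ?thesis .
qed simp

lemma coeff_prod_linear:
  fixes p r :: "nat \<Rightarrow> 'k::field"
  assumes "finite S"
  shows "coeff (\<Prod>i\<in>S. [:p i, r i:]) (card S) = (\<Prod>i\<in>S. r i) \<and> degree (\<Prod>i\<in>S. [:p i, r i:]) \<le> card S"
  using assms
proof (induction S rule: finite_induct)
  case (insert a S)
  have "coeff ([:p a, r a:] * (\<Prod>i\<in>S. [:p i, r i:])) (Suc (card S)) = r a * (\<Prod>i\<in>S. r i)"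
    using insert coeff_eq_0[of "\<Prod>i\<in>S. [:p i, r i:]" "Suc (card S)"] by simp
  moreover have "degree ([:p a, r a:] * (\<Prod>i\<in>S. [:p i, r i:])) \<le> 1 + card S"
    using insert by (intro order.trans[OF degree_mult_le] add_mono) auto
  ultimately show ?case using insert by simp
qed simp

lemma dvd_cancel_no_common_root:
  fixes p r e :: "'k::alg_closed_field poly"
  assumes "p dvd r * e" "r \<noteq> 0" "\<And>x. poly r x = 0 \<Longrightarrow> poly p x \<noteq> 0"
  shows "p dvd e"
proof -
  obtain M where M: "r = smult (lead_coeff r) (\<Prod>x\<in>#M. [:-x,1:])"
    using alg_closed_imp_factorization[OF assms(2)] by blast
  define l where "l = lead_coeff r"
  have l: "l \<noteq> 0" using assms(2) by (simp add: l_def)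
  have "x \<in># M \<Longrightarrow> poly r x = 0" for x
    by (subst M) (auto simp: poly_prod_mset image_mset.compositionality o_def)
  then have nz: "x \<in># M \<Longrightarrow> poly p x \<noteq> 0" for x using assms(3) by blast
  have "p dvd smult l ((\<Prod>x\<in>#M. [:-x,1:]) * e)" using assms(1) M by (metis l_def mult_smult_left)
  then have "p dvd (\<Prod>x\<in>#M. [:-x,1:]) * e" using l by (simp add: dvd_smult_iff)
  then show ?thesis using nz
  proof (induction M arbitrary: e)
    case (add x M)
    have "p dvd (\<Prod>x\<in>#M. [:-x,1:]) * ([:-x,1:] * e)" using add.prems(1)
      by (simp add: mult_ac del: mult_pCons_left mult_pCons_right)
    then have "p dvd [:-x,1:] * e" using add.IH[of "[:-x,1:] * e"] add.prems(2) by auto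
    then obtain h where h: "[:-x,1:] * e = p * h" unfolding dvd_def by blast
    then have "poly p x * poly h x = 0" using arg_cong[OF h, of "\<lambda>p. poly p x"] unfolding poly_mult by simp
    then have "poly h x = 0" using add.prems(2) by auto
    then obtain h' where "h = [:-x,1:] * h'" by (metis poly_eq_0_iff_dvd dvdE)
    then have "[:-x,1:] * e = [:-x,1:] * (p * h')" using h by (simp only: mult_ac)
    then have "e = p * h'" by (subst (asm) mult_cancel_left) auto
    then show ?case by simp
  qed simp
qed

lemma order_factor:
  fixes E :: "'k::field poly"
  assumes "E \<noteq> 0"
  obtains o' E' where "E = [:0,1:] ^ o' * E'" "coeff E' 0 \<noteq> 0" "o' \<le> degree E"
proof -
  obtain E' where E': "E = [:- 0, 1:] ^ order 0 E * E'" "\<not> [:- 0, 1:] dvd E'"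
    using order_decomp[OF assms] by blast
  have "coeff E' 0 \<noteq> 0"
  proof
    assume "coeff E' 0 = 0"
    then have "[:0,1:] ^ 1 dvd E'" unfolding Y_power_dvd_iff by simp
    then show False using E'(2) by simp
  qed
  then show thesis using that[of "order 0 E" E'] E'(1) order_degree[OF assms, of 0] by simp
qed

text \<open>In the coordinate u = s - s0 + \<delta> t the fibre is a quadratic over the polynomials
  in t, of Eisenstein type at t = 0: q2 is a unit there, q1 is divisible by t, and q0 exactly once.
  So t is u^2 up to a unit near the point. \<open>content\<close> rules out factors depending on t
  alone.\<close>

locale quad_fibre =
  fixes n :: nat and G0 :: "'k::alg_closed_field poly \<Rightarrow> 'k poly \<Rightarrow> 'k poly" and q2 q1 q0 :: "'k poly" and s0 \<delta> :: 'k
  assumes GQ: "\<And>s t. G0 s t = pcompose q2 t * (s - [:s0:] + [:\<delta>:] * t)\<^sup>2 + pcompose q1 t * (s - [:s0:] + [:\<delta>:] * t) + pcompose q0 t"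
    and deg: "degree q2 \<le> n" "degree q1 \<le> n" "degree q0 \<le> n"
    and c2: "coeff q2 0 \<noteq> 0" and c1: "coeff q1 0 = 0" and c0: "coeff q0 0 = 0" and c01: "coeff q0 1 \<noteq> 0"
    and content: "\<And>t. poly q2 t = 0 \<Longrightarrow> poly q1 t = 0 \<Longrightarrow> poly q0 t = 0 \<Longrightarrow> False"
    and degG: "\<And>s. degree (G0 [:s:] [:0,1:]) = n"
begin

definition Rd :: "nat \<Rightarrow> ('k poly \<Rightarrow> 'k poly \<Rightarrow> 'k poly) \<Rightarrow> bool" where
  "Rd k f \<longleftrightarrow> (\<exists>E1 E0 Q. degree E1 \<le> k \<and> degree E0 \<le> k \<and>
     (\<forall>s t. f s t = pcompose E1 t * (s - [:s0:] + [:\<delta>:] * t) + pcompose E0 t + G0 s t * Q s t))"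

lemma Rd_add:
  assumes "Rd k f" "Rd k f'"
  shows "Rd k (\<lambda>s t. f s t + f' s t)"
proof -
  obtain E1 E0 Q where 1: "degree E1 \<le> k" "degree E0 \<le> k"
    "\<And>s t. f s t = pcompose E1 t * (s - [:s0:] + [:\<delta>:] * t) + pcompose E0 t + G0 s t * Q s t"
    using assms(1) unfolding Rd_def by blast
  obtain E1' E0' Q' where 2: "degree E1' \<le> k" "degree E0' \<le> k"
    "\<And>s t. f' s t = pcompose E1' t * (s - [:s0:] + [:\<delta>:] * t) + pcompose E0' t + G0 s t * Q' s t"
    using assms(2) unfolding Rd_def by blast
  have "f s t + f' s t = pcompose (E1 + E1') t * (s - [:s0:] + [:\<delta>:] * t) + pcompose (E0 + E0') t + G0 s t * (Q s t + Q' s t)" for s t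
    unfolding pcompose_add 1(3) 2(3) by (simp only: distrib_left distrib_right add_ac)
  moreover have "degree (E1 + E1') \<le> k" "degree (E0 + E0') \<le> k" using 1 2 by (auto intro: degree_add_le)
  ultimately show ?thesis unfolding Rd_def
    by (intro exI[of _ "E1 + E1'"] exI[of _ "E0 + E0'"] exI[of _ "\<lambda>s t. Q s t + Q' s t"]) blast
qed

lemma Rd_sum: "(\<And>x. x \<in> S \<Longrightarrow> Rd k (f x)) \<Longrightarrow> Rd k (\<lambda>s t. \<Sum>x\<in>S. f x s t)"
proof (induction S rule: infinite_finite_induct)
  case (insert x S)
  then show ?case using Rd_add[of k "f x"] by simp
qed (auto simp: Rd_def intro!: exI[of _ 0] exI[of _ "\<lambda>_ _. 0"])

lemma Rd_mult_t: "Rd k f \<Longrightarrow> degree r \<le> l \<Longrightarrow> Rd (k + l) (\<lambda>s t. pcompose r t * f s t)"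
  unfolding Rd_def
proof (elim exE conjE, goal_cases)
  case (1 E1 E0 Q)
  have "pcompose r t * f s t = pcompose (r * E1) t * (s - [:s0:] + [:\<delta>:] * t) + pcompose (r * E0) t + G0 s t * (pcompose r t * Q s t)" for s t
    unfolding pcompose_mult 1(4)[rule_format] by (simp only: distrib_left mult_ac)
  moreover have "degree (r * E1) \<le> k + l" "degree (r * E0) \<le> k + l"
    using 1 degree_mult_le[of r E1] degree_mult_le[of r E0] by linarith+
  ultimately show ?case by (intro exI[of _ "r * E1"] exI[of _ "r * E0"] exI[of _ "\<lambda>s t. pcompose r t * Q s t"]) blast
qed

lemma Rd_mono: "Rd k f \<Longrightarrow> k \<le> l \<Longrightarrow> Rd l f"
  unfolding Rd_def by (elim exE conjE, intro exI conjI) (assumption | rule order.trans)+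

text \<open>The quadratic has leading coefficient q2, not 1, so a power of q2 is spent for each
  power of s. A step adds n to the degree for q2, q1, q0 and 1 for writing s = u + s0 - \<delta>
  t.\<close>

lemma Rd_s_power: "Rd ((n + 1) * k) (\<lambda>s t. pcompose q2 t ^ k * s ^ k)"
proof (induction k)
  case 0
  show ?case unfolding Rd_def
    by (rule exI[of _ 0], rule exI[of _ 1], rule exI[of _ "\<lambda>_ _. 0"]) (auto simp: pcompose_1)
next
  case (Suc k)
  then obtain E1 E0 Q where E: "degree E1 \<le> (n + 1) * k" "degree E0 \<le> (n + 1) * k"
    "\<And>s t. pcompose q2 t ^ k * s ^ k = pcompose E1 t * (s - [:s0:] + [:\<delta>:] * t) + pcompose E0 t + G0 s t * Q s t"
    unfolding Rd_def by blast
  define ll where "ll = [:s0, -\<delta>:]"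
  define F1 where "F1 = (E0 + ll * E1) * q2 - E1 * q1"
  define F0 where "F0 = ll * E0 * q2 - E1 * q0"
  have dl: "degree ll \<le> 1" by (simp add: ll_def)
  have "degree (ll * E1) \<le> (n + 1) * k + 1" "degree (ll * E0) \<le> (n + 1) * k + 1"
    using degree_mult_le[of ll E1] degree_mult_le[of ll E0] dl E by auto
  then have "degree (E0 + ll * E1) \<le> (n + 1) * k + 1" "degree (ll * E0) \<le> (n + 1) * k + 1" using E by (auto intro: degree_add_le)
  then have d: "degree ((E0 + ll * E1) * q2) \<le> (n + 1) * Suc k" "degree (ll * E0 * q2) \<le> (n + 1) * Suc k"
    "degree (E1 * q1) \<le> (n + 1) * Suc k" "degree (E1 * q0) \<le> (n + 1) * Suc k"
    using degree_mult_le[of "E0 + ll * E1" q2] degree_mult_le[of "ll * E0" q2] degree_mult_le[of E1 q1] degree_mult_le[of E1 q0] deg E by auto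
  have F: "degree F1 \<le> (n + 1) * Suc k" "degree F0 \<le> (n + 1) * Suc k"
    unfolding F1_def F0_def using d by (auto intro: degree_diff_le)
  have "pcompose q2 t ^ Suc k * s ^ Suc k = pcompose F1 t * (s - [:s0:] + [:\<delta>:] * t) + pcompose F0 t
     + G0 s t * (pcompose E1 t + pcompose q2 t * s * Q s t)" for s t
  proof -
    define u where "u = s - [:s0:] + [:\<delta>:] * t"
    have lt: "pcompose ll t = [:s0:] - [:\<delta>:] * t" by (simp add: ll_def pcompose_pCons)
    have s: "s = u + pcompose ll t" unfolding lt u_def by simp
    have "pcompose q2 t ^ Suc k * s ^ Suc k = pcompose q2 t * s * (pcompose q2 t ^ k * s ^ k)" by (simp only: power_Suc mult_ac)
    also have "\<dots> = pcompose q2 t * s * (pcompose E1 t * u + pcompose E0 t) + G0 s t * (pcompose q2 t * s * Q s t)"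
      unfolding E(3) u_def[symmetric] by (simp only: algebra_simps)
    also have "pcompose q2 t * s * (pcompose E1 t * u + pcompose E0 t) = 
      pcompose E1 t * (pcompose q2 t * u\<^sup>2 + pcompose q1 t * u + pcompose q0 t) + pcompose F1 t * u + pcompose F0 t"
      unfolding s F1_def F0_def by (simp add: pcompose_add pcompose_mult pcompose_diff power2_eq_square algebra_simps)
    also have "pcompose q2 t * u\<^sup>2 + pcompose q1 t * u + pcompose q0 t = G0 s t" unfolding GQ u_def ..
    finally show ?thesis unfolding u_def by (simp only: algebra_simps)
  qed
  then show ?case unfolding Rd_def using F
    by (intro exI[of _ F1] exI[of _ F0] exI[of _ "\<lambda>s t. pcompose E1 t + pcompose q2 t * s * Q s t"]) blast
qed

definition ev :: "nat \<Rightarrow> (nat \<Rightarrow> nat \<Rightarrow> 'k) \<Rightarrow> 'k poly \<Rightarrow> 'k poly \<Rightarrow> 'k poly" where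
  "ev d e s t = (\<Sum>k\<le>d. \<Sum>i<n. [:e k i:] * (s ^ k * t ^ i))"

lemma Rd_ev: "Rd ((n + 1) * d + n) (\<lambda>s t. pcompose q2 t ^ d * ev d e s t)"
proof -
  have "Rd ((n + 1) * d + n) (\<lambda>s t. pcompose q2 t ^ d * ([:e k i:] * (s ^ k * t ^ i)))" if "k \<le> d" "i < n" for k i
  proof -
    have "degree (q2 ^ (d - k) * monom (e k i) i) \<le> n * (d - k) + i"
    proof -
      have "degree (q2 ^ (d - k)) \<le> degree q2 * (d - k)" by (rule degree_power_le)
      also have "\<dots> \<le> n * (d - k)" using deg by simp
      finally show ?thesis using degree_mult_le[of "q2 ^ (d - k)" "monom (e k i) i"] degree_monom_le[of "e k i" i] by linarith
    qed
    from Rd_mult_t[OF Rd_s_power this, of k]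
    have h1: "Rd ((n + 1) * k + (n * (d - k) + i)) (\<lambda>s t. pcompose (q2 ^ (d - k) * monom (e k i) i) t * (pcompose q2 t ^ k * s ^ k))" .
    have h2: "(\<lambda>s t. pcompose (q2 ^ (d - k) * monom (e k i) i) t * (pcompose q2 t ^ k * s ^ k)) = (\<lambda>s t. pcompose q2 t ^ d * ([:e k i:] * (s ^ k * t ^ i)))"
    proof (intro ext)
      fix s t
      have m: "pcompose (monom (e k i) i) t = [:e k i:] * t ^ i" by (simp add: monom_altdef pcompose_smult pcompose_pow pcompose_pCons)
      have "pcompose q2 t ^ d = pcompose q2 t ^ (d - k) * pcompose q2 t ^ k" using that by (simp flip: power_add)
      then show "pcompose (q2 ^ (d - k) * monom (e k i) i) t * (pcompose q2 t ^ k * s ^ k) = pcompose q2 t ^ d * ([:e k i:] * (s ^ k * t ^ i))"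
        unfolding pcompose_mult pcompose_pow m by (simp only: mult_ac)
    qed
    have h3: "(n + 1) * k + (n * (d - k) + i) \<le> (n + 1) * d + n"
    proof -
      have "n * (d - k) + n * k = n * d" using that by (simp flip: distrib_left)
      then show ?thesis using that by (simp only: distrib_right mult_1)
    qed
    show ?thesis by (rule Rd_mono[OF h1[unfolded h2] h3])
  qed
  then have "Rd ((n + 1) * d + n) (\<lambda>s t. \<Sum>k\<in>{..d}. \<Sum>i\<in>{..<n}. pcompose q2 t ^ d * ([:e k i:] * (s ^ k * t ^ i)))"
    by (intro Rd_sum) blast
  then show ?thesis unfolding ev_def sum_distrib_left .
qed

text \<open>The branch is ramified, so even and odd orders in \<open>Y\<close> separate the two parts of a reduced form \<open>E1(t) u + E0(t)\<close>.\<close>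

lemma \<tau>_order:
  assumes "coeff \<tau> 0 = 0" "[:0,1:] ^ N dvd G0 [:s0,1:] \<tau>" "N \<ge> 3"
  obtains u where "\<tau> = [:0,1:]\<^sup>2 * u" "coeff u 0 \<noteq> 0"
proof -
  let ?Y = "[:0,1::'k:]"
  obtain \<tau>1 where t1: "\<tau> = ?Y * \<tau>1" using assms(1) Y_power_dvd_iff[of 1 \<tau>] unfolding dvd_def by auto
  obtain r0 where r0: "q0 = ?Y * r0" using c0 Y_power_dvd_iff[of 1 q0] unfolding dvd_def by auto
  obtain r1 where r1: "q1 = ?Y * r1" using c1 Y_power_dvd_iff[of 1 q1] unfolding dvd_def by auto
  have r00: "coeff r0 0 \<noteq> 0" using c01 unfolding r0 by simp
  define v1 where "v1 = 1 + [:\<delta>:] * \<tau>1"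
  have v: "[:s0,1:] - [:s0:] + [:\<delta>:] * \<tau> = ?Y * v1" unfolding v1_def t1 by (simp add: algebra_simps)
  have G: "G0 [:s0,1:] \<tau> = ?Y * (?Y * (pcompose q2 \<tau> * v1\<^sup>2) + ?Y * (\<tau>1 * pcompose r1 \<tau> * v1) + \<tau>1 * pcompose r0 \<tau>)"
  proof -
    have "pcompose q1 \<tau> = \<tau> * pcompose r1 \<tau>" "pcompose q0 \<tau> = \<tau> * pcompose r0 \<tau>"
      unfolding r0 r1 pcompose_mult by (simp_all add: pcompose_pCons)
    then have "G0 [:s0,1:] \<tau> = pcompose q2 \<tau> * (?Y * v1)\<^sup>2 + (?Y * \<tau>1) * pcompose r1 \<tau> * (?Y * v1) + (?Y * \<tau>1) * pcompose r0 \<tau>"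
      unfolding GQ v t1[symmetric] by simp
    then show ?thesis by (simp only: power2_eq_square algebra_simps)
  qed
  have "?Y ^ 2 dvd G0 [:s0,1:] \<tau>" using assms(2) by (rule power_le_dvd) (use assms(3) in simp)
  then have "?Y ^ 1 dvd (?Y * (pcompose q2 \<tau> * v1\<^sup>2) + ?Y * (\<tau>1 * pcompose r1 \<tau> * v1) + \<tau>1 * pcompose r0 \<tau>)"
    unfolding G power2_eq_square power_one_right by (subst (asm) dvd_times_left_cancel_iff) auto
  then have "coeff (?Y * (pcompose q2 \<tau> * v1\<^sup>2) + ?Y * (\<tau>1 * pcompose r1 \<tau> * v1) + \<tau>1 * pcompose r0 \<tau>) 0 = 0"
    unfolding Y_power_dvd_iff by simp
  then have "coeff (\<tau>1 * pcompose r0 \<tau>) 0 = 0" by (simp add: coeff_mult_0)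
  moreover have pr0: "coeff (pcompose r0 \<tau>) 0 = coeff r0 0" using assms(1) by (simp add: coeff_pcompose_0 poly_0_coeff_0)
  ultimately have "coeff \<tau>1 0 = 0" using r00 by (simp add: coeff_mult_0)
  then obtain u where u: "\<tau>1 = ?Y * u" using Y_power_dvd_iff[of 1 \<tau>1] unfolding dvd_def by auto
  have G2: "G0 [:s0,1:] \<tau> = ?Y ^ 2 * (pcompose q2 \<tau> * v1\<^sup>2 + \<tau>1 * pcompose r1 \<tau> * v1 + u * pcompose r0 \<tau>)"
  proof -
    have "G0 [:s0,1:] \<tau> = ?Y * (?Y * (pcompose q2 \<tau> * v1\<^sup>2) + ?Y * (\<tau>1 * pcompose r1 \<tau> * v1) + (?Y * u) * pcompose r0 \<tau>)"
      using G unfolding u[symmetric] .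
    then show ?thesis by (simp only: power2_eq_square algebra_simps)
  qed
  have "?Y ^ 2 * ?Y dvd G0 [:s0,1:] \<tau>"
  proof -
    have "?Y ^ 3 dvd G0 [:s0,1:] \<tau>" using assms(2,3) by (rule power_le_dvd)
    then show ?thesis by (simp only: power2_eq_square power3_eq_cube)
  qed
  then have "?Y ^ 1 dvd (pcompose q2 \<tau> * v1\<^sup>2 + \<tau>1 * pcompose r1 \<tau> * v1 + u * pcompose r0 \<tau>)"
    unfolding G2 power_one_right by (subst (asm) dvd_times_left_cancel_iff) auto
  then have "coeff (pcompose q2 \<tau> * v1\<^sup>2 + \<tau>1 * pcompose r1 \<tau> * v1 + u * pcompose r0 \<tau>) 0 = 0"
    unfolding Y_power_dvd_iff by simp
  moreover have "coeff (pcompose q2 \<tau>) 0 = coeff q2 0" using assms(1) by (simp add: coeff_pcompose_0 poly_0_coeff_0)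
  moreover have "coeff v1 0 = 1" unfolding v1_def using \<open>coeff \<tau>1 0 = 0\<close> by simp
  ultimately have "coeff q2 0 + coeff u 0 * coeff r0 0 = 0" using \<open>coeff \<tau>1 0 = 0\<close> pr0
    by (simp add: coeff_mult_0 coeff_0_power)
  then have "coeff u 0 \<noteq> 0" using c2 by auto
  moreover have "\<tau> = ?Y\<^sup>2 * u" unfolding t1 u by (simp only: power2_eq_square mult.assoc)
  ultimately show thesis using that by blast
qed

text \<open>Gauss's lemma by specialisation: for all but finitely many s, G0(s, t) as a polynomial
  in t has no root in common with q2, so it divides the specialised \<open>ev\<close>, whose degree
  is below n. Hence \<open>ev\<close> vanishes for infinitely many s.\<close>

lemma ev_zero:
  assumes "\<And>s t. pcompose q2 t ^ d * ev d e s t = G0 s t * Q s t" "k \<le> d" "i < n"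
  shows "e k i = 0"
proof -
  have q2nz: "q2 \<noteq> 0" using c2 by auto
  define T where "T = {t. poly q2 t = 0}"
  have "finite T" unfolding T_def using q2nz by (rule poly_roots_finite)
  \<comment> \<open>The values of s for which G0 and q2 have a common root t. Where q1 vanishes too,
    the quotient is 0 by convention; by \<open>content\<close> no s at all is critical for such a
    t.\<close>
  define S where "S = (\<lambda>t. s0 - \<delta> * t - poly q0 t / poly q1 t) ` T"
  have "finite S" unfolding S_def using \<open>finite T\<close> by simp
  define f where "f = (\<Sum>k\<le>d. monom (e k i) k)"
  have "poly f s = 0" if sS: "s \<notin> S" for s
  proof -
    define p where "p = G0 [:s:] [:0,1:]"
    have pP: "poly p t = poly q2 t * (s - s0 + \<delta> * t)\<^sup>2 + poly q1 t * (s - s0 + \<delta> * t) + poly q0 t" for t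
      unfolding p_def GQ by (simp add: algebra_simps)
    define es where "es = (\<Sum>i<n. monom (\<Sum>k\<le>d. e k i * s ^ k) i)"
    have ees: "ev d e [:s:] [:0,1:] = es"
    proof -
      have "ev d e [:s:] [:0,1:] = (\<Sum>k\<le>d. \<Sum>i<n. monom (e k i * s ^ k) i)"
        unfolding ev_def by (intro sum.cong refl) (simp add: monom_altdef poly_const_pow mult.commute)
      also have "\<dots> = (\<Sum>i<n. \<Sum>k\<le>d. monom (e k i * s ^ k) i)" by (rule sum.swap)
      also have "\<dots> = es" unfolding es_def
      proof (rule sum.cong[OF refl])
        fix i
        show "(\<Sum>k\<le>d. monom (e k i * s ^ k) i) = monom (\<Sum>k\<le>d. e k i * s ^ k) i"
          by (induction d) (auto simp: add_monom)
      qed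
      finally show ?thesis .
    qed
    have "p dvd q2 ^ d * es"
      using assms(1)[of "[:0,1:]" "[:s:]"] unfolding ees p_def by (simp add: pcompose_idR)
    moreover have "poly p x \<noteq> 0" if x: "poly (q2 ^ d) x = 0" for x
    proof
      assume p0: "poly p x = 0"
      have x2: "poly q2 x = 0" using x by (simp add: poly_power)
      then have eq: "poly q1 x * (s - s0 + \<delta> * x) + poly q0 x = 0" using p0 pP[of x] by simp
      have "poly q1 x \<noteq> 0" using content[OF x2] eq by auto
      then have "s = s0 - \<delta> * x - poly q0 x / poly q1 x" using eq by (simp add: field_simps eq_neg_iff_add_eq_0)
      then show False using sS x2 unfolding S_def T_def by blast
    qed
    ultimately have pe: "p dvd es" using q2nz by (intro dvd_cancel_no_common_root[of p "q2 ^ d" es]) auto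
    have "es = 0"
    proof (rule ccontr)
      assume "es \<noteq> 0"
      then have "degree p \<le> degree es" using pe by (rule dvd_imp_degree_le[rotated])
      moreover have "degree es < n" unfolding es_def using assms(3)
        by (intro degree_sum_less) (auto intro: le_less_trans[OF degree_monom_le])
      ultimately show False using degG unfolding p_def by simp
    qed
    then have "coeff es i = 0" by simp
    then show "poly f s = 0" unfolding es_def f_def using assms(3) by (simp add: coeff_sum poly_sum poly_monom)
  qed
  then have "UNIV \<subseteq> S \<union> {s. poly f s = 0}" by auto
  then have "infinite {s. poly f s = 0}" using infinite_alg_closed[where 'k='k] \<open>finite S\<close> by (meson finite_UnI finite_subset)
  then have "f = 0" using poly_roots_finite by blast
  then have "coeff f k = 0" by simp
  then show ?thesis unfolding f_def using assms(2) by (simp add: coeff_sum)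
qed

text \<open>Multiplying by q2^d and reducing leaves polynomials of degree at most (n + 1) d + n.
  Substituting \<tau>, which has order 2, doubles orders, and u adds 1, so a nonzero result has
  order at most 2 (n + 1) (d + 1) - 1.\<close>

theorem irr:
  assumes e: "\<exists>k\<le>d. \<exists>i<n. e k i \<noteq> 0" and \<tau>: "coeff \<tau> 0 = 0" and N: "2 * (n + 1) * (d + 1) < N"
    and G: "[:0,1:] ^ N dvd G0 [:s0,1:] \<tau>"
  shows "\<not> [:0,1:] ^ Suc (2 * (n + 1) * (d + 1)) dvd (\<Sum>k\<le>d. \<Sum>i<n. [:e k i:] * ([:s0,1:] ^ k * \<tau> ^ i))"
proof
  let ?Y = "[:0,1::'k:]"
  define M where "M = Suc (2 * (n + 1) * (d + 1))"
  assume "?Y ^ Suc (2 * (n + 1) * (d + 1)) dvd (\<Sum>k\<le>d. \<Sum>i<n. [:e k i:] * ([:s0,1:] ^ k * \<tau> ^ i))"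
  then have dv: "?Y ^ M dvd ev d e [:s0,1:] \<tau>" unfolding M_def ev_def .
  have MN: "M \<le> N" using N by (simp add: M_def)
  have "N \<ge> 3" using N by (auto simp: algebra_simps)
  obtain u where u: "\<tau> = ?Y\<^sup>2 * u" "coeff u 0 \<noteq> 0" using \<tau>_order[OF \<tau> G \<open>N \<ge> 3\<close>] .
  obtain E1 E0 Q where E: "degree E1 \<le> (n + 1) * d + n" "degree E0 \<le> (n + 1) * d + n"
    "\<And>s t. pcompose q2 t ^ d * ev d e s t = pcompose E1 t * (s - [:s0:] + [:\<delta>:] * t) + pcompose E0 t + G0 s t * Q s t"
    using Rd_ev[of d e] unfolding Rd_def by blast
  define v1 where "v1 = 1 + [:\<delta>:] * (?Y * u)"
  have v: "[:s0,1:] - [:s0:] + [:\<delta>:] * \<tau> = ?Y * v1" unfolding v1_def u(1) by (simp add: algebra_simps power2_eq_square)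
  have v10: "coeff v1 0 \<noteq> 0" unfolding v1_def by simp
  have comp: "\<exists>w. pcompose E \<tau> = ?Y ^ (2 * o') * w \<and> coeff w 0 \<noteq> 0" if "E = ?Y ^ o' * E'" "coeff E' 0 \<noteq> 0" for E E' o'
  proof -
    have "pcompose E \<tau> = \<tau> ^ o' * pcompose E' \<tau>" unfolding that(1) pcompose_mult pcompose_pow by (simp add: pcompose_pCons)
    also have "\<dots> = ?Y ^ (2 * o') * (u ^ o' * pcompose E' \<tau>)" unfolding u(1) by (simp only: power_mult_distrib power_mult mult.assoc)
    finally have e: "pcompose E \<tau> = ?Y ^ (2 * o') * (u ^ o' * pcompose E' \<tau>)" .
    have "coeff (u ^ o' * pcompose E' \<tau>) 0 \<noteq> 0" using u(2) that(2) \<tau>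
      by (simp add: coeff_mult_0 coeff_0_power coeff_pcompose_0 poly_0_coeff_0)
    then show ?thesis using e by blast
  qed
  have sum: "?Y ^ M dvd pcompose E1 \<tau> * (?Y * v1) + pcompose E0 \<tau>"
  proof -
    have "pcompose E1 \<tau> * (?Y * v1) + pcompose E0 \<tau> = pcompose q2 \<tau> ^ d * ev d e [:s0,1:] \<tau> - G0 [:s0,1:] \<tau> * Q [:s0,1:] \<tau>"
      unfolding E(3) v by simp
    moreover have "?Y ^ M dvd G0 [:s0,1:] \<tau>" using G MN by (rule power_le_dvd)
    ultimately show ?thesis using dv by (metis dvd_diff dvd_mult dvd_mult2)
  qed
  have small: "2 * o' + 1 < M" if "o' \<le> (n + 1) * d + n" for o' using that by (simp add: M_def algebra_simps)
  have cf: "coeff (?Y ^ j * w) j = coeff w 0" "i < j \<Longrightarrow> coeff (?Y ^ j * w) i = 0" for j w i by (auto simp: Y_power_mult_coeff)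
  have E10: "E1 = 0 \<and> E0 = 0"
  proof (rule ccontr)
    assume ne: "\<not> (E1 = 0 \<and> E0 = 0)"
    have X1: "\<exists>j w. pcompose E1 \<tau> * (?Y * v1) = ?Y ^ (2 * j + 1) * w \<and> coeff w 0 \<noteq> 0 \<and> 2 * j + 1 < M" if "E1 \<noteq> 0"
    proof -
      obtain o' E' where o: "E1 = ?Y ^ o' * E'" "coeff E' 0 \<noteq> 0" "o' \<le> degree E1" using order_factor[OF \<open>E1 \<noteq> 0\<close>] .
      obtain w where w: "pcompose E1 \<tau> = ?Y ^ (2 * o') * w" "coeff w 0 \<noteq> 0" using comp[OF o(1,2)] by blast
      have "pcompose E1 \<tau> * (?Y * v1) = ?Y ^ (2 * o' + 1) * (w * v1)" unfolding w(1) power_add power_one_right by (simp only: mult_ac)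
      moreover have "coeff (w * v1) 0 \<noteq> 0" using w v10 by (simp add: coeff_mult_0)
      ultimately show ?thesis using small[of o'] o E(1) by (metis le_trans)
    qed
    have X0: "\<exists>j w. pcompose E0 \<tau> = ?Y ^ (2 * j) * w \<and> coeff w 0 \<noteq> 0 \<and> 2 * j + 1 < M" if "E0 \<noteq> 0"
    proof -
      obtain o' E' where o: "E0 = ?Y ^ o' * E'" "coeff E' 0 \<noteq> 0" "o' \<le> degree E0" using order_factor[OF \<open>E0 \<noteq> 0\<close>] .
      obtain w where w: "pcompose E0 \<tau> = ?Y ^ (2 * o') * w" "coeff w 0 \<noteq> 0" using comp[OF o(1,2)] by blast
      then show ?thesis using small[of o'] o E(2) by (metis le_trans)
    qed
    have z: "coeff (pcompose E1 \<tau> * (?Y * v1) + pcompose E0 \<tau>) i = 0" if "i < M" for i using sum that unfolding Y_power_dvd_iff by blast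
    consider "E1 \<noteq> 0" "E0 = 0" | "E1 = 0" "E0 \<noteq> 0" | "E1 \<noteq> 0" "E0 \<noteq> 0" using ne by blast
    then show False
    proof cases
      case 1
      obtain j w where j: "pcompose E1 \<tau> * (?Y * v1) = ?Y ^ (2 * j + 1) * w" "coeff w 0 \<noteq> 0" "2 * j + 1 < M" using X1[OF 1(1)] by blast
      then show False using z[OF j(3)] 1(2) cf(1)[of "2 * j + 1" w] by simp
    next
      case 2
      obtain j w where j: "pcompose E0 \<tau> = ?Y ^ (2 * j) * w" "coeff w 0 \<noteq> 0" "2 * j + 1 < M" using X0[OF 2(2)] by blast
      then show False using z[of "2 * j"] 2(1) cf(1)[of "2 * j" w] by simp
    next
      case 3
      obtain j w where j: "pcompose E1 \<tau> * (?Y * v1) = ?Y ^ (2 * j + 1) * w" "coeff w 0 \<noteq> 0" "2 * j + 1 < M" using X1[OF 3(1)] by blast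
      obtain l x where l: "pcompose E0 \<tau> = ?Y ^ (2 * l) * x" "coeff x 0 \<noteq> 0" "2 * l + 1 < M" using X0[OF 3(2)] by blast
      show False
      proof (cases "2 * j + 1 < 2 * l")
        case True
        then show False using z[OF j(3)] j(2) unfolding j(1) l(1) coeff_add cf(1) cf(2)[OF True] by simp
      next
        case False
        then have lt: "2 * l < 2 * j + 1" by presburger
        show False using z[of "2 * l"] l(2,3) unfolding j(1) l(1) coeff_add cf(1) cf(2)[OF lt] by simp
      qed
    qed
  qed
  then have "pcompose q2 t ^ d * ev d e s t = G0 s t * Q s t" for s t using E(3)[of t s] by simp
  from ev_zero[OF this] show False using e by blast
qed

end

section \<open>The surface of the norm equation\<close>

locale norm_curve =
  fixes q n I J :: nat and K F :: "'k::alg_closed_field set" and c :: 'k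
  assumes frobp: "\<And>x y :: 'k poly. (x + y) ^ q = x ^ q + y ^ q"
    and n5: "n \<ge> 5" and qbig: "q \<ge> 600 * n ^ 7"
    and K: "K = {x. x ^ q = x}" and cardK: "card K = q"
    and F: "F = {x. x ^ (q ^ n) = x}" and cardF: "card F = q ^ n"
    and I: "0 < I" "I < n" and J: "0 < J" "J < n" and IJ: "I \<noteq> J" "I + J \<noteq> n"
    and I2: "2 * I \<noteq> n" and J3: "3 * J \<noteq> n" "3 * J \<noteq> 2 * n"
    and c: "c \<in> K" "c \<noteq> 0"
    and empt: "\<And>z. z \<in> F \<Longrightarrow> (\<Prod>i<n. z ^ (q ^ (i + I)) - z ^ (q ^ i)) = c * (\<Prod>i<n. z ^ (q ^ (i + J)) - z ^ (q ^ i)) \<Longrightarrow> z \<in> K"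
begin

section \<open>Frobenius on K and F inside the closure\<close>

lemma q_bounds: "q > n ^ 5" "q \<ge> 2"
proof -
  have "n ^ 5 \<ge> 5 ^ 5" using n5 by (intro power_mono) auto
  then have *: "n ^ 5 \<ge> 3125" by simp
  have "n ^ 5 \<le> n ^ 7" using n5 by (intro power_increasing) auto
  then show "q > n ^ 5" "q \<ge> 2" using qbig * by linarith+
qed

lemma frob: "(x + y) ^ q = x ^ q + y ^ q" for x y :: 'k
proof -
  have "[:(x + y) ^ q:] = [:x ^ q + y ^ q:]" using frobp[of "[:x:]" "[:y:]"] by (simp add: poly_const_pow)
  then show ?thesis by simp
qed

lemma frob_iterate: "(x + y) ^ (q ^ i) = x ^ (q ^ i) + y ^ (q ^ i)" for x y :: 'k
proof (induction i)
  case (Suc i)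
  have "z ^ (q ^ Suc i) = (z ^ (q ^ i)) ^ q" for z :: 'k by (simp only: power_mult[symmetric] power_Suc mult.commute)
  then show ?case using Suc frob by simp
qed simp

lemma zero_pow [simp]: "(0::'k) ^ (q ^ i) = 0" using q_bounds by simp

lemma frob_diff: "(x - y) ^ (q ^ i) = x ^ (q ^ i) - y ^ (q ^ i)" for x y :: 'k
  using frob_iterate[of "x - y" y i] by simp

lemma frob_sum: "(\<Sum>k\<in>S. f k :: 'k) ^ (q ^ i) = (\<Sum>k\<in>S. f k ^ (q ^ i))"
  by (induction S rule: infinite_finite_induct) (auto simp: frob_iterate)

lemma F_per: "z \<in> F \<Longrightarrow> z ^ (q ^ (i + n)) = z ^ (q ^ i)"
proof -
  have "z ^ (q ^ (i + n)) = (z ^ (q ^ n)) ^ (q ^ i)" by (simp only: power_mult[symmetric] power_add mult.commute)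
  then show "z \<in> F \<Longrightarrow> z ^ (q ^ (i + n)) = z ^ (q ^ i)" unfolding F by simp
qed

lemma F_pow: "z \<in> F \<Longrightarrow> z ^ m \<in> F"
proof -
  have "(z ^ m) ^ (q ^ n) = (z ^ (q ^ n)) ^ m" by (simp only: power_mult[symmetric] mult.commute)
  then show "z \<in> F \<Longrightarrow> z ^ m \<in> F" unfolding F by simp
qed

lemma F_diff: "x \<in> F \<Longrightarrow> y \<in> F \<Longrightarrow> x - y \<in> F"
  unfolding F by (simp add: frob_diff)

lemma F_add: "x \<in> F \<Longrightarrow> y \<in> F \<Longrightarrow> x + y \<in> F"
  unfolding F by (simp add: frob_iterate)

lemma F_mult: "x \<in> F \<Longrightarrow> y \<in> F \<Longrightarrow> x * y \<in> F"
  unfolding F by (simp add: power_mult_distrib)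

lemma F_0: "0 \<in> F" unfolding F by simp

lemma F_sum: "(\<And>k. k \<in> S \<Longrightarrow> f k \<in> F) \<Longrightarrow> sum f S \<in> F"
  by (induction S rule: infinite_finite_induct) (auto intro: F_add F_0)

lemma K_pow: "x \<in> K \<Longrightarrow> x ^ (q ^ i) = x"
  unfolding K by (induction i) (auto simp: power_mult)

lemma q_pow_inj: "q ^ a = q ^ b \<longleftrightarrow> a = b"
  using q_bounds(2) by simp

lemma card_Int_quadruples: "card (S \<inter> {..<n} \<times> {..<n} \<times> {..<n} \<times> {..<n}) \<le> n ^ 4"
proof -
  have "card (S \<inter> {..<n} \<times> {..<n} \<times> {..<n} \<times> {..<n}) \<le> card ({..<n} \<times> {..<n} \<times> {..<n} \<times> {..<n})"
    by (intro card_mono) auto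
  then show ?thesis by (simp add: card_cartesian_product power4_eq_xxxx mult.assoc)
qed

text \<open>Fewer than q quadruples have to be avoided, each given by a nonzero polynomial of degree
  at most q^(n-1), while F has q^n elements. The case a' = b' is included and gives the distinctness
  of the conjugates.\<close>

lemma ex_generic_element:
  obtains e where "e \<in> F"
    "\<And>a b a' b'. a < n \<Longrightarrow> b < n \<Longrightarrow> a' < n \<Longrightarrow> b' < n \<Longrightarrow> a \<noteq> b \<Longrightarrow> {a,b} \<noteq> {a',b'}
       \<Longrightarrow> e ^ (q ^ a) - e ^ (q ^ b) \<noteq> e ^ (q ^ a') - e ^ (q ^ b')"
proof -
  define T where "T = {(a,b,a',b'). a \<noteq> b \<and> {a,b} \<noteq> {a',b'}} \<inter> {..<n} \<times> {..<n} \<times> {..<n} \<times> {..<n}"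
  define P where "P = (\<lambda>(a,b,a',b'). monom 1 (q ^ a) - monom 1 (q ^ b) - monom 1 (q ^ a') + monom (1::'k) (q ^ b'))"
  have fin: "finite T" unfolding T_def by simp
  have nz: "P x \<noteq> 0" if "x \<in> T" for x
  proof -
    obtain a b a' b' where x: "x = (a,b,a',b')" by (metis prod.exhaust)
    have h: "a \<noteq> b" "{a,b} \<noteq> {a',b'}" using that unfolding T_def x by auto
    show ?thesis
    proof (cases "a = a' \<or> a = b'")
      case False
      then have "coeff (P x) (q ^ a) = 1" using h unfolding P_def x by (auto simp: q_pow_inj)
      then show ?thesis by auto
    next
      case True
      then have "b \<noteq> a'" "b \<noteq> b'" using h by auto
      then have "coeff (P x) (q ^ b) = - 1" using h unfolding P_def x by (auto simp: q_pow_inj)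
      then show ?thesis by auto
    qed
  qed
  have deg: "degree (P x) \<le> q ^ (n - 1)" if "x \<in> T" for x
  proof -
    obtain a b a' b' where x: "x = (a,b,a',b')" by (metis prod.exhaust)
    have "a \<le> n - 1" "b \<le> n - 1" "a' \<le> n - 1" "b' \<le> n - 1" using that unfolding T_def x by auto
    then have "q ^ a \<le> q ^ (n - 1)" "q ^ b \<le> q ^ (n - 1)" "q ^ a' \<le> q ^ (n - 1)" "q ^ b' \<le> q ^ (n - 1)"
      using q_bounds(2) by (auto intro: power_increasing)
    then show ?thesis unfolding P_def x
      by (auto intro!: degree_add_le degree_diff_le order.trans[OF degree_monom_le])
  qed
  have "n ^ 4 < q"
  proof -
    have "n ^ 4 \<le> n ^ 5" using n5 by (intro power_increasing) auto
    then show ?thesis using q_bounds by linarith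
  qed
  then have "card T < q" using card_Int_quadruples unfolding T_def by (meson le_less_trans)
  then have "card T * q ^ (n - 1) < q * q ^ (n - 1)" using q_bounds(2) by simp
  also have "\<dots> = card F" unfolding cardF using n5 by (cases n) auto
  finally have "card T * q ^ (n - 1) < card F" .
  from common_nonroot[of T P, OF fin nz deg this] obtain e where e: "e \<in> F" "\<And>y. y \<in> T \<Longrightarrow> poly (P y) e \<noteq> 0" by blast
  show thesis
  proof (rule that[OF e(1)])
    fix a b a' b' assume *: "a < n" "b < n" "a' < n" "b' < n" "a \<noteq> b" "{a,b} \<noteq> {a',b'}"
    then have "(a,b,a',b') \<in> T" by (auto simp: T_def)
    from e(2)[OF this] show "e ^ (q ^ a) - e ^ (q ^ b) \<noteq> e ^ (q ^ a') - e ^ (q ^ b')"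
      by (auto simp: P_def poly_monom)
  qed
qed

text \<open>On the special fibre a conjugate of nonzero index is A_i + e_i t with A_i = \<theta> ^ r
  i, and an edge {a, b} collapses at t = - (A_a - A_b) / (e_a - e_b). The condition says that two
  edges never collapse at the same t, except both at t = 0 through coinciding exponents. Genericity
  of \<open>e\<close> keeps the polynomials in \<theta> nonzero.\<close>

lemma ex_generic_values:
  fixes r :: "nat \<Rightarrow> nat" and e :: 'k
  assumes r: "\<And>i. i < n \<Longrightarrow> r i < n"
    and sid: "\<And>a b a' b'. a < n \<Longrightarrow> b < n \<Longrightarrow> a' < n \<Longrightarrow> b' < n \<Longrightarrow> a \<noteq> b \<Longrightarrow> {a,b} \<noteq> {a',b'}
       \<Longrightarrow> e ^ (q ^ a) - e ^ (q ^ b) \<noteq> e ^ (q ^ a') - e ^ (q ^ b')"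
  obtains \<theta> where "\<theta> \<in> F"
    "\<And>a b a' b'. a < n \<Longrightarrow> b < n \<Longrightarrow> a' < n \<Longrightarrow> b' < n \<Longrightarrow> a \<noteq> b \<Longrightarrow> a' \<noteq> b' \<Longrightarrow> {a,b} \<noteq> {a',b'} \<Longrightarrow> r a \<noteq> r b \<or> r a' \<noteq> r b'
       \<Longrightarrow> (\<theta> ^ r a - \<theta> ^ r b) * (e ^ (q ^ a') - e ^ (q ^ b')) \<noteq> (\<theta> ^ r a' - \<theta> ^ r b') * (e ^ (q ^ a) - e ^ (q ^ b))"
proof -
  define T where "T = {(a,b,a',b'). a \<noteq> b \<and> a' \<noteq> b' \<and> {a,b} \<noteq> {a',b'} \<and> (r a \<noteq> r b \<or> r a' \<noteq> r b')} \<inter> {..<n} \<times> {..<n} \<times> {..<n} \<times> {..<n}"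
  define P where "P = (\<lambda>(a,b,a',b'). smult (e ^ (q ^ a') - e ^ (q ^ b')) (monom 1 (r a) - monom 1 (r b))
      - smult (e ^ (q ^ a) - e ^ (q ^ b)) (monom 1 (r a') - monom 1 (r b')))"
  have fin: "finite T" unfolding T_def by simp
  have nz: "P x \<noteq> 0" if "x \<in> T" for x
  proof -
    obtain a b a' b' where x: "x = (a,b,a',b')" by (metis prod.exhaust)
    have h: "a \<noteq> b" "a' \<noteq> b'" "{a,b} \<noteq> {a',b'}" "r a \<noteq> r b \<or> r a' \<noteq> r b'" and l: "a < n" "b < n" "a' < n" "b' < n"
      using that unfolding T_def x by auto
    define u w where "u = e ^ (q ^ a) - e ^ (q ^ b)" and "w = e ^ (q ^ a') - e ^ (q ^ b')"
    have u: "u \<noteq> 0" using sid[OF l(1,2) l(1) l(1) h(1)] h by (auto simp: u_def)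
    have w: "w \<noteq> 0" using sid[OF l(3,4) l(3) l(3) h(2)] h by (auto simp: w_def)
    have uw: "w - u \<noteq> 0" using sid[OF l(1-4) h(1,3)] by (auto simp: u_def w_def)
    have "{b,a} \<noteq> {a',b'}" using h(3) by auto
    from sid[OF l(2,1,3,4) h(1)[symmetric] this] have uw': "w + u \<noteq> 0" unfolding u_def w_def by (auto simp: algebra_simps)
    have P: "P x = smult w (monom 1 (r a) - monom 1 (r b)) - smult u (monom 1 (r a') - monom 1 (r b'))"
      unfolding P_def x u_def w_def by simp
    consider "r a = r b" | "r a \<noteq> r b" "r a \<noteq> r a'" "r a \<noteq> r b'" | "r a \<noteq> r b" "r b \<noteq> r a'" "r b \<noteq> r b'"
      | "r a \<noteq> r b" "r a' = r b'" "r a = r a'"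
      | "r a \<noteq> r b" "r a = r a'" "r b = r b'" | "r a \<noteq> r b" "r a = r b'" "r b = r a'" by metis
    then show ?thesis
    proof cases
      case 1
      then have "coeff (P x) (r a') = - u" using h(4) unfolding P by auto
      then show ?thesis using u by auto
    next
      case 2
      then have "coeff (P x) (r a) = w" unfolding P by auto
      then show ?thesis using w by auto
    next
      case 3
      then have "coeff (P x) (r b) = - w" unfolding P by auto
      then show ?thesis using w by auto
    next
      case 4
      then have "coeff (P x) (r a) = w" unfolding P by auto
      then show ?thesis using w by auto
    next
      case 5
      then have "coeff (P x) (r a) = w - u" unfolding P by auto
      then show ?thesis using uw by auto
    next
      case 6
      then have "coeff (P x) (r a) = w + u" unfolding P by auto
      then show ?thesis using uw' by auto
    qed
  qed
  have deg: "degree (P x) \<le> n" if "x \<in> T" for x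
  proof -
    obtain a b a' b' where x: "x = (a,b,a',b')" by (metis prod.exhaust)
    have "r a \<le> n" "r b \<le> n" "r a' \<le> n" "r b' \<le> n" using that r unfolding T_def x by (auto simp: less_imp_le)
    then show ?thesis unfolding P_def x
      by (auto intro!: degree_diff_le order.trans[OF degree_smult_le] order.trans[OF degree_monom_le])
  qed
  have "card T * n \<le> n ^ 4 * n" using card_Int_quadruples unfolding T_def by (intro mult_le_mono1)
  also have "n ^ 4 * n = n ^ 5" by (simp add: eval_nat_numeral)
  also have "n ^ 5 < q ^ 1" using q_bounds by simp
  also have "q ^ 1 \<le> q ^ n" using q_bounds(2) n5 by (intro power_increasing) auto
  finally have "card T * n < card F" unfolding cardF .
  from common_nonroot[of T P, OF fin nz deg this] obtain \<theta> where t: "\<theta> \<in> F" "\<And>y. y \<in> T \<Longrightarrow> poly (P y) \<theta> \<noteq> 0" by blast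
  show thesis
  proof (rule that[OF t(1)])
    fix a b a' b' assume *: "a < n" "b < n" "a' < n" "b' < n" "a \<noteq> b" "a' \<noteq> b'" "{a,b} \<noteq> {a',b'}" "r a \<noteq> r b \<or> r a' \<noteq> r b'"
    then have "(a,b,a',b') \<in> T" by (auto simp: T_def)
    from t(2)[OF this] show "(\<theta> ^ r a - \<theta> ^ r b) * (e ^ (q ^ a') - e ^ (q ^ b')) \<noteq> (\<theta> ^ r a' - \<theta> ^ r b') * (e ^ (q ^ a) - e ^ (q ^ b))"
      by (auto simp: P_def poly_monom mult.commute)
  qed
qed

text \<open>The evaluation map on the coefficient vectors in \<open>F\<close> is injective, hence bijective since \<open>F\<close> is finite.\<close>

lemma interpolation:
  assumes e: "e \<in> F" and inj: "\<And>a b. a < n \<Longrightarrow> b < n \<Longrightarrow> a \<noteq> b \<Longrightarrow> e ^ (q ^ a) \<noteq> e ^ (q ^ b)"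
    and A: "\<And>i. i < n \<Longrightarrow> A i \<in> F"
  obtains \<alpha> where "\<And>k. k < n \<Longrightarrow> \<alpha> k \<in> F" "\<And>i. i < n \<Longrightarrow> (\<Sum>k<n. \<alpha> k ^ (q ^ i) * e ^ k) = A i"
proof -
  define S where "S = (\<Pi>\<^sub>E i\<in>{..<n}. F)"
  define ev where "ev = (\<lambda>\<alpha>. \<lambda>i\<in>{..<n}. \<Sum>k<n. \<alpha> k ^ (q ^ i) * e ^ k)"
  have finF: "finite F" using cardF q_bounds(2) card.infinite by fastforce
  have finS: "finite S" unfolding S_def using finF by (intro finite_PiE) auto
  have "ev ` S \<subseteq> S"
  proof safe
    fix \<alpha> assume "\<alpha> \<in> S"
    then have "\<And>k. k < n \<Longrightarrow> \<alpha> k \<in> F" by (auto simp: S_def)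
    then show "ev \<alpha> \<in> S" unfolding ev_def S_def using e by (auto intro!: F_sum F_mult F_pow)
  qed
  moreover have "inj_on ev S"
  proof (rule inj_onI)
    fix \<alpha> \<beta> assume S: "\<alpha> \<in> S" "\<beta> \<in> S" and eq: "ev \<alpha> = ev \<beta>"
    have ab: "\<And>k. k < n \<Longrightarrow> \<alpha> k \<in> F" "\<And>k. k < n \<Longrightarrow> \<beta> k \<in> F" using S by (auto simp: S_def)
    define \<delta> where "\<delta> = (\<lambda>k. \<alpha> k - \<beta> k)"
    have d: "\<delta> k \<in> F" if "k < n" for k using ab that by (auto simp: \<delta>_def intro: F_diff)
    define p where "p = (\<Sum>k<n. monom (\<delta> k) k)"
    have root: "poly p (e ^ (q ^ (n - i))) = 0" if i: "i < n" for i
    proof -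
      have "(\<Sum>k<n. \<alpha> k ^ (q ^ i) * e ^ k) = (\<Sum>k<n. \<beta> k ^ (q ^ i) * e ^ k)"
        using fun_cong[OF eq, of i] i by (simp add: ev_def)
      then have "(\<Sum>k<n. \<delta> k ^ (q ^ i) * e ^ k) = 0"
        by (simp add: \<delta>_def frob_diff left_diff_distrib sum_subtractf)
      \<comment> \<open>A further Frobenius power moves the conjugation from the coefficients to
        \<open>e\<close>, so that the n conjugates of \<open>e\<close> become roots of one
        polynomial of degree below n.\<close>
      then have "(\<Sum>k<n. \<delta> k ^ (q ^ i) * e ^ k) ^ (q ^ (n - i)) = 0" by simp
      then have "(\<Sum>k<n. (\<delta> k ^ (q ^ i)) ^ (q ^ (n - i)) * (e ^ k) ^ (q ^ (n - i))) = 0"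
        unfolding frob_sum power_mult_distrib .
      moreover have "(\<delta> k ^ (q ^ i)) ^ (q ^ (n - i)) = \<delta> k" if "k < n" for k
      proof -
        have "(\<delta> k ^ (q ^ i)) ^ (q ^ (n - i)) = \<delta> k ^ (q ^ (i + (n - i)))" by (simp only: power_add power_mult)
        then show ?thesis using d[OF that] i unfolding F by simp
      qed
      moreover have "(e ^ k) ^ (q ^ (n - i)) = (e ^ (q ^ (n - i))) ^ k" for k by (simp only: power_mult[symmetric] mult.commute)
      ultimately show ?thesis unfolding p_def by (simp add: poly_sum poly_monom)
    qed
    have p0: "p = 0"
    proof (rule ccontr)
      assume "p \<noteq> 0"
      define R where "R = (\<lambda>i. e ^ (q ^ (n - i))) ` {1..n}"
      have "inj_on (\<lambda>i. e ^ (q ^ (n - i))) {1..n}"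
      proof (rule inj_onI)
        fix i j assume ij: "i \<in> {1..n}" "j \<in> {1..n}" "e ^ (q ^ (n - i)) = e ^ (q ^ (n - j))"
        then have "n - i = n - j" using inj[of "n - i" "n - j"] by force
        then show "i = j" using ij by auto
      qed
      then have "card R = n" unfolding R_def by (simp add: card_image)
      moreover have "R \<subseteq> {x. poly p x = 0}"
      proof -
        have "poly p (e ^ (q ^ (n - n))) = 0" using root[of 0] n5 e unfolding F by simp
        then have "poly p (e ^ (q ^ (n - i))) = 0" if "i \<in> {1..n}" for i using that root[of i] by (cases "i = n") auto
        then show ?thesis unfolding R_def by auto
      qed
      then have "card R \<le> card {x. poly p x = 0}" using \<open>p \<noteq> 0\<close> by (intro card_mono poly_roots_finite)
      then have "card R \<le> degree p" using card_poly_roots_bound[OF \<open>p \<noteq> 0\<close>] by linarith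
      moreover have "degree p < n" unfolding p_def using n5
        by (intro degree_sum_less) (auto intro: le_less_trans[OF degree_monom_le])
      ultimately show False by simp
    qed
    have "\<delta> k = 0" if "k < n" for k
    proof -
      have "coeff p k = \<delta> k" unfolding p_def using that by (simp add: coeff_sum)
      then show ?thesis using p0 by simp
    qed
    then show "\<alpha> = \<beta>" using S unfolding S_def \<delta>_def by (intro PiE_ext[of \<alpha> "{..<n}" "\<lambda>_. F"]) auto
  qed
  ultimately have im: "ev ` S = S" using finS by (intro endo_inj_surj)
  have "restrict A {..<n} \<in> S" using A by (auto simp: S_def)
  then obtain \<alpha> where "\<alpha> \<in> S" "ev \<alpha> = restrict A {..<n}" using im by (metis imageE)
  note a = this
  have "(\<Sum>k<n. \<alpha> k ^ (q ^ i) * e ^ k) = A i" if "i < n" for i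
    using fun_cong[OF a(2), of i] that by (simp add: ev_def)
  then show thesis using that[of \<alpha>] a(1) by (auto simp: S_def)
qed

end

text \<open>The special point is x0 = e. \<open>A i\<close> is the value there of the conjugate
  polynomial a_i, and b_i takes the value 1 for i = 0 and 0 otherwise, so that s enters the fibre
  through X_0 alone.\<close>

locale norm_fibre = norm_curve q n I J K F c for q n I J :: nat and K F :: "'k::alg_closed_field set" and c :: 'k +
  fixes e :: 'k and A \<alpha> \<beta> :: "nat \<Rightarrow> 'k" and i1 :: nat
  assumes e: "e \<in> F" and inj: "\<And>a b. a < n \<Longrightarrow> b < n \<Longrightarrow> a \<noteq> b \<Longrightarrow> e ^ (q ^ a) \<noteq> e ^ (q ^ b)"
    and gen: "\<And>a b a' b'. a < n \<Longrightarrow> b < n \<Longrightarrow> a' < n \<Longrightarrow> b' < n \<Longrightarrow> a \<noteq> b \<Longrightarrow> a' \<noteq> b' \<Longrightarrow> {a,b} \<noteq> {a',b'} \<Longrightarrow> A a \<noteq> A b \<or> A a' \<noteq> A b'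
       \<Longrightarrow> (A a - A b) * (e ^ (q ^ a') - e ^ (q ^ b')) \<noteq> (A a' - A b') * (e ^ (q ^ a) - e ^ (q ^ b))"
    and AJ: "A J = A (n - J)"
    and i1: "i1 < n" "i1 \<noteq> 0" "i1 \<noteq> n - I" "A ((i1 + I) mod n) = A i1"
    and AI: "\<And>i. i < n \<Longrightarrow> i \<noteq> 0 \<Longrightarrow> i \<noteq> n - I \<Longrightarrow> i \<noteq> i1 \<Longrightarrow> A ((i + I) mod n) \<noteq> A i"
    and AJ': "\<And>i. i < n \<Longrightarrow> i \<noteq> 0 \<Longrightarrow> i \<noteq> n - J \<Longrightarrow> A ((i + J) mod n) \<noteq> A i"
    and AIJ: "A I \<noteq> A J" "A (n - I) \<noteq> A J"
    and \<alpha>F: "\<And>k. k < n \<Longrightarrow> \<alpha> k \<in> F" and \<beta>F: "\<And>k. k < n \<Longrightarrow> \<beta> k \<in> F"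
    and \<alpha>A: "\<And>i. i < n \<Longrightarrow> (\<Sum>k<n. \<alpha> k ^ (q ^ i) * e ^ k) = A i"
    and \<beta>A: "\<And>i. i < n \<Longrightarrow> (\<Sum>k<n. \<beta> k ^ (q ^ i) * e ^ k) = (if i = 0 then 1 else 0)"
begin

definition Xl :: "nat \<Rightarrow> (nat \<Rightarrow> 'k poly) \<Rightarrow> 'k poly" where
  "Xl i v = (\<Sum>k<n. [:\<alpha> k ^ (q ^ i):] * v 0 ^ k) + v 1 * (\<Sum>k<n. [:\<beta> k ^ (q ^ i):] * v 0 ^ k) + [:e ^ (q ^ i):] * v 2"

definition G :: "(nat \<Rightarrow> 'k poly) \<Rightarrow> 'k poly" where
  "G v = (\<Prod>i<n. Xl (i + I) v - Xl i v) - [:c:] * (\<Prod>i<n. Xl (i + J) v - Xl i v)"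

definition Xc :: "nat \<Rightarrow> 'k \<Rightarrow> 'k \<Rightarrow> 'k \<Rightarrow> 'k" where
  "Xc i x s t = (\<Sum>k<n. \<alpha> k ^ (q ^ i) * x ^ k) + s * (\<Sum>k<n. \<beta> k ^ (q ^ i) * x ^ k) + e ^ (q ^ i) * t"

definition Gk :: "'k \<Rightarrow> 'k \<Rightarrow> 'k \<Rightarrow> 'k" where
  "Gk x s t = (\<Prod>i<n. Xc (i + I) x s t - Xc i x s t) - c * (\<Prod>i<n. Xc (i + J) x s t - Xc i x s t)"

lemma poly_Xl: "poly (Xl i v) y = Xc i (poly (v 0) y) (poly (v 1) y) (poly (v 2) y)"
  by (simp add: Xl_def Xc_def poly_sum poly_power)

lemma poly_G: "poly (G v) y = Gk (poly (v 0) y) (poly (v 1) y) (poly (v 2) y)"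
  by (simp add: G_def Gk_def poly_prod poly_Xl)

lemma Xl_per: "Xl (i + n) = Xl i"
  unfolding Xl_def by (intro ext) (simp add: F_per[OF e] F_per[OF \<alpha>F] F_per[OF \<beta>F])

lemma Xc_per: "Xc (i + n) x s t = Xc i x s t"
  using poly_Xl[of "i + n" "vec3 [:x:] [:s:] [:t:]" 0] poly_Xl[of i "vec3 [:x:] [:s:] [:t:]" 0]
  by (simp add: Xl_per vec3_def)

lemma Xl_mod: "Xl (i mod n) = Xl i"
proof -
  have "Xl (j + n * m) = Xl j" for j m
  proof (induction m)
    case (Suc m)
    have "Xl (j + n * Suc m) = Xl ((j + n * m) + n)" by (simp add: algebra_simps)
    then show ?case using Xl_per Suc by simp
  qed simp
  from this[of "i mod n" "i div n"] show ?thesis by simp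
qed

text \<open>The weight n of t is chosen so that all parts of a conjugate weigh at most n: a_i has
  degree at most n - 1 in x, and s b_i weighs at most 1 + (n - 1).\<close>

lemma G_pw: "pwR n 3 (int (n * n)) G"
proof -
  have s: "pwR n 3 (int n - 1) (\<lambda>v. \<Sum>k<n. [:f k:] * v 0 ^ k)" for f :: "nat \<Rightarrow> 'k"
  proof (rule pw_sum)
    fix k assume "k \<in> {..<n}"
    then have k: "k < n" by simp
    have "pwR n 3 1 (\<lambda>v::nat \<Rightarrow> 'k poly. v 0)" by (rule pw.var) (auto simp: wtR_def)
    from pw_power[OF this, of k] have p: "pwR n 3 (int k) (\<lambda>v::nat \<Rightarrow> 'k poly. v 0 ^ k)" by simp
    have cst: "pwR n 3 0 (\<lambda>v::nat \<Rightarrow> 'k poly. [:f k:])" by (rule pw.const) auto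
    show "pwR n 3 (int n - 1) (\<lambda>v. [:f k:] * v 0 ^ k)" by (rule pw_mult'[OF cst p]) (use k in auto)
  qed
  have Xp: "pwR n 3 (int n) (Xl i)" for i
  proof -
    have v1: "pwR n 3 1 (\<lambda>v::nat \<Rightarrow> 'k poly. v 1)" by (rule pw.var) (auto simp: wtR_def)
    have 2: "pwR n 3 (int n) (\<lambda>v. v 1 * (\<Sum>k<n. [:\<beta> k ^ (q ^ i):] * v 0 ^ k))"
      by (rule pw_mult'[OF v1 s]) auto
    have v2: "pwR n 3 (int n) (\<lambda>v::nat \<Rightarrow> 'k poly. v 2)" by (rule pw.var) (auto simp: wtR_def)
    have cst: "pwR n 3 0 (\<lambda>v::nat \<Rightarrow> 'k poly. [:e ^ (q ^ i):])" by (rule pw.const) auto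
    have 3: "pwR n 3 (int n) (\<lambda>v. [:e ^ (q ^ i):] * v 2)" by (rule pw_mult'[OF cst v2]) auto
    have 1: "pwR n 3 (int n) (\<lambda>v. \<Sum>k<n. [:\<alpha> k ^ (q ^ i):] * v 0 ^ k)"
      by (rule pw_mono[OF s]) auto
    show ?thesis unfolding Xl_def by (intro pw.add 1 2 3)
  qed
  have pr: "pwR n 3 (int (n * n)) (\<lambda>v. \<Prod>i<n. Xl (i + m) v - Xl i v)" for m
    using pw_prod[of "{..<n}" "wtR n" "\<lambda>_. 0" "range (\<lambda>c::'k. [:c:])" 3 "int n" 0 "\<lambda>i v. Xl (i + m) v - Xl i v"] pw_diff[OF Xp Xp]
    by simp
  have cst: "pwR n 3 0 (\<lambda>v::nat \<Rightarrow> 'k poly. [:c:])" by (rule pw.const) auto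
  have "pwR n 3 (int (n * n)) (\<lambda>v. [:c:] * (\<Prod>i<n. Xl (i + J) v - Xl i v))" by (rule pw_mult'[OF cst pr]) auto
  then show ?thesis unfolding G_def by (intro pw_diff pr) auto
qed

lemma e_notin_K: "e \<notin> K"
  using inj[of 0 1] n5 unfolding K by auto

text \<open>The coefficient of t^n is the difference of the two sides of the norm equation at z = e,
  and \<open>e\<close>, lying outside K, is not a solution.\<close>

lemma G_lead: "coeff (G (\<lambda>i. if i = 2 then [:0,1:] else 0)) n \<noteq> 0"
proof -
  let ?v = "\<lambda>i::nat. if i = 2 then [:0,1::'k:] else 0"
  have Xl: "Xl i ?v = [:\<alpha> 0 ^ (q ^ i), e ^ (q ^ i):]" for i
  proof -
    have "(\<Sum>k<n. [:\<alpha> k ^ (q ^ i):] * (0::'k poly) ^ k) = [:\<alpha> 0 ^ (q ^ i):]"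
      using n5 by (simp add: power_0_left if_distrib[of "\<lambda>x. _ * x"] sum.delta cong: if_cong)
    then show ?thesis unfolding Xl_def by simp
  qed
  have "coeff (\<Prod>i<n. Xl (i + m) ?v - Xl i ?v) n = (\<Prod>i<n. e ^ (q ^ (i + m)) - e ^ (q ^ i))" for m
    using coeff_prod_linear[of "{..<n}" "\<lambda>i. \<alpha> 0 ^ (q ^ (i + m)) - \<alpha> 0 ^ (q ^ i)" "\<lambda>i. e ^ (q ^ (i + m)) - e ^ (q ^ i)"]
    unfolding Xl by simp
  then have "coeff (G ?v) n = (\<Prod>i<n. e ^ (q ^ (i + I)) - e ^ (q ^ i)) - c * (\<Prod>i<n. e ^ (q ^ (i + J)) - e ^ (q ^ i))"
    unfolding G_def by simp
  then show ?thesis using empt[OF e] e_notin_K by auto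
qed

lemma Xc_frob: "Xc i x s t ^ q = Xc (Suc i) (x ^ q) (s ^ q) (t ^ q)"
proof -
  have *: "(y ^ (q ^ i)) ^ q = y ^ (q ^ Suc i)" for y :: 'k by (simp flip: power_mult add: mult.commute)
  have **: "(y ^ k) ^ q = (y ^ q) ^ k" for y :: 'k and k by (simp flip: power_mult add: mult.commute)
  have "(\<Sum>k<n. f k ^ (q ^ i) * x ^ k) ^ q = (\<Sum>k<n. f k ^ (q ^ Suc i) * (x ^ q) ^ k)" for f :: "nat \<Rightarrow> 'k"
  proof -
    have "(\<Sum>k<n. f k ^ (q ^ i) * x ^ k) ^ q = (\<Sum>k<n. (f k ^ (q ^ i)) ^ q * (x ^ k) ^ q)"
      using frob_sum[of "\<lambda>k. f k ^ (q ^ i) * x ^ k" "{..<n}" 1] by (simp only: power_one_right power_mult_distrib)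
    then show ?thesis unfolding * by (simp only: **)
  qed
  then show ?thesis unfolding Xc_def frob power_mult_distrib * by simp
qed

text \<open>Frobenius shifts the factors of both products cyclically and fixes
  \<open>c\<close>.\<close>

lemma Gk_frob: "Gk (x ^ q) (s ^ q) (t ^ q) = Gk x s t ^ q"
proof -
  have "(\<Prod>i<n. Xc (i + m) (x ^ q) (s ^ q) (t ^ q) - Xc i (x ^ q) (s ^ q) (t ^ q)) = (\<Prod>i<n. Xc (i + m) x s t - Xc i x s t) ^ q" for m
  proof -
    have "(\<Prod>i<n. Xc (i + m) x s t - Xc i x s t) ^ q = (\<Prod>i<n. Xc (Suc i + m) (x ^ q) (s ^ q) (t ^ q) - Xc (Suc i) (x ^ q) (s ^ q) (t ^ q))"
      using frob_diff[where i = 1] by (simp add: prod_power_distrib Xc_frob)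
    also have "\<dots> = (\<Prod>i<n. Xc (i + m) (x ^ q) (s ^ q) (t ^ q) - Xc i (x ^ q) (s ^ q) (t ^ q))"
      by (rule prod_cyclic_shift) (use Xc_per[of m] Xc_per[of 0] in \<open>simp add: add.commute\<close>)
    finally show ?thesis by simp
  qed
  moreover have "c ^ q = c" using c unfolding K by simp
  ultimately show ?thesis unfolding Gk_def using frob_diff[where i = 1] by (simp add: power_mult_distrib)
qed

section \<open>Base points over which the family may degenerate into K\<close>

definition ap :: "nat \<Rightarrow> 'k poly" where "ap i = (\<Sum>k<n. monom (\<alpha> k ^ (q ^ i)) k)"
definition bp :: "nat \<Rightarrow> 'k poly" where "bp i = (\<Sum>k<n. monom (\<beta> k ^ (q ^ i)) k)"

lemma Xc_poly: "Xc i x s t = poly (ap i) x + s * poly (bp i) x + e ^ (q ^ i) * t"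
  unfolding Xc_def ap_def bp_def by (simp add: poly_sum poly_monom)

lemma deg_abp: "degree (ap i) \<le> n - 1" "degree (bp i) \<le> n - 1"
  unfolding ap_def bp_def by (auto intro!: degree_sum_le order.trans[OF degree_monom_le])

text \<open>If all conjugates of \<open>z\<close> agree, then \<open>(1, s, t)\<close> is in the kernel of the \<open>3 \<times> 3\<close> matrix of differences with determinant \<open>\<Delta>\<close>.\<close>

definition \<Delta> :: "'k poly" where
  "\<Delta> = (let a = (\<lambda>i. ap i - ap J); b = (\<lambda>i. bp i - bp J); d = (\<lambda>i. e ^ (q ^ i) - e ^ (q ^ J)) in
     smult (d (n - I)) (a 0 * b I - a I * b 0) - smult (d I) (a 0 * b (n - I) - a (n - I) * b 0) + smult (d 0) (a I * b (n - I) - a (n - I) * b I))"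

lemma \<Delta>_root:
  assumes "\<And>i. i < n \<Longrightarrow> Xc i x s t = z"
  shows "poly \<Delta> x = 0"
proof -
  have a: "poly (ap i) x - poly (ap J) x = - s * (poly (bp i) x - poly (bp J) x) - t * (e ^ (q ^ i) - e ^ (q ^ J))" if "i < n" for i
    using assms[OF that] assms[OF J(2)] unfolding Xc_poly by (simp add: algebra_simps) algebra
  have l: "0 < n" "n - I < n" using n5 I by auto
  have det: "dn * ((- s * b0 - t * d0) * bI - (- s * bI - t * dI) * b0) - dI * ((- s * b0 - t * d0) * bn - (- s * bn - t * dn) * b0)
     + d0 * ((- s * bI - t * dI) * bn - (- s * bn - t * dn) * bI) = 0" for b0 bI bn d0 dI dn :: 'k
    by (simp add: algebra_simps)
  show ?thesis unfolding \<Delta>_def Let_def poly_diff poly_add poly_smult poly_mult a[OF l(1)] a[OF l(2)] a[OF I(2)] by (rule det)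
qed

lemma \<Delta>_degree: "degree \<Delta> \<le> 2 * n"
proof -
  have d: "degree (ap i - ap J) \<le> n - 1" "degree (bp i - bp J) \<le> n - 1" for i using deg_abp by (auto intro: degree_diff_le)
  have "degree ((ap i - ap J) * (bp j - bp J)) \<le> 2 * n" for i j
    using degree_mult_le[of "ap i - ap J" "bp j - bp J"] d(1)[of i] d(2)[of j] by linarith
  then show ?thesis unfolding \<Delta>_def Let_def
    by (intro degree_add_le degree_diff_le order.trans[OF degree_smult_le])
qed

lemma index_facts: "n - I < n" "n - J < n" "n - I \<noteq> 0" "n - J \<noteq> 0" "I \<noteq> n - I" "I \<noteq> n - J" "J \<noteq> n - I" "n - I \<noteq> n - J"
  using I J IJ I2 by auto

text \<open>At x = e only b_0 differs from 0, so the determinant collapses to a two-by-two minor in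
  the rows I and n - I, which is nonzero by genericity of the edges {I, J} and {n - I, J}.\<close>

lemma \<Delta>_nonzero: "\<Delta> \<noteq> 0"
proof
  assume "\<Delta> = 0"
  then have 0: "poly \<Delta> e = 0" by simp
  have a: "poly (ap i) e = A i" "poly (bp i) e = (if i = 0 then 1 else 0)" if "i < n" for i
    using \<alpha>A[OF that] \<beta>A[OF that] unfolding ap_def bp_def by (simp_all add: poly_sum poly_monom)
  have l: "0 < n" using n5 by simp
  have "(A I - A J) * (e ^ (q ^ (n - I)) - e ^ (q ^ J)) = (A (n - I) - A J) * (e ^ (q ^ I) - e ^ (q ^ J))"
    using 0 unfolding \<Delta>_def Let_def poly_diff poly_add poly_smult poly_mult a[OF l] a[OF J(2)] a[OF I(2)] a[OF index_facts(1)]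
    using I J index_facts by (simp add: algebra_simps)
  moreover have "{I, J} \<noteq> {n - I, J}" using index_facts by (auto simp: doubleton_eq_iff)
  ultimately show False using gen[of I J "n - I" J] I J IJ index_facts AIJ by auto
qed

text \<open>A K-rational zero makes the X_i the conjugates of one z in F that solves the norm
  equation. Then z is in K, all conjugates coincide, and \<open>\<Delta>\<close> vanishes at
  x.\<close>

lemma nonempty_fibre:
  assumes "x \<in> K" "s \<in> K" "t \<in> K" "poly \<Delta> x \<noteq> 0"
  shows "Gk x s t \<noteq> 0"
proof
  assume 0: "Gk x s t = 0"
  have st: "x ^ q = x" "s ^ q = s" "t ^ q = t" using assms unfolding K by auto
  define z where "z = Xc 0 x s t"
  have z: "Xc i x s t = z ^ (q ^ i)" for i
  proof (induction i)
    case (Suc i)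
    have "Xc (Suc i) x s t = Xc i x s t ^ q" using Xc_frob[of i x s t] st by simp
    then show ?case using Suc by (simp flip: power_mult add: mult.commute)
  qed (simp add: z_def)
  have "z \<in> F" unfolding F using z[of n] Xc_per[of 0 x s t] z_def by simp
  moreover have "(\<Prod>i<n. z ^ (q ^ (i + I)) - z ^ (q ^ i)) = c * (\<Prod>i<n. z ^ (q ^ (i + J)) - z ^ (q ^ i))"
    using 0 unfolding Gk_def z by simp
  ultimately have "z \<in> K" by (rule empt)
  then have "Xc i x s t = z" for i unfolding z by (rule K_pow)
  then show False using \<Delta>_root assms by blast
qed

text \<open>The conjugate X_i on the special fibre, for i \<noteq> 0, as a polynomial in t.\<close>

definition Xt :: "nat \<Rightarrow> 'k poly" where "Xt i = [:A i, e ^ (q ^ i):]"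
text \<open>The edges i, i + I that avoid the vertex 0, which is met exactly for i = 0 and i = n -
  I.\<close>

definition EI :: "nat set" where "EI = {..<n} - {0, n - I}"
definition EJ :: "nat set" where "EJ = {..<n} - {0, n - J}"
definition al :: "'k poly" where "al = (\<Prod>i\<in>EI. Xt ((i + I) mod n) - Xt i)"
definition be :: "'k poly" where "be = (\<Prod>i\<in>EJ. Xt ((i + J) mod n) - Xt i)"
text \<open>With \<open>s0\<close> and \<open>\<delta>\<close>, X_0 = u + X_J for u = s - s0 +
  \<delta> t. The J-edge starting at 0 then contributes just - u, and the constant term
  \<open>p0\<close> comes from the I-product alone.\<close>

definition s0 :: 'k where "s0 = A J - A 0"
definition \<delta> :: 'k where "\<delta> = e ^ (q ^ 0) - e ^ (q ^ J)"
definition p2 :: "'k poly" where "p2 = smult c be - al"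
definition p1 :: "'k poly" where "p1 = al * ((Xt I - Xt J) - (Xt J - Xt (n - I))) + smult c be * (Xt J - Xt (n - J))"
definition p0 :: "'k poly" where "p0 = (Xt I - Xt J) * (Xt J - Xt (n - I)) * al"

lemma mod_edge:
  assumes "m = I \<or> m = J" "i < n" "i \<noteq> 0" "i \<noteq> n - m"
  shows "(i + m) mod n < n" "(i + m) mod n \<noteq> 0" "(i + m) mod n \<noteq> i"
proof -
  have m: "0 < m" "m < n" using assms(1) I J by auto
  have "(i + m) mod n = (if i + m < n then i + m else i + m - n)" using m assms(2) by (auto simp: mod_if)
  then show "(i + m) mod n < n" "(i + m) mod n \<noteq> 0" "(i + m) mod n \<noteq> i" using m assms by (auto split: if_splits)
qed

lemma edges_differ:
  assumes "i < n" "j < n"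
  shows "{(i + I) mod n, i} \<noteq> {(j + J) mod n, j}"
proof
  have s: "(a + m) mod n = a + m \<or> (a + m) mod n + n = a + m" if "a < n" "m < n" for a m :: nat
    using that by (auto simp: mod_if)
  define y y' where "y = (i + I) mod n" and "y' = (j + J) mod n"
  have y: "y = i + I \<or> y + n = i + I" "y' = j + J \<or> y' + n = j + J" unfolding y_def y'_def using s assms I J by auto
  assume "{(i + I) mod n, i} = {(j + J) mod n, j}"
  then have "y = y' \<and> i = j \<or> y = j \<and> i = y'" unfolding y_def[symmetric] y'_def[symmetric] by (simp only: doubleton_eq_iff)
  then show False using y I J IJ assms by (elim disjE conjE) auto
qed

lemma X_e: "i < n \<Longrightarrow> i \<noteq> 0 \<Longrightarrow> Xl i (vec3 [:e:] s t) = pcompose (Xt i) t"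
  and X_e0: "Xl 0 (vec3 [:e:] s t) = [:A 0:] + s + [:e ^ (q ^ 0):] * t"
proof -
  have sm: "(\<Sum>k<n. [:f k ^ (q ^ i):] * [:e:] ^ k) = [:\<Sum>k<n. f k ^ (q ^ i) * e ^ k:]" for f :: "nat \<Rightarrow> 'k" and i
    by (intro poly_eqI) (simp add: poly_const_pow coeff_sum coeff_pCons mult.commute split: nat.splits)
  have X: "Xl i (vec3 [:e:] s t) = [:A i:] + s * [:if i = 0 then 1 else 0:] + [:e ^ (q ^ i):] * t" if "i < n" for i
  proof -
    have v: "vec3 [:e:] s t 0 = [:e:]" "vec3 [:e:] s t 1 = s" "vec3 [:e:] s t 2 = t" by (simp_all add: vec3_def)
    show ?thesis unfolding Xl_def v sm \<alpha>A[OF that] \<beta>A[OF that] ..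
  qed
  show "Xl i (vec3 [:e:] s t) = pcompose (Xt i) t" if "i < n" "i \<noteq> 0"
    using X[OF that(1)] that(2) by (simp add: Xt_def pcompose_pCons mult.commute)
  show "Xl 0 (vec3 [:e:] s t) = [:A 0:] + s + [:e ^ (q ^ 0):] * t"
    using X[of 0] n5 by simp
qed

text \<open>The variable s enters only through X_0, and the vertex 0 lies on exactly two edges of
  each product, those starting at 0 and at n - m.\<close>

lemma GQ: "G (vec3 [:e:] s t) = pcompose p2 t * (s - [:s0:] + [:\<delta>:] * t)\<^sup>2 + pcompose p1 t * (s - [:s0:] + [:\<delta>:] * t) + pcompose p0 t"
proof -
  define v where "v = vec3 [:e:] s t"
  define u where "u = s - [:s0:] + [:\<delta>:] * t"
  let ?X = "\<lambda>i. pcompose (Xt i) t"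
  have prod: "(\<Prod>i<n. Xl (i + m) v - Xl i v) = (?X m - Xl 0 v) * (Xl 0 v - ?X (n - m)) * (\<Prod>i\<in>{..<n} - {0, n - m}. ?X ((i + m) mod n) - ?X i)"
    if m: "m = I \<or> m = J" for m
  proof -
    have m': "0 < m" "m < n" using m I J by auto
    have "{..<n} = insert 0 (insert (n - m) ({..<n} - {0, n - m}))" using m' by auto
    then have "(\<Prod>i<n. Xl (i + m) v - Xl i v) = (\<Prod>i\<in>insert 0 (insert (n - m) ({..<n} - {0, n - m})). Xl (i + m) v - Xl i v)" by simp
    also have "\<dots> = (Xl (0 + m) v - Xl 0 v) * ((Xl (n - m + m) v - Xl (n - m) v) * (\<Prod>i\<in>{..<n} - {0, n - m}. Xl (i + m) v - Xl i v))"
      using m' by (subst prod.insert; simp)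
    also have "Xl (n - m + m) v = Xl 0 v" using m' Xl_per[of 0] by simp
    also have "Xl (0 + m) v = ?X m" using X_e[of m s t] m' by (simp add: v_def)
    also have "Xl (n - m) v = ?X (n - m)" using X_e[of "n - m" s t] m' by (simp add: v_def)
    also have "(\<Prod>i\<in>{..<n} - {0, n - m}. Xl (i + m) v - Xl i v) = (\<Prod>i\<in>{..<n} - {0, n - m}. ?X ((i + m) mod n) - ?X i)"
    proof (rule prod.cong[OF refl])
      fix i assume i: "i \<in> {..<n} - {0, n - m}"
      then have "Xl i v = ?X i" using X_e[of i s t] by (simp add: v_def)
      moreover have "Xl (i + m) v = ?X ((i + m) mod n)"
        using Xl_mod[of "i + m"] X_e[of "(i + m) mod n" s t] mod_edge[OF m, of i] i by (simp add: v_def)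
      ultimately show "Xl (i + m) v - Xl i v = ?X ((i + m) mod n) - ?X i" by simp
    qed
    finally show ?thesis by (simp only: mult.assoc)
  qed
  have X0: "Xl 0 v = u + ?X J" unfolding v_def X_e0 u_def s0_def \<delta>_def Xt_def by (simp add: pcompose_pCons smult_diff_left algebra_simps)
  have a: "(\<Prod>i\<in>{..<n} - {0, n - I}. ?X ((i + I) mod n) - ?X i) = pcompose al t"
    unfolding al_def EI_def pcompose_prod pcompose_diff ..
  have b: "(\<Prod>i\<in>{..<n} - {0, n - J}. ?X ((i + J) mod n) - ?X i) = pcompose be t"
    unfolding be_def EJ_def pcompose_prod pcompose_diff ..
  have "G v = (?X I - (u + ?X J)) * ((u + ?X J) - ?X (n - I)) * pcompose al t
    - [:c:] * ((?X J - (u + ?X J)) * ((u + ?X J) - ?X (n - J)) * pcompose be t)"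
    unfolding G_def prod[OF disjI1[OF refl]] prod[OF disjI2[OF refl]] a b X0 ..
  also have "\<dots> = pcompose p2 t * u\<^sup>2 + pcompose p1 t * u + pcompose p0 t"
  proof -
    have id: "(xI - (u + xJ)) * ((u + xJ) - xI') * la - cc * ((xJ - (u + xJ)) * ((u + xJ) - xJ') * lb)
      = (cc * lb - la) * u\<^sup>2 + (la * ((xI - xJ) - (xJ - xI')) + cc * lb * (xJ - xJ')) * u + (xI - xJ) * (xJ - xI') * la"
      for xI xJ xI' xJ' la lb cc :: "'k poly" by (simp add: power2_eq_square algebra_simps)
    show ?thesis unfolding p2_def p1_def p0_def pcompose_diff pcompose_add pcompose_mult pcompose_smult
      using id[of "?X I" "?X J" "?X (n - I)" "pcompose al t" "[:c:]" "?X (n - J)" "pcompose be t"] by simp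
  qed
  finally show ?thesis unfolding v_def u_def .
qed

section \<open>Non-degeneracy of the special fibre\<close>

lemma poly_Xt: "poly (Xt i) y = A i + y * e ^ (q ^ i)"
  by (simp add: Xt_def)

lemma edge_root:
  assumes "a < n" "b < n" "a' < n" "b' < n" "a \<noteq> b" "a' \<noteq> b'" "{a,b} \<noteq> {a',b'}" "A a \<noteq> A b \<or> A a' \<noteq> A b'"
    "poly (Xt a) y = poly (Xt b) y" "poly (Xt a') y = poly (Xt b') y"
  shows False
proof -
  have "A a - A b = - y * (e ^ (q ^ a) - e ^ (q ^ b))" "A a' - A b' = - y * (e ^ (q ^ a') - e ^ (q ^ b'))"
    using assms(9,10) unfolding poly_Xt by (simp_all add: algebra_simps eq_diff_eq diff_eq_eq)
  then show False using gen[OF assms(1-8)] by (simp only: mult_ac simp_thms)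
qed

text \<open>A common root would make two different edges collapse at once. If \<open>al\<close>
  vanishes, so does \<open>be\<close>, which gives an I-edge and a J-edge. Otherwise
  \<open>p0\<close> makes X_J equal to X_I or X_(n-I), and \<open>p2\<close> and \<open>p1\<close>
  then force the other of these two to equal X_(n-J).\<close>

lemma content:
  assumes "poly p2 y = 0" "poly p1 y = 0" "poly p0 y = 0"
  shows False
proof (cases "poly al y = 0")
  case True
  then have "poly be y = 0" using assms(1) c unfolding p2_def by simp
  then obtain j where j: "j \<in> EJ" "poly (Xt ((j + J) mod n)) y = poly (Xt j) y"
    unfolding be_def by (auto simp: poly_prod EJ_def)
  obtain i where i: "i \<in> EI" "poly (Xt ((i + I) mod n)) y = poly (Xt i) y"
    using True unfolding al_def by (auto simp: poly_prod EI_def)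
  have i': "i < n" "i \<noteq> 0" "i \<noteq> n - I" using i by (auto simp: EI_def)
  have j': "j < n" "j \<noteq> 0" "j \<noteq> n - J" using j by (auto simp: EJ_def)
  show False
    by (rule edge_root[of "(i + I) mod n" i "(j + J) mod n" j y])
      (use mod_edge[of I i] mod_edge[of J j] i j i' j' edges_differ[OF i'(1) j'(1)] AJ'[OF j'] in auto)
next
  case False
  have h: "c * poly be y = poly al y" using assms(1) unfolding p2_def by simp
  have "poly al y * ((poly (Xt I) y - poly (Xt J) y) - (poly (Xt J) y - poly (Xt (n - I)) y) + (poly (Xt J) y - poly (Xt (n - J)) y)) = 0"
    using assms(2) unfolding p1_def poly_add poly_mult poly_smult poly_diff h by (simp only: distrib_left)
  then have "(poly (Xt I) y - poly (Xt J) y) - (poly (Xt J) y - poly (Xt (n - I)) y) + (poly (Xt J) y - poly (Xt (n - J)) y) = 0"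
    using False by (subst (asm) mult_eq_0_iff) blast
  then have sum: "poly (Xt I) y - poly (Xt J) y + (poly (Xt (n - I)) y - poly (Xt (n - J)) y) = 0" by (simp add: algebra_simps)
  have "(poly (Xt I) y - poly (Xt J) y) * (poly (Xt J) y - poly (Xt (n - I)) y) = 0"
    using assms(3) False unfolding p0_def by simp
  then consider "poly (Xt I) y = poly (Xt J) y" | "poly (Xt J) y = poly (Xt (n - I)) y" by auto
  then show False
  proof cases
    case 1
    then have 2: "poly (Xt (n - I)) y = poly (Xt (n - J)) y" using sum by simp
    have "{I, J} \<noteq> {n - I, n - J}" using index_facts by (auto simp: doubleton_eq_iff)
    then show False using edge_root[of I J "n - I" "n - J" y] 1 2 I J IJ index_facts AIJ by auto
  next
    case 2
    then have 3: "poly (Xt I) y = poly (Xt (n - J)) y" using sum by simp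
    have "{J, n - I} \<noteq> {I, n - J}" using index_facts IJ by (auto simp: doubleton_eq_iff)
    then show False using edge_root[of J "n - I" I "n - J" y] 2 3 I J IJ index_facts AIJ by auto
  qed
qed

lemma deg_EI: "degree al \<le> n - 2" "degree be \<le> n - 2"
proof -
  have "card {0, n - I} = 2" "card {0, n - J} = 2" using index_facts by auto
  moreover have "{0, n - I} \<subseteq> {..<n}" "{0, n - J} \<subseteq> {..<n}" using index_facts n5 by auto
  ultimately have "card EI = n - 2" "card EJ = n - 2" unfolding EI_def EJ_def by (simp_all only: card_Diff_subset finite.intros card_lessThan)
  moreover have X: "degree (Xt a - Xt b) \<le> 1" for a b unfolding Xt_def by simp
  have "degree (\<Prod>i\<in>S. Xt (f i) - Xt i) \<le> card S" if "finite S" for S f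
    using degree_prod_sum_le[OF that, of "\<lambda>i. Xt (f i) - Xt i"] sum_bounded_above[of S "\<lambda>i. degree (Xt (f i) - Xt i)" 1] X
    by (simp add: o_def)
  then have "degree al \<le> card EI" "degree be \<le> card EJ" unfolding al_def be_def EI_def EJ_def by auto
  ultimately show "degree al \<le> n - 2" "degree be \<le> n - 2" by simp_all
qed

lemma deg_p: "degree p2 \<le> n" "degree p1 \<le> n" "degree p0 \<le> n"
proof -
  have X: "degree (Xt a - Xt b) \<le> 1" for a b unfolding Xt_def by simp
  have X2: "degree ((Xt I - Xt J) - (Xt J - Xt (n - I))) \<le> 1" using X degree_diff_le by blast
  have XX: "degree ((Xt I - Xt J) * (Xt J - Xt (n - I))) \<le> 2"
    using degree_mult_le[of "Xt I - Xt J" "Xt J - Xt (n - I)"] X[of I J] X[of J "n - I"] by linarith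
  have cb: "degree (smult c be) \<le> n - 2" using deg_EI by (intro order.trans[OF degree_smult_le])
  show "degree p2 \<le> n" unfolding p2_def using cb deg_EI by (intro degree_diff_le) auto
  have "degree (al * ((Xt I - Xt J) - (Xt J - Xt (n - I)))) \<le> n - 2 + 1" "degree (smult c be * (Xt J - Xt (n - J))) \<le> n - 2 + 1"
    using degree_mult_le[of al "(Xt I - Xt J) - (Xt J - Xt (n - I))"] degree_mult_le[of "smult c be" "Xt J - Xt (n - J)"]
      deg_EI(1) cb X2 X[of J "n - J"] by linarith+
  then show "degree p1 \<le> n" unfolding p1_def using n5 by (intro degree_add_le) linarith+
  have "degree p0 \<le> 2 + (n - 2)" unfolding p0_def
    using degree_mult_le[of "(Xt I - Xt J) * (Xt J - Xt (n - I))" al] deg_EI XX by linarith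
  then show "degree p0 \<le> n" using n5 by simp
qed

lemma i1_EI: "i1 \<in> EI" using i1 by (simp add: EI_def)

lemma al_0: "coeff al 0 = 0"
proof -
  have "poly al 0 = 0" unfolding al_def using i1_EI i1(4) by (auto simp: poly_prod poly_Xt EI_def)
  then show ?thesis by (simp add: poly_0_coeff_0)
qed

lemma p2_0: "coeff p2 0 \<noteq> 0"
proof -
  have "poly be 0 \<noteq> 0" unfolding be_def using AJ' by (auto simp: poly_prod poly_Xt EJ_def)
  then show ?thesis unfolding p2_def using al_0 c by (simp add: poly_0_coeff_0)
qed

lemma p1_0: "coeff p1 0 = 0"
  unfolding p1_def using al_0 AJ by (simp add: coeff_mult_0 Xt_def)

lemma p0_0: "coeff p0 0 = 0"
  unfolding p0_def using al_0 by (simp add: coeff_mult_0)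

text \<open>The only factor that vanishes at t = 0 is that of the edge at \<open>i1\<close>, and it
  vanishes simply because the corresponding conjugates of \<open>e\<close> differ.\<close>

lemma p0_1: "coeff p0 1 \<noteq> 0"
proof -
  define y where "y = (\<Prod>i\<in>EI - {i1}. Xt ((i + I) mod n) - Xt i)"
  define z where "z = e ^ (q ^ ((i1 + I) mod n)) - e ^ (q ^ i1)"
  define w where "w = (Xt I - Xt J) * (Xt J - Xt (n - I)) * y"
  have z: "z \<noteq> 0" unfolding z_def using inj mod_edge[of I i1] i1 by auto
  have "al = (Xt ((i1 + I) mod n) - Xt i1) * y" unfolding al_def y_def using i1_EI by (intro prod.remove) (auto simp: EI_def)
  also have "Xt ((i1 + I) mod n) - Xt i1 = [:0, z:]" unfolding Xt_def z_def using i1(4) by simp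
  finally have "p0 = [:0, z:] * w" unfolding p0_def w_def by (simp only: mult_ac)
  then have "coeff p0 1 = z * coeff w 0" by simp
  moreover have "poly w 0 \<noteq> 0" unfolding w_def y_def using AIJ AI
    by (auto simp: poly_prod poly_Xt EI_def)
  ultimately show ?thesis using z by (simp add: poly_0_coeff_0)
qed

lemma contradiction: False
proof -
  obtain D P Q R where DPQR: "pwR n 3 (int (n * n) - int n) D" "pwR n 6 (int (n * n) - 1) P" "pwR n 6 (int (n * n) - 1) Q"
    "pwR n 6 (int (n * n) - 2 * int n) R"
    "\<forall>v. G (shift6 v) = G v + v 5 * D v + v 3 * P v + v 4 * Q v + (v 5)\<^sup>2 * R v"
    using pwR_taylor[OF G_pw] by blast
  define Bad where "Bad = {x. poly \<Delta> x = 0}"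
  have Bad: "finite Bad" "card Bad \<le> 2 * n"
    unfolding Bad_def using \<Delta>_nonzero \<Delta>_degree card_poly_roots_bound[OF \<Delta>_nonzero] by (auto intro: poly_roots_finite)
  interpret ac: acf_curve n G D P Q R
    using n5 G_pw DPQR G_lead by unfold_locales auto
  have Gc: "ac.Gc env = Gk (env 0) (env 1) (env 2)" for env
    using poly_G[of "\<lambda>i. [:env i:]" 0] unfolding ac.Gc_def by (simp add: poly_0_coeff_0)
  interpret qf: quad_fibre n "\<lambda>s t. G (vec3 [:e:] s t)" p2 p1 p0 s0 \<delta>
    using GQ deg_p p2_0 p1_0 p0_0 p0_1 content ac.Pt_degree unfolding ac.Pt_def by unfold_locales blast+
  have pt: "ac.Gc (vec3 e s0 0) = 0 \<and> ac.g (vec3 e s0 0) \<noteq> 0"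
  proof -
    \<comment> \<open>An increment in t alone: the coefficient of Y is then the t-derivative at the
      special point.\<close>
    let ?v = "\<lambda>i::nat. if i = 0 then [:e:] else if i = 1 then [:s0:] else if i = 5 then [:0,1:] else 0"
    let ?c = "\<lambda>i. [:vec3 e s0 0 i:]"
    have "G (shift6 ?v) = G ?v + [:0,1:] * D ?v + [:0,1:]\<^sup>2 * R ?v" using DPQR(5)[rule_format, of ?v] by simp
    moreover have "G (shift6 ?v) = G (vec3 [:e:] [:s0:] [:0,1:])"
      by (rule pw_cong[OF G_pw]) (auto simp: shift6_def vec3_def less_Suc_eq numeral_3_eq_3)
    moreover have "G ?v = G ?c" by (rule pw_cong[OF G_pw]) (auto simp: vec3_def)
    moreover have "D ?v = D ?c" by (rule pw_cong[OF DPQR(1)]) (auto simp: vec3_def)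
    ultimately have eq: "G (vec3 [:e:] [:s0:] [:0,1:]) = [:ac.Gc (vec3 e s0 0):] + [:0,1:] * [:ac.g (vec3 e s0 0):] + [:0,1:]\<^sup>2 * R ?v"
      by (simp only: ac.G_const ac.D_const)
    \<comment> \<open>At s = s0 the coordinate u is \<delta> t, so the first-order coefficient in t
      reduces to that of \<open>p0\<close>.\<close>
    have eq': "G (vec3 [:e:] [:s0:] [:0,1:]) = [:0,\<delta>:] * ([:0,\<delta>:] * p2) + [:0,\<delta>:] * p1 + p0"
      unfolding GQ by (simp add: pcompose_idR power2_eq_square algebra_simps)
    have "ac.Gc (vec3 e s0 0) = coeff (G (vec3 [:e:] [:s0:] [:0,1:])) 0" unfolding eq by (simp add: coeff_mult_0 power2_eq_square)
    also have "\<dots> = 0" unfolding eq' using p0_0 by (simp add: coeff_mult_0)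
    finally have 1: "ac.Gc (vec3 e s0 0) = 0" .
    have "ac.g (vec3 e s0 0) = coeff (G (vec3 [:e:] [:s0:] [:0,1:])) 1" unfolding eq by (simp add: power2_eq_square)
    also have "\<dots> = coeff p0 1" unfolding eq' using p1_0 by simp
    finally show ?thesis using p0_1 1 by simp
  qed
  interpret pc: place_curve n G D P Q R q K Bad e s0
  proof unfold_locales
    show "(x + y) ^ q = x ^ q + y ^ q" for x y :: "'k poly" by (rule frobp)
    show "2 \<le> q" by (rule q_bounds)
    show "K = {x. x ^ q = x}" "card K = q" by (rule K, rule cardK)
    show "ac.Gc (\<lambda>i. env i ^ q) = ac.Gc env ^ q" for env unfolding Gc by (rule Gk_frob)
    show "finite Bad" by (rule Bad)
    show "ac.Gc (vec3 x s t) \<noteq> 0" if "x \<in> K" "x \<notin> Bad" "s \<in> K" "t \<in> K" for x s t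
      unfolding Gc using nonempty_fibre[of x s t] that by (simp add: vec3_def Bad_def)
    show "ac.Gc (vec3 e s0 0) = 0" "ac.g (vec3 e s0 0) \<noteq> 0" using pt by auto
  next
    fix d N :: nat and ee :: "nat \<Rightarrow> nat \<Rightarrow> 'k" and \<tau> :: "'k poly"
    assume "\<exists>k\<le>d. \<exists>i<n. ee k i \<noteq> 0" "coeff \<tau> 0 = 0" "2 * (n + 1) * (d + 1) < N" "[:0, 1:] ^ N dvd G (vec3 [:e:] [:s0, 1:] \<tau>)"
    then show "\<not> [:0, 1:] ^ Suc (2 * (n + 1) * (d + 1)) dvd (\<Sum>k\<le>d. \<Sum>i<n. [:ee k i:] * ([:s0, 1:] ^ k * \<tau> ^ i))"
      by (rule qf.irr)
  qed
  obtain a b m d where abmd: "card (tri (a + b + 2 * n * n * m)) * n * (n - 1) * (\<Sum>r<m. r + 1) < (card (tri a) * n) * (card (tri b) * n)"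
    "(n - 1) * card (tri (d + 2 * n * n)) < n * card (tri d)" "m \<le> q" "2 * (n + 1) * (a + 1) < q"
    "a + n * n + q * (b + n * n) < m * (q - card Bad - (d + 2 * n * n))"
    "a + n * n + q * (b + n * n) + (d + 2 * n * n) < q * q"
    using stepanov_parameters[OF n5 qbig Bad(2)] by blast
  show False using pc.no_such_curve[OF abmd] .
qed

end

lemma (in norm_curve) contradiction: False
proof -
  obtain r i1 where r: "\<forall>i<n. r i < n" "r J = r (n - J)" and i1: "i1 < n" "i1 \<noteq> 0" "i1 \<noteq> n - I" "r ((i1 + I) mod n) = r i1"
    and rI: "\<forall>i<n. i \<noteq> 0 \<longrightarrow> i \<noteq> n - I \<longrightarrow> i \<noteq> i1 \<longrightarrow> r ((i + I) mod n) \<noteq> r i"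
    and rJ: "\<forall>i<n. i \<noteq> 0 \<longrightarrow> i \<noteq> n - J \<longrightarrow> r ((i + J) mod n) \<noteq> r i"
    and rIJ: "r I \<noteq> r J" "r (n - I) \<noteq> r J"
    using gluing[OF n5 I J IJ I2 J3] by blast
  obtain e where e: "e \<in> F" and sid: "\<And>a b a' b'. a < n \<Longrightarrow> b < n \<Longrightarrow> a' < n \<Longrightarrow> b' < n \<Longrightarrow> a \<noteq> b \<Longrightarrow> {a,b} \<noteq> {a',b'}
       \<Longrightarrow> e ^ (q ^ a) - e ^ (q ^ b) \<noteq> e ^ (q ^ a') - e ^ (q ^ b')" using ex_generic_element by blast
  obtain \<theta> where t: "\<theta> \<in> F" and gen: "\<And>a b a' b'. a < n \<Longrightarrow> b < n \<Longrightarrow> a' < n \<Longrightarrow> b' < n \<Longrightarrow> a \<noteq> b \<Longrightarrow> a' \<noteq> b' \<Longrightarrow> {a,b} \<noteq> {a',b'} \<Longrightarrow> r a \<noteq> r b \<or> r a' \<noteq> r b'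
       \<Longrightarrow> (\<theta> ^ r a - \<theta> ^ r b) * (e ^ (q ^ a') - e ^ (q ^ b')) \<noteq> (\<theta> ^ r a' - \<theta> ^ r b') * (e ^ (q ^ a) - e ^ (q ^ b))"
    using ex_generic_values[of r e] r(1) sid by blast
  define A where "A = (\<lambda>i. \<theta> ^ r i)"
  have inj: "e ^ (q ^ a) \<noteq> e ^ (q ^ b)" if "a < n" "b < n" "a \<noteq> b" for a b
    using sid[of a b a a] that by auto
  have i2: "(i1 + I) mod n < n" "(i1 + I) mod n \<noteq> i1"
  proof -
    have "(i1 + I) mod n = (if i1 + I < n then i1 + I else i1 + I - n)" using I i1(1) by (auto simp: mod_if)
    then show "(i1 + I) mod n < n" "(i1 + I) mod n \<noteq> i1" using I i1 by (auto split: if_splits)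
  qed
  have Ar: "A a = A b \<longleftrightarrow> r a = r b" if "a < n" "b < n" for a b
  proof
    assume eq: "A a = A b"
    show "r a = r b"
    proof (rule ccontr)
      assume ne: "r a \<noteq> r b"
      \<comment> \<open>The edge is tested against the degenerate one at \<open>i1\<close>: with A_a
        = A_b both sides of the genericity condition would be 0.\<close>
      then have "{a, b} \<noteq> {(i1 + I) mod n, i1}" using i1(4) by (auto simp: doubleton_eq_iff)
      from gen[OF that i2(1) i1(1) _ i2(2) this] ne show False using eq i1(4) by (auto simp: A_def)
    qed
  qed (simp add: A_def)
  obtain \<alpha> where \<alpha>: "\<And>k. k < n \<Longrightarrow> \<alpha> k \<in> F" "\<And>i. i < n \<Longrightarrow> (\<Sum>k<n. \<alpha> k ^ (q ^ i) * e ^ k) = A i"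
    using interpolation[OF e inj, of A] t by (auto simp: A_def F_pow)
  have F1: "(1::'k) \<in> F" unfolding F by simp
  have F01: "(if i = 0 then 1 else 0) \<in> F" for i :: nat using F_0 F1 by simp
  obtain \<beta> where \<beta>: "\<And>k. k < n \<Longrightarrow> \<beta> k \<in> F" "\<And>i. i < n \<Longrightarrow> (\<Sum>k<n. \<beta> k ^ (q ^ i) * e ^ k) = (if i = 0 then 1 else 0)"
    using interpolation[of e "\<lambda>i. if i = 0 then 1 else 0", OF e inj F01] by blast
  have l: "n - I < n" "n - J < n" "\<And>i. (i + I) mod n < n" "\<And>i. (i + J) mod n < n" using I J n5 by auto
  interpret norm_fibre q n I J K F c e A \<alpha> \<beta> i1
  proof unfold_locales
    show "(A a - A b) * (e ^ (q ^ a') - e ^ (q ^ b')) \<noteq> (A a' - A b') * (e ^ (q ^ a) - e ^ (q ^ b))"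
      if "a < n" "b < n" "a' < n" "b' < n" "a \<noteq> b" "a' \<noteq> b'" "{a,b} \<noteq> {a',b'}" "A a \<noteq> A b \<or> A a' \<noteq> A b'" for a b a' b'
      using gen[OF that(1-7)] that(8) Ar[OF that(1,2)] Ar[OF that(3,4)] unfolding A_def by blast
  qed (use e inj i1 r rI rJ rIJ \<alpha> \<beta> I J l Ar in auto)
  show False by (rule contradiction)
qed

section \<open>Finite fields and the norm\<close>

lemma power_card_closed:
  fixes x :: "'a::field"
  assumes "finite S" "0 \<notin> S" "x \<noteq> 0" "(*) x ` S = S"
  shows "x ^ card S = 1"
proof -
  have "prod id S = prod id ((*) x ` S)" using assms(4) by simp
  also have "\<dots> = (\<Prod>y\<in>S. x * y)" using assms(3) by (subst prod.reindex) (auto simp: inj_on_def)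
  also have "\<dots> = x ^ card S * prod id S" by (simp add: prod.distrib)
  finally show ?thesis using assms(1,2) by (simp add: prod_zero_iff)
qed

lemma geometric_sum_nat:
  fixes q :: nat
  assumes "q \<ge> 2"
  shows "(q ^ n - 1) div (q - 1) = (\<Sum>i<n. q ^ i)"
proof -
  have "(q - 1) * (\<Sum>i<n. q ^ i) = q ^ n - 1"
  proof (induction n)
    case (Suc n)
    have "q ^ n \<ge> 1" using assms by simp
    moreover have "(q - 1) * (\<Sum>i<Suc n. q ^ i) = q ^ n - 1 + (q * q ^ n - q ^ n)"
      unfolding sum.lessThan_Suc distrib_left Suc by (simp add: diff_mult_distrib)
    moreover have "q ^ n \<le> q * q ^ n" using assms by simp
    ultimately show ?case by simp
  qed simp
  then show ?thesis using assms by (metis nonzero_mult_div_cancel_left diff_is_0_eq not_less_eq_eq numeral_2_eq_2 One_nat_def)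
qed

lemma card_roots_power_eq:
  fixes q :: nat
  assumes "q \<ge> 2"
  shows "card {x :: 'k::field. x ^ q = x} \<le> q" "finite {x :: 'k. x ^ q = x}"
proof -
  define p where "p = monom 1 q - monom (1::'k) 1"
  have "coeff p q = 1" using assms unfolding p_def by simp
  then have p: "p \<noteq> 0" by auto
  have d: "degree p \<le> q" unfolding p_def using assms by (intro degree_diff_le order.trans[OF degree_monom_le]) auto
  have s: "{x :: 'k. x ^ q = x} = {x. poly p x = 0}" unfolding p_def by (auto simp: poly_monom)
  show "card {x :: 'k::field. x ^ q = x} \<le> q" "finite {x :: 'k. x ^ q = x}"
    unfolding s using p d card_poly_roots_bound[OF p] by (auto intro: poly_roots_finite)
qed

lemma card_roots_of_unity:
  fixes m :: nat
  assumes "m > 0"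
  shows "card {x :: 'k::field. x ^ m = 1} \<le> m" "finite {x :: 'k. x ^ m = 1}"
proof -
  define p where "p = monom 1 m - monom (1::'k) 0"
  have "coeff p m = 1" using assms unfolding p_def by simp
  then have p: "p \<noteq> 0" by auto
  have d: "degree p \<le> m" unfolding p_def using assms by (intro degree_diff_le order.trans[OF degree_monom_le]) auto
  have s: "{x :: 'k. x ^ m = 1} = {x. poly p x = 0}" unfolding p_def by (auto simp: poly_monom)
  show "card {x :: 'k::field. x ^ m = 1} \<le> m" "finite {x :: 'k. x ^ m = 1}"
    unfolding s using p d card_poly_roots_bound[OF p] by (auto intro: poly_roots_finite)
qed

locale finite_ext =
  fixes q n :: nat and K :: "'a::{field,finite} set"
  assumes pp: "primepow q" and n1: "n \<ge> 2" and card: "CARD('a) = q ^ n" and sub: "is_subfield K" and cardK: "card K = q"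
begin

lemma char: "normalization_semidom_class.prime CHAR('a)" "\<exists>k. q = CHAR('a) ^ k"
proof -
  have "CHAR('a) > 0" by (rule finite_imp_CHAR_pos) simp
  then show p: "normalization_semidom_class.prime CHAR('a)" by (rule prime_CHAR_semidom)
  have "(\<Sum>x\<in>(UNIV :: 'a set). x) = (\<Sum>x\<in>(UNIV :: 'a set). x + 1)"
    by (rule sum.reindex_bij_witness[of _ "\<lambda>x. x + 1" "\<lambda>x. x - 1"]) auto
  then have "of_nat CARD('a) = (0 :: 'a)" by (simp add: sum.distrib)
  then have "CHAR('a) dvd CARD('a)" by (simp only: of_nat_eq_0_iff_char_dvd)
  then have "CHAR('a) dvd q ^ n" unfolding card .
  then have d: "CHAR('a) dvd q" using p prime_dvd_power by blast
  obtain p' k where p': "normalization_semidom_class.prime p'" "q = p' ^ k" using pp unfolding primepow_def by blast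
  then have "CHAR('a) dvd p'" using d p prime_dvd_power by blast
  then have "CHAR('a) = p'" using p p' by (simp add: primes_dvd_imp_eq)
  then show "\<exists>k. q = CHAR('a) ^ k" using p' by blast
qed

lemma q2: "q \<ge> 2" using pp primepow_gt_Suc_0[of q] by simp

lemma frob: "(x + y) ^ q = x ^ q + y ^ q" for x y :: 'a
  using char freshmans_dream'[where ?'a = 'a] by blast

lemma frob_ac_poly: "(x + y) ^ q = x ^ q + y ^ q" for x y :: "'a alg_closure poly"
  using char freshmans_dream'[where ?'a = "'a alg_closure poly"] by (metis CHAR_alg_closure semiring_char_poly)

lemma frob_iterate: "(x + y) ^ (q ^ i) = x ^ (q ^ i) + y ^ (q ^ i)" for x y :: 'a
proof (induction i)
  case (Suc i)
  have "z ^ (q ^ Suc i) = (z ^ (q ^ i)) ^ q" for z :: 'a by (simp only: power_mult[symmetric] power_Suc mult.commute)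
  then show ?case using Suc frob by simp
qed simp

lemma frob_diff: "(x - y) ^ (q ^ i) = x ^ (q ^ i) - y ^ (q ^ i)" for x y :: 'a
  using frob_iterate[of "x - y" y i] by simp

lemma pow_qn: "x ^ (q ^ n) = x" for x :: 'a
proof (cases "x = 0")
  case False
  have "(*) x ` (UNIV - {0}) = UNIV - {0}"
  proof (intro equalityI subsetI)
    fix y assume "y \<in> UNIV - {0 :: 'a}"
    then show "y \<in> (*) x ` (UNIV - {0})" using False by (intro image_eqI[of _ _ "y / x"]) auto
  qed (use False in auto)
  then have "x ^ card (UNIV - {0 :: 'a}) = 1" using False by (intro power_card_closed) auto
  then have "x ^ (q ^ n - 1) = 1" by (simp add: card_Diff_subset card)
  moreover have "x ^ (q ^ n) = x * x ^ (q ^ n - 1)" using q2 by (metis power_eq_if power_not_zero not_numeral_le_zero)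
  ultimately show ?thesis by simp
qed (use q2 in simp)

lemma K_iff: "x \<in> K \<longleftrightarrow> x ^ q = x"
proof -
  have "x ^ q = x" if x: "x \<in> K" for x
  proof (cases "x = 0")
    case False
    have inv: "inverse x \<in> K" using sub x False unfolding is_subfield_def by blast
    have "(*) x ` (K - {0}) = K - {0}"
    proof (intro equalityI subsetI)
      fix y assume "y \<in> K - {0}"
      then show "y \<in> (*) x ` (K - {0})" using False inv sub unfolding is_subfield_def
        by (intro image_eqI[of _ _ "inverse x * y"]) auto
    qed (use False x sub in \<open>auto simp: is_subfield_def\<close>)
    then have "x ^ card (K - {0}) = 1" using False by (intro power_card_closed) auto
    moreover have "0 \<in> K" using sub unfolding is_subfield_def by blast
    ultimately have "x ^ (q - 1) = 1" by (simp add: card_Diff_subset cardK)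
    moreover have "x ^ q = x * x ^ (q - 1)" using q2 by (metis power_eq_if not_numeral_le_zero)
    ultimately show ?thesis by simp
  qed (use q2 in simp)
  then have "K \<subseteq> {x. x ^ q = x}" by auto
  moreover have "card {x :: 'a. x ^ q = x} \<le> card K" using card_roots_power_eq[OF q2, where 'k = 'a] cardK by simp
  ultimately have "K = {x. x ^ q = x}" by (intro card_seteq) auto
  then show ?thesis by auto
qed

lemma ac_K: "{x :: 'a alg_closure. x ^ q = x} = to_ac ` K" "card {x :: 'a alg_closure. x ^ q = x} = q"
proof -
  have s: "to_ac ` K \<subseteq> {x :: 'a alg_closure. x ^ q = x}" using K_iff by (auto simp flip: to_ac_power)
  have c: "card (to_ac ` K) = q" using cardK by (simp add: card_image inj_on_def)
  show "{x :: 'a alg_closure. x ^ q = x} = to_ac ` K"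
    using card_seteq[OF card_roots_power_eq(2)[OF q2] s] card_roots_power_eq(1)[OF q2, where 'k = "'a alg_closure"] c by simp
  then show "card {x :: 'a alg_closure. x ^ q = x} = q" using c by simp
qed

lemma qn2: "q ^ n \<ge> 2"
  using q2 n1 self_le_power[of q n] by linarith

lemma ac_F: "{x :: 'a alg_closure. x ^ (q ^ n) = x} = range to_ac" "card {x :: 'a alg_closure. x ^ (q ^ n) = x} = q ^ n"
proof -
  have s: "range to_ac \<subseteq> {x :: 'a alg_closure. x ^ (q ^ n) = x}" using pow_qn by (auto simp flip: to_ac_power)
  have c: "CARD('a) = card (range (to_ac :: 'a \<Rightarrow> _))" by (simp add: card_image inj_on_def)
  show "{x :: 'a alg_closure. x ^ (q ^ n) = x} = range to_ac"
    using card_seteq[OF card_roots_power_eq(2)[OF qn2] s] card_roots_power_eq(1)[OF qn2, where 'k = "'a alg_closure"] c card by simp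
  then show "card {x :: 'a alg_closure. x ^ (q ^ n) = x} = q ^ n" using c card by simp
qed

section \<open>The norm, Hilbert 90 and the norm equation\<close>

abbreviation N :: "'a \<Rightarrow> 'a" where "N \<equiv> fq_norm q n"

lemma N_prod: "N x = (\<Prod>i<n. x ^ (q ^ i))"
  unfolding fq_norm_def geometric_sum_nat[OF q2] power_sum ..

lemma N_mult: "N (x * y) = N x * N y"
  unfolding fq_norm_def by (rule power_mult_distrib)

lemma N_pow: "N (x ^ m) = N x ^ m"
  unfolding fq_norm_def by (simp only: power_mult[symmetric] mult.commute)

lemma pow_pow: "(x ^ (q ^ i)) ^ (q ^ j) = x ^ (q ^ (i + j))" for x :: 'a
  by (simp only: power_mult[symmetric] power_add)

lemma N_in_K: "N x \<in> K"
proof -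
  have "N x ^ q = (\<Prod>i<n. x ^ (q ^ Suc i))" unfolding N_prod prod_power_distrib
    by (intro prod.cong refl) (simp only: power_mult[symmetric] power_Suc mult.commute)
  also have "\<dots> = N x" unfolding N_prod by (rule prod_cyclic_shift) (simp add: pow_qn)
  finally show ?thesis unfolding K_iff .
qed

lemma N_frob: "N (x ^ (q ^ i)) = N x"
proof -
  have "N x ^ (q ^ i) = N x"
  proof (induction i)
    case (Suc i)
    have "N x ^ (q ^ Suc i) = (N x ^ (q ^ i)) ^ q" by (simp only: power_mult[symmetric] power_Suc mult.commute)
    then show ?case using Suc N_in_K K_iff by simp
  qed simp
  then show ?thesis unfolding N_pow .
qed

lemma N_eq_0: "N x = 0 \<longleftrightarrow> x = 0"
  unfolding N_prod using q2 n1 by (auto simp: power_0_left intro: exI[of _ 0])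

lemma N_1: "N 1 = 1" unfolding fq_norm_def by simp

lemma iterate: "z ^ (q ^ a) = z \<Longrightarrow> z ^ (q ^ (a * m)) = z" for z :: 'a
proof (induction m)
  case (Suc m)
  have "z ^ (q ^ (a * Suc m)) = (z ^ (q ^ a)) ^ (q ^ (a * m))" unfolding pow_pow by simp
  then show ?case using Suc by simp
qed simp

text \<open>z is fixed by the Frobenius powers with exponents a and n, hence by Frobenius itself,
  through a Bezout relation. The exponent \<open>i\<close> admits an equation between two conjugates
  in the form in which it arises.\<close>

lemma coprime_fixed:
  assumes "coprime a n" "z ^ (q ^ (i + a)) = z ^ (q ^ i)" "i \<le> n"
  shows "z \<in> K"
proof -
  have "(z ^ (q ^ a)) ^ (q ^ i) = z ^ (q ^ i)" using assms(2) unfolding pow_pow by (simp add: add.commute)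
  then have "((z ^ (q ^ a)) ^ (q ^ i)) ^ (q ^ (n - i)) = (z ^ (q ^ i)) ^ (q ^ (n - i))" by simp
  then have za: "z ^ (q ^ a) = z" unfolding pow_pow[of _ i] using assms(3) pow_qn by simp
  have "a \<noteq> 0" using assms(1) n1 by (intro notI) simp
  then obtain x y where xy: "a * x = n * y + 1" using bezout_nat[of a n] assms(1) by auto
  have "z = z ^ (q ^ (a * x))" using iterate[OF za] by simp
  also have "\<dots> = (z ^ (q ^ (n * y))) ^ (q ^ 1)" unfolding xy pow_pow ..
  also have "\<dots> = z ^ q" using iterate[OF pow_qn] by simp
  finally show ?thesis unfolding K_iff by simp
qed

text \<open>Hilbert 90 by counting: the fibres of \<open>y \<mapsto> y ^ (q ^ J) / y ^ (q ^ I)\<close> are cosets of the group \<open>K - {0}\<close>,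
  and the elements of norm 1 are roots of a polynomial of degree \<open>(q ^ n - 1) / (q - 1)\<close>.\<close>

lemma hilbert90:
  assumes IJ: "I < J" "J < n" "coprime (J - I) n" and u: "N u = 1"
  obtains y where "y \<noteq> 0" "u * y ^ (q ^ I) = y ^ (q ^ J)"
proof -
  define \<phi> where "\<phi> = (\<lambda>y::'a. y ^ (q ^ J) / y ^ (q ^ I))"
  define U where "U = UNIV - {0::'a}"
  define m where "m = (\<Sum>i<n. q ^ i)"
  have Nm: "N x = x ^ m" for x :: 'a unfolding fq_norm_def geometric_sum_nat[OF q2] m_def ..
  have m0: "m > 0" unfolding m_def using n1 q2 by (auto intro!: sum_pos2[of _ 0])
  have sub: "\<phi> ` U \<subseteq> {x. x ^ m = 1}"
  proof safe
    fix y assume "y \<in> U"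
    then have y: "y \<noteq> 0" by (simp add: U_def)
    have "N (\<phi> y) * N (y ^ (q ^ I)) = N (y ^ (q ^ J))" unfolding N_mult[symmetric] \<phi>_def using y by simp
    then have "N (\<phi> y) * N y = N y" unfolding N_frob .
    then show "\<phi> y ^ m = 1" unfolding Nm[symmetric] using N_eq_0 y by simp
  qed
  have fib: "card {y \<in> U. \<phi> y = v} \<le> q - 1" if "v \<in> \<phi> ` U" for v
  proof -
    obtain y0 where y0: "y0 \<noteq> 0" "v = \<phi> y0" using \<open>v \<in> \<phi> ` U\<close> by (auto simp: U_def)
    have "{y \<in> U. \<phi> y = v} \<subseteq> (*) y0 ` (K - {0})"
    proof
      fix y assume "y \<in> {y \<in> U. \<phi> y = v}"
      then have y: "y \<noteq> 0" "\<phi> y = \<phi> y0" using y0 by (auto simp: U_def)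
      then have "(y / y0) ^ (q ^ J) = (y / y0) ^ (q ^ I)" using y0 unfolding \<phi>_def by (simp add: power_divide field_simps)
      then have "(y / y0) ^ (q ^ (I + (J - I))) = (y / y0) ^ (q ^ I)" using IJ by simp
      from coprime_fixed[OF IJ(3) this] have "y / y0 \<in> K" using IJ by simp
      then show "y \<in> (*) y0 ` (K - {0})" using y y0 by (intro image_eqI[of _ _ "y / y0"]) auto
    qed
    then have "card {y \<in> U. \<phi> y = v} \<le> card ((*) y0 ` (K - {0}))" by (intro card_mono) auto
    also have "\<dots> \<le> card (K - {0})" by (rule card_image_le) auto
    also have "\<dots> = q - 1" using cardK sub unfolding is_subfield_def
      by (metis K_iff card_Diff_singleton power_0_left q2 not_numeral_le_zero)
    finally show ?thesis .
  qed
  have "card U = (\<Sum>v\<in>\<phi> ` U. card {y \<in> U. \<phi> y = v})"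
    using sum.image_gen[of U "\<lambda>_. 1::nat" \<phi>] by (simp add: U_def)
  also have "\<dots> \<le> card (\<phi> ` U) * (q - 1)" using sum_bounded_above[OF fib, of "\<phi> ` U" "\<lambda>v. v"] by simp
  finally have "q ^ n - 1 \<le> card (\<phi> ` U) * (q - 1)" by (simp add: U_def card_Diff_subset card)
  then have "m * (q - 1) \<le> card (\<phi> ` U) * (q - 1)"
    using div_times_less_eq_dividend[of "q ^ n - 1" "q - 1"] unfolding geometric_sum_nat[OF q2] m_def[symmetric] by linarith
  then have "m \<le> card (\<phi> ` U)" using q2 by simp
  then have "card {x :: 'a. x ^ m = 1} \<le> card (\<phi> ` U)" using card_roots_of_unity(1)[OF m0, where 'k = 'a] by linarith
  then have "\<phi> ` U = {x. x ^ m = 1}" using sub by (intro card_seteq) auto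
  then have "u \<in> \<phi> ` U" using u unfolding Nm by simp
  then obtain y where "y \<noteq> 0" "u = \<phi> y" by (auto simp: U_def)
  then show thesis using that[of y] by (simp add: \<phi>_def)
qed

lemma norm_orbit: "(\<Prod>i<n. z ^ (q ^ (i + m)) - z ^ (q ^ i)) = N (z ^ (q ^ m) - z)"
  unfolding N_prod frob_diff pow_pow by (simp add: add.commute)

lemma scattered_iff:
  assumes IJ: "I < J" "J < n" "coprime (J - I) n" and \<alpha>: "\<alpha> \<noteq> 0"
  shows "scattered K (monom 1 (q ^ I) + monom \<alpha> (q ^ J)) \<longleftrightarrow>
    (\<forall>z. N (z ^ (q ^ I) - z) = N (- \<alpha>) * N (z ^ (q ^ J) - z) \<longrightarrow> z \<in> K)"
proof -
  let ?f = "monom 1 (q ^ I) + monom \<alpha> (q ^ J)"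
  have f: "poly ?f x = x ^ (q ^ I) + \<alpha> * x ^ (q ^ J)" for x by (simp add: poly_monom)
  have lin: "linearized_poly (card K) ?f" unfolding linearized_poly_def cardK by (auto split: if_splits)
  have eq: "poly ?f (z * y) / (z * y) = poly ?f y / y \<longleftrightarrow> (z ^ (q ^ I) - z) * y ^ (q ^ I) = - \<alpha> * (z ^ (q ^ J) - z) * y ^ (q ^ J)"
    if "z \<noteq> 0" "y \<noteq> 0" for z y
  proof -
    have "a / (z * y) = b / y \<longleftrightarrow> a = z * b" for a b using that by (auto simp: divide_eq_eq)
    then have "poly ?f (z * y) / (z * y) = poly ?f y / y \<longleftrightarrow> poly ?f (z * y) = z * poly ?f y" .
    also have "\<dots> \<longleftrightarrow> (z ^ (q ^ I) - z) * y ^ (q ^ I) = - \<alpha> * (z ^ (q ^ J) - z) * y ^ (q ^ J)"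
      unfolding f power_mult_distrib by (auto simp: algebra_simps eq_diff_eq add_eq_0_iff2 diff_eq_eq)
    finally show ?thesis .
  qed
  have K0: "0 \<in> K" using sub unfolding is_subfield_def by blast
  show ?thesis
  proof
    assume sc: "scattered K ?f"
    show "\<forall>z. N (z ^ (q ^ I) - z) = N (- \<alpha>) * N (z ^ (q ^ J) - z) \<longrightarrow> z \<in> K"
    proof (intro allI impI)
      fix z assume z: "N (z ^ (q ^ I) - z) = N (- \<alpha>) * N (z ^ (q ^ J) - z)"
      define u w where "u = z ^ (q ^ I) - z" and "w = - \<alpha> * (z ^ (q ^ J) - z)"
      have Nuw: "N u = N w" unfolding u_def w_def N_mult z ..
      show "z \<in> K"
      proof (cases "z = 0 \<or> w = 0")
        case True
        then show ?thesis
        proof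
          \<comment> \<open>Then z is fixed by the I-th and the J-th power of Frobenius, and J - I
            being prime to n puts it in K.\<close>
          assume "w = 0"
          moreover from this have "u = 0" using Nuw N_eq_0[of u] N_eq_0[of w] by simp
          ultimately have "z ^ (q ^ (I + (J - I))) = z ^ (q ^ I)" using \<alpha> IJ unfolding u_def w_def by simp
          from coprime_fixed[OF IJ(3) this] show "z \<in> K" using IJ by simp
        qed (use K0 in simp)
      next
        case False
        then have w: "w \<noteq> 0" "z \<noteq> 0" by auto
        then have u: "u \<noteq> 0" using Nuw N_eq_0[of u] N_eq_0[of w] by simp
        have "N (u / w) * N w = N w" unfolding N_mult[symmetric] using w Nuw by simp
        then have "N (u / w) = 1" using w N_eq_0 by simp
        from hilbert90[OF IJ this] obtain y where y: "y \<noteq> 0" "u / w * y ^ (q ^ I) = y ^ (q ^ J)" .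
        then have "u * y ^ (q ^ I) = w * y ^ (q ^ J)" using w by (simp add: field_simps)
        then have "poly ?f (z * y) / (z * y) = poly ?f y / y" unfolding eq[OF w(2) y(1)] u_def w_def by (simp only: mult.assoc)
        moreover have "z * y \<noteq> 0" using y w by simp
        ultimately have "(z * y) / y \<in> K" using sc y(1) unfolding scattered_def by blast
        then show ?thesis using y by simp
      qed
    qed
  next
    assume all: "\<forall>z. N (z ^ (q ^ I) - z) = N (- \<alpha>) * N (z ^ (q ^ J) - z) \<longrightarrow> z \<in> K"
    show "scattered K ?f" unfolding scattered_def
    proof (intro conjI lin allI impI)
      fix x y assume xy: "x \<noteq> 0" "y \<noteq> 0" "poly ?f x / x = poly ?f y / y"
      define z where "z = x / y"
      have z: "z \<noteq> 0" "x = z * y" using xy by (auto simp: z_def)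
      have "(z ^ (q ^ I) - z) * y ^ (q ^ I) = - \<alpha> * (z ^ (q ^ J) - z) * y ^ (q ^ J)" using xy(3) eq[OF z(1) xy(2)] unfolding z(2) by blast
      then have "N (z ^ (q ^ I) - z) * N (y ^ (q ^ I)) = N (- \<alpha>) * N (z ^ (q ^ J) - z) * N (y ^ (q ^ J))" unfolding N_mult[symmetric] by simp
      then have "N (z ^ (q ^ I) - z) = N (- \<alpha>) * N (z ^ (q ^ J) - z)" unfolding N_frob using N_eq_0 xy by simp
      then show "x / y \<in> K" using all unfolding z_def by blast
    qed
  qed
qed

text \<open>For I + J = n the J-th Frobenius power maps z^(q^I) - z to z - z^(q^J), and the norm is
  invariant under it.\<close>

lemma norm_symmetric:
  assumes "I + J = n"
  shows "N (z ^ (q ^ J) - z) = N (- 1) * N (z ^ (q ^ I) - z)"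
proof -
  have "(z ^ (q ^ I) - z) ^ (q ^ J) = - 1 * (z ^ (q ^ J) - z)" unfolding frob_diff pow_pow assms pow_qn by simp
  then have "N (z ^ (q ^ I) - z) = N (- 1) * N (z ^ (q ^ J) - z)" by (metis N_frob N_mult)
  moreover have "N (- 1) * N (- 1) = 1" using N_mult[of "- 1" "- 1"] N_1 by simp
  ultimately show ?thesis by (simp flip: mult.assoc)
qed

lemma norm_equation_solvable:
  assumes n: "n \<ge> 5" and q: "q \<ge> 600 * n ^ 7" and I: "0 < I" "I < n" and J: "0 < J" "J < n" and IJ: "I \<noteq> J" "I + J \<noteq> n"
    and c: "c \<in> K" "c \<noteq> 0"
  shows "\<exists>z. z \<notin> K \<and> N (z ^ (q ^ I) - z) = c * N (z ^ (q ^ J) - z)"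
proof (rule ccontr)
  assume no: "\<not> ?thesis"
  have main: False if h: "0 < I" "I < n" "0 < J" "J < n" "I \<noteq> J" "I + J \<noteq> n" "2 * I \<noteq> n" "3 * J \<noteq> n" "3 * J \<noteq> 2 * n" "c \<in> K" "c \<noteq> 0"
    and empt: "\<And>z. N (z ^ (q ^ I) - z) = c * N (z ^ (q ^ J) - z) \<Longrightarrow> z \<in> K" for I J c
  proof -
    interpret norm_curve q n I J "to_ac ` K" "range to_ac :: 'a alg_closure set" "to_ac c"
    proof unfold_locales
      show "(x + y) ^ q = x ^ q + y ^ q" for x y :: "'a alg_closure poly" by (rule frob_ac_poly)
      show "to_ac ` K = {x :: 'a alg_closure. x ^ q = x}" "card (to_ac ` K :: 'a alg_closure set) = q" using ac_K by auto
      show "range to_ac = {x :: 'a alg_closure. x ^ q ^ n = x}" "card (range to_ac :: 'a alg_closure set) = q ^ n" using ac_F by auto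
    next
      fix z :: "'a alg_closure"
      assume "z \<in> range to_ac" and eq: "(\<Prod>i<n. z ^ q ^ (i + I) - z ^ q ^ i) = to_ac c * (\<Prod>i<n. z ^ q ^ (i + J) - z ^ q ^ i)"
      then obtain y where y: "z = to_ac y" by blast
      have t: "(\<Prod>i<n. z ^ q ^ (i + m) - z ^ q ^ i) = to_ac (N (y ^ (q ^ m) - y))" for m
        unfolding y norm_orbit[symmetric] to_ac_prod by simp
      have "to_ac (N (y ^ (q ^ I) - y)) = to_ac (c * N (y ^ (q ^ J) - y))" using eq unfolding t by simp
      then have "N (y ^ (q ^ I) - y) = c * N (y ^ (q ^ J) - y)" by (simp only: to_ac_eq_iff)
      then show "z \<in> to_ac ` K" unfolding y using empt[of y] by auto
    qed (use h n q in auto)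
    show False by (rule contradiction)
  qed
  \<comment> \<open>The conditions needed to arrange the degenerate edges may fail for (I, J) or for
    (J, I), but not for both; exchanging I and J replaces \<open>c\<close> by its inverse.\<close>
  consider "2 * I \<noteq> n" "3 * J \<noteq> n" "3 * J \<noteq> 2 * n" | "2 * J \<noteq> n" "3 * I \<noteq> n" "3 * I \<noteq> 2 * n"
    using I J IJ by linarith
  then show False
  proof cases
    case 1
    then show False using main[of I J c] I J IJ c no by blast
  next
    case 2
    have ic: "inverse c \<in> K" using sub c unfolding is_subfield_def by blast
    have "N (z ^ (q ^ J) - z) = inverse c * N (z ^ (q ^ I) - z) \<Longrightarrow> z \<in> K" for z
    proof -
      assume "N (z ^ (q ^ J) - z) = inverse c * N (z ^ (q ^ I) - z)"
      then have "N (z ^ (q ^ I) - z) = c * N (z ^ (q ^ J) - z)" using c by simp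
      then show "z \<in> K" using no by blast
    qed
    then show False using main[of J I "inverse c"] 2 I J IJ c ic by (simp add: add.commute)
  qed
qed

end

theorem theorem3p9:
  fixes q n I J :: nat
    and K :: "'a::{field,finite} set"
    and \<alpha> :: 'a
  assumes "primepow q"
    and "n \<ge> 5"
    and "0 < I" and "I < J" and "J < n"
    and "gcd (J - I) n = 1"
    and "real q \<ge> 2 powr (13 / 3 * real n + 4)"
    and "CARD('a) = q ^ n"
    and "is_subfield K" and "card K = q"
    and "\<alpha> \<noteq> 0"
  shows "scattered K (monom 1 (q ^ I) + monom \<alpha> (q ^ J)) \<longleftrightarrow>
           I + J = n \<and> fq_norm q n \<alpha> \<noteq> 1"
proof -
  interpret finite_ext q n K using assms by unfold_locales auto
  have cop: "coprime (J - I) n" using assms(6) by (simp add: coprime_iff_gcd_eq_1)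
  note sc = scattered_iff[OF assms(4,5) cop assms(11)]
  show ?thesis
  proof (cases "I + J = n")
    case True
    have fixed: "z \<in> K" if "N (z ^ (q ^ I) - z) = 0" for z
    proof -
      have "z ^ (q ^ I) = z" using that N_eq_0 by simp
      moreover from this have "z ^ (q ^ J) = z" using norm_symmetric[OF True, of z] that N_eq_0[of "z ^ (q ^ J) - z"] by simp
      ultimately have "z ^ (q ^ (I + (J - I))) = z ^ (q ^ I)" using assms(4) by simp
      from coprime_fixed[OF cop this] show ?thesis using assms(4,5) by simp
    qed
    \<comment> \<open>The sign drops out, as N(- \<alpha>) N(- 1) = N(\<alpha>).\<close>
    have eq: "N (- \<alpha>) * N (z ^ (q ^ J) - z) = N \<alpha> * N (z ^ (q ^ I) - z)" for z
      unfolding norm_symmetric[OF True] using N_mult[of "- \<alpha>" "- 1"] by (simp flip: mult.assoc)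
    have "(\<forall>z. N (z ^ (q ^ I) - z) = N \<alpha> * N (z ^ (q ^ I) - z) \<longrightarrow> z \<in> K) \<longleftrightarrow> N \<alpha> \<noteq> 1"
    proof
      assume all: "\<forall>z. N (z ^ (q ^ I) - z) = N \<alpha> * N (z ^ (q ^ I) - z) \<longrightarrow> z \<in> K"
      show "N \<alpha> \<noteq> 1"
      proof
        assume "N \<alpha> = 1"
        \<comment> \<open>With N(\<alpha>) = 1 every z satisfies the equation.\<close>
        then have "K = UNIV" using all by auto
        then have "q = q ^ n" using assms(8,10) by simp
        then have "q ^ 1 = q ^ n" by simp
        then show False using q2 assms(2) by (subst (asm) power_inject_exp) auto
      qed
    qed (use fixed in auto)
    then show ?thesis unfolding sc eq using True by simp
  next
    case False
    have "N (- \<alpha>) \<noteq> 0" using assms(11) N_eq_0[of "- \<alpha>"] by simp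
    then have "\<exists>z. z \<notin> K \<and> N (z ^ (q ^ I) - z) = N (- \<alpha>) * N (z ^ (q ^ J) - z)"
      using norm_equation_solvable[OF assms(2) q_large[OF assms(2,7)], of I J "N (- \<alpha>)"] assms(3-5) False N_in_K by simp
    then show ?thesis unfolding sc using False by blast
  qed
qed

end
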